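(* Let $(m_n)$ be any sequence of integers all greater than $1$, and set $\mu_n=\log m_n$, $t_n=\frac{3\log n}{2\mu_n}$ ($n\ge2$). Consider the family of $m_n$-shuffles $\{(S_n,Q_{n,m_n},U_n)\}$. Below $k$ denotes non-negative integers in infima and suprema. (A) Assume $\lim_{n\to\infty}m_n=\infty$ (equivalently $\mu_n\to\infty$). Then: (1) The family always has a $(\{t_n\},b_n)$ total variation cutoff for any positive $b_n=o(1)$, that is, $$\lim_{n\to\infty}\inf_{k<\{t_n\}}\|Q^k_{n,m_n}-U_n\|_{\mathrm{TV}}=1,\qquad \lim_{n\to\infty}\sup_{k>\{t_n\}}\|Q^k_{n,m_n}-U_n\|_{\mathrm{TV}}=0.$$ (2) If $\lim_{n\to\infty}|d(t_n)|\mu_n=\infty$, then there is a $(t_n,0)$ total variation cutoff, that is, $$\lim_{n\to\infty}\inf_{k\le t_n}\|Q^k_{n,m_n}-U_n\|_{\mathrm{TV}}=1,\qquad \lim_{n\to\infty}\sup_{k\ge t_n}\|Q^k_{n,m_n}-U_n\|_{\mathrm{TV}}=0.$$ (3) If $\liminf_{n\to\infty}|d(t_n)|\mu_n<\infty$, then there exists a sequence $(n_i)_{i\ge1}$ tending to infinity, with $t_{n_i}\ge 1/2$ (so $\{t_{n_i}\}$ is an integer), such that $$0<\liminf_{i\to\infty}\|Q^{\{t_{n_i}\}}_{n_i,m_{n_i}}-U_{n_i}\|_{\mathrm{TV}}\le\limsup_{i\to\infty}\|Q^{\{t_{n_i}\}}_{n_i,m_{n_i}}-U_{n_i}\|_{\mathrm{TV}}<1.$$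 In particular, there is no $(t_n,0)$ total variation cutoff. (4) If $\lim_{n\to\infty}d(t_n)\mu_n=L\in[-\infty,\infty]$ exists, then $$\lim_{n\to\infty}\|Q^{\lfloor\{t_n\}\rfloor}_{n,m_n}-U_n\|_{\mathrm{TV}}=\Psi(e^{L}).$$ (B) Assume $(m_n)$ is bounded. Then $t_n\to\infty$, there is a $(t_n,1)$ total variation cutoff and, for any fixed $k\in\mathbb Z$, $$0<\liminf_{n\to\infty}\|Q^{\{t_n\}+k}_{n,m_n}-U_n\|_{\mathrm{TV}}\le\limsup_{n\to\infty}\|Q^{\{t_n\}+k}_{n,m_n}-U_n\|_{\mathrm{TV}}<1.$$ In particular, the $(t_n,1)$ cutoff is optimal.
   Context: Shuffles. $S_n$ is the set of arrangements of a deck of $n$ cards labelled $1,\dots,n$, identified with the symmetric group (an arrangement $\sigma$ lists cards $\sigma(1),\dots,\sigma(n)$ from top to bottom); $U_n$ is the uniform distribution on $S_n$. A rising sequence of $\sigma$ is a maximal set of cards with consecutive face values appearing in increasing order in $\sigma$; $r(\sigma)$ is the number of rising sequences, i.e. $1$ plus the number of $i\in\{1,\dots,n-1\}$ such that card $i+1$ appears before card $i$. For an integer $m\ge1$, an $m$-shuffle cuts the deck into $m$ packs of sizes $(a_1,\dots,a_m)$ with multinomial probability $m^{-n}\frac{n!}{a_1!\cdots a_m!}$, then drops cards one by one, from pack $i$ with probability proportional to its current size. Its distribution $Q_{n,m}$, started from a deck in order, is given by (Bayer–Diaconis) $Q_{n,m}(\sigma)=m^{-n}\binom{n+m-r(\sigma)}{n}$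 (the binomial being $0$ if $m<r(\sigma)$), and this may be taken as the definition. For a probability $Q$ on $S_n$, $Q^k$ is the distribution after $k$ independent successive $Q$-shuffles from a deck in order, i.e. the $k$-fold convolution power of $Q$ on the symmetric group ($Q^0$ is the point mass at the identity). It is known that $Q_{n,m}*Q_{n,m'}=Q_{n,mm'}$. $\|\mu-\nu\|_{\mathrm{TV}}=\sup_{A}\{\mu(A)-\nu(A)\}$. Notation. For real $t>0$: $\{t\}=1/2$ if $0<t<1/2$, and $\{t\}=k$ if $k-1/2\le t<k+1/2$ for an integer $k\ge1$; $d(t)=1/2$ if $0<t<1/2$, and $d(t)=t-\{t\}$ if $t\ge1/2$. For $x\in[0,\infty]$, $\Psi(x)=\frac{1}{\sqrt{2\pi}}\int_{-x/(4\sqrt3)}^{x/(4\sqrt3)}e^{-t^2/2}\,dt$; $e^{-\infty}=0$, $e^{\infty}=\infty$. Cutoff. For probabilities $Q_n$ on $S_n$, the family $\{(S_n,Q_n,U_n)\}$ presents a $(t_n,b_n)$ total variation cutoff if: (1) $t_n>0$ for all sufficiently large $n$ and $b_n/t_n\to0$; (2) for $c\neq0$, setting $k=k(n,c)=\lceil t_n+cb_n\rceil$ if $c>0$ and $k=\lfloor t_n+cb_n\rfloor$ if $c<0$ (non-negative for large $n$), the functions $\overline f(c)=\limsup_{n\to\infty}\|Q_n^{k}-U_n\|_{\mathrm{TV}}$ and $\underline f(c)=\liminf_{n\to\infty}\|Q_n^{k}-U_n\|_{\mathrm{TV}}$ satisfy $\lim_{c\to\infty}\overline f(c)=0$ and $\lim_{c\to-\infty}\underline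 f(c)=1$. The cutoff is optimal if moreover $\underline f(c)>0$ and $\overline f(-c)<1$ for all $c>0$. (By group invariance the starting arrangement is irrelevant.) *)

theory Defs
  imports
    "HOL-Probability.Probability"
    "HOL-Combinatorics.Combinatorics"
begin

section \<open>Riffle shuffles as probability mass functions on the symmetric group\<close>

text \<open>
  An arrangement of cards \<open>1, ..., n\<close> is a function \<open>\<sigma>\<close> with \<open>\<sigma> permutes {1..n}\<close>, where \<open>\<sigma> j\<close>
  is the card at position \<open>j\<close> from the top; hence \<open>inv \<sigma> i\<close> is the position of card \<open>i\<close>.
\<close>

definition rising_sequences :: "nat \<Rightarrow> (nat \<Rightarrow> nat) \<Rightarrow> nat" where
  "rising_sequences n \<sigma> = 1 + card {i \<in> {1..<n}. inv \<sigma> (i + 1) < inv \<sigma> i}"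

text \<open>
  The subtraction below never truncates for \<open>n, m \<ge> 1\<close>, since there are at most \<open>n\<close> rising
  sequences; the binomial coefficient vanishes when \<open>m\<close> is smaller than their number.
\<close>

definition shuffle_mass :: "nat \<Rightarrow> nat \<Rightarrow> (nat \<Rightarrow> nat) \<Rightarrow> real" where
  "shuffle_mass n m \<sigma> =
     (if \<sigma> permutes {1..n}
      then real ((n + m - rising_sequences n \<sigma>) choose n) / real m ^ n else 0)"

text \<open>Only meaningful for \<open>m \<ge> 1\<close>; see \<open>pmf_shuffle\<close> below.\<close>

definition shuffle :: "nat \<Rightarrow> nat \<Rightarrow> (nat \<Rightarrow> nat) pmf" where
  "shuffle n m = embed_pmf (shuffle_mass n m)"

definition uniform_perm :: "nat \<Rightarrow> (nat \<Rightarrow> nat) pmf" where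
  "uniform_perm n = pmf_of_set {\<sigma>. \<sigma> permutes {1..n}}"

text \<open>
  Shuffling a deck in arrangement \<open>\<sigma>\<close>, where the shuffle moves the card at position \<open>\<tau> j\<close> to
  position \<open>j\<close>, yields the arrangement \<open>\<sigma> \<circ> \<tau>\<close>.
\<close>

definition convolution :: "('a \<Rightarrow> 'a) pmf \<Rightarrow> ('a \<Rightarrow> 'a) pmf \<Rightarrow> ('a \<Rightarrow> 'a) pmf" where
  "convolution P Q = bind_pmf P (\<lambda>\<sigma>. bind_pmf Q (\<lambda>\<tau>. return_pmf (\<sigma> \<circ> \<tau>)))"

primrec convolution_power :: "('a \<Rightarrow> 'a) pmf \<Rightarrow> nat \<Rightarrow> ('a \<Rightarrow> 'a) pmf" where
  "convolution_power Q 0 = return_pmf id"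
| "convolution_power Q (Suc k) = convolution (convolution_power Q k) Q"

definition tv_dist :: "'a pmf \<Rightarrow> 'a pmf \<Rightarrow> real" where
  "tv_dist \<mu> \<nu> = (SUP A. measure_pmf.prob \<mu> A - measure_pmf.prob \<nu> A)"


section \<open>Total variation cutoff\<close>

definition cutoff_step :: "(nat \<Rightarrow> real) \<Rightarrow> (nat \<Rightarrow> real) \<Rightarrow> nat \<Rightarrow> real \<Rightarrow> nat" where
  "cutoff_step t b n c =
     nat (if c > 0 then \<lceil>t n + c * b n\<rceil> else \<lfloor>t n + c * b n\<rfloor>)"

definition upper_profile ::
    "(nat \<Rightarrow> (nat \<Rightarrow> nat) pmf) \<Rightarrow> (nat \<Rightarrow> real) \<Rightarrow> (nat \<Rightarrow> real) \<Rightarrow> real \<Rightarrow> ereal" where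
  "upper_profile Q t b c =
     limsup (\<lambda>n. ereal (tv_dist (convolution_power (Q n) (cutoff_step t b n c)) (uniform_perm n)))"

definition lower_profile ::
    "(nat \<Rightarrow> (nat \<Rightarrow> nat) pmf) \<Rightarrow> (nat \<Rightarrow> real) \<Rightarrow> (nat \<Rightarrow> real) \<Rightarrow> real \<Rightarrow> ereal" where
  "lower_profile Q t b c =
     liminf (\<lambda>n. ereal (tv_dist (convolution_power (Q n) (cutoff_step t b n c)) (uniform_perm n)))"

text \<open>
  The first two conditions force \<open>t n + c * b n\<close> to be non-negative for large \<open>n\<close>, so the
  truncation by \<^const>\<open>nat\<close> in \<^const>\<open>cutoff_step\<close> is harmless.
\<close>

definition tv_cutoff ::
    "(nat \<Rightarrow> (nat \<Rightarrow> nat) pmf) \<Rightarrow> (nat \<Rightarrow> real) \<Rightarrow> (nat \<Rightarrow> real) \<Rightarrow> bool" where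
  "tv_cutoff Q t b \<longleftrightarrow>
     (\<forall>\<^sub>F n in sequentially. t n > 0) \<and> (\<lambda>n. b n / t n) \<longlonglongrightarrow> 0 \<and>
     (upper_profile Q t b \<longlongrightarrow> 0) at_top \<and> (lower_profile Q t b \<longlongrightarrow> 1) at_bot"

definition optimal_tv_cutoff ::
    "(nat \<Rightarrow> (nat \<Rightarrow> nat) pmf) \<Rightarrow> (nat \<Rightarrow> real) \<Rightarrow> (nat \<Rightarrow> real) \<Rightarrow> bool" where
  "optimal_tv_cutoff Q t b \<longleftrightarrow>
     tv_cutoff Q t b \<and> (\<forall>c>0. lower_profile Q t b c > 0 \<and> upper_profile Q t b (- c) < 1)"


section \<open>Rounding and the limit profile\<close>

text \<open>The library function \<^const>\<open>round\<close> rounds halves up. Both functions are used for \<open>t > 0\<close> only.\<close>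

definition nearest :: "real \<Rightarrow> real" where
  "nearest t = (if t < 1/2 then 1/2 else of_int (round t))"

definition dev :: "real \<Rightarrow> real" where
  "dev t = (if t < 1/2 then 1/2 else t - nearest t)"

definition exp_ereal :: "ereal \<Rightarrow> ereal" where
  "exp_ereal x =
     (if x = \<infinity> then \<infinity> else if x = - \<infinity> then 0 else ereal (exp (real_of_ereal x)))"

definition Psi :: "ereal \<Rightarrow> real" where
  "Psi x = 1 / sqrt (2 * pi) *
     (LBINT s = - (x / ereal (4 * sqrt 3)) .. x / ereal (4 * sqrt 3). exp (- (s\<^sup>2) / 2))"


section \<open>The shuffle mass function is a probability mass function\<close>

fun descents :: "nat list \<Rightarrow> nat" where
  "descents (x # y # zs) = (if y < x then 1 else 0) + descents (y # zs)"
| "descents [x] = 0"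
| "descents [] = 0"

definition insert_at :: "'a \<Rightarrow> nat \<Rightarrow> 'a list \<Rightarrow> 'a list" where
  "insert_at M i xs = take i xs @ M # drop i xs"

lemma insert_at_simps [simp]:
  "insert_at M 0 xs = M # xs" "insert_at M (Suc i) (x # xs) = x # insert_at M i xs"
  by (simp_all add: insert_at_def)

lemma descents_le: "descents xs \<le> length xs - 1"
  by (induction xs rule: descents.induct) auto

lemma sum_insert_descents:
  fixes f :: "nat \<Rightarrow> nat"
  assumes "\<forall>x\<in>set xs. x < M"
  shows "(\<Sum>i\<le>length xs. f (descents (insert_at M i xs))) =
           (descents xs + 1) * f (descents xs) + (length xs - descents xs) * f (descents xs + 1)"
  using assms
proof (induction xs arbitrary: f rule: descents.induct)
  case (1 x y zs)
  define e :: nat where "e = (if y < x then 1 else 0)"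
  define d where "d = descents (y # zs)"
  define l where "l = length (y # zs)"
  have dl: "d \<le> length zs" using descents_le[of "y # zs"] by (simp add: d_def)
  have IH: "(\<Sum>i\<le>length (y # zs). f (e + descents (insert_at M i (y # zs)))) =
      (d + 1) * f (e + d) + (l - d) * f (e + d + 1)"
    using "1.IH"[of "\<lambda>k. f (e + k)"] "1.prems" by (simp add: d_def l_def)
  have IH': "f (e + 1 + d) + (\<Sum>i\<le>length zs. f (e + descents (y # insert_at M i zs))) =
      (d + 1) * f (e + d) + (l - d) * f (e + d + 1)"
    using IH "1.prems" by (simp only: length_Cons sum.atMost_Suc_shift) (simp add: d_def)
  have "(\<Sum>i\<le>length (x # y # zs). f (descents (insert_at M i (x # y # zs)))) =
      f (e + 1 + d) + (f (1 + d) + (\<Sum>i\<le>length zs. f (e + descents (y # insert_at M i zs))))"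
    using "1.prems" by (simp only: length_Cons sum.atMost_Suc_shift) (simp add: d_def e_def)
  also have "\<dots> = f (1 + d) + ((d + 1) * f (e + d) + (l - d) * f (e + d + 1))"
    using IH' by simp
  also have "\<dots> = (e + d + 1) * f (e + d) + (Suc l - (e + d)) * f (e + d + 1)"
  proof (cases "y < x")
    case True
    then show ?thesis by (simp add: e_def)
  next
    case False
    have "Suc l - d = Suc (l - d)" using dl by (simp add: l_def)
    then show ?thesis using False by (simp add: e_def)
  qed
  finally show ?case by (simp add: e_def d_def l_def)
qed (simp_all add: insert_at_def)

lemma binomial_insert_identity:
  assumes "d \<le> n" "m \<ge> 1"
  shows "(d + 1) * ((n + m - d) choose Suc n) + (n - d) * ((n + m - (d + 1)) choose Suc n) =
         m * ((n + m - (d + 1)) choose n)"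
proof -
  define N where "N = n + m - (d + 1)"
  have N: "n + m - d = Suc N" "int N = int n + int m - int d - 1"
    using assms by (auto simp: N_def)
  have a: "int (Suc n) * int (N choose Suc n) = (int N - int n) * int (N choose n)"
  proof (cases "n \<le> N")
    case True
    have "Suc n * (N choose Suc n) = (N - n) * (N choose n)"
      by (metis binomial_absorb_comp binomial_absorption mult.commute)
    then show ?thesis using True by (metis of_nat_diff of_nat_mult)
  qed (simp add: binomial_eq_0)
  have "int ((d + 1) * (Suc N choose Suc n) + (n - d) * (N choose Suc n)) =
      (int d + 1) * int (N choose n) + int (Suc n) * int (N choose Suc n)"
    using assms(1) by (simp add: of_nat_diff algebra_simps)
  also have "\<dots> = int (m * (N choose n))"
  proof -
    have m: "int m = int N - int n + int d + 1" using N(2) by simp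
    show ?thesis unfolding a of_nat_mult m by (simp add: algebra_simps)
  qed
  finally show ?thesis using N(1) by (simp only: N_def of_nat_eq_iff)
qed

lemma sum_permutations_insert:
  fixes f :: "nat list \<Rightarrow> nat"
  assumes "M \<notin> A" "finite A"
  shows "sum f (permutations_of_set (insert M A)) =
         (\<Sum>xs\<in>permutations_of_set A. \<Sum>i\<le>card A. f (insert_at M i xs))"
proof -
  have "(\<Sum>xs\<in>permutations_of_set A. \<Sum>i\<le>card A. f (insert_at M i xs)) =
     (\<Sum>(xs, i)\<in>permutations_of_set A \<times> {..card A}. f (insert_at M i xs))"
    by (rule sum.cartesian_product)
  also have "\<dots> = sum f (permutations_of_set (insert M A))"
  proof (rule sum.reindex_bij_witness[where
        i = "\<lambda>ys. (remove1 M ys, length (takeWhile (\<lambda>y. y \<noteq> M) ys))" and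
        j = "\<lambda>(xs, i). insert_at M i xs"], goal_cases)
    case (1 p)
    obtain xs i where p: "p = (xs, i)" by force
    have xs: "distinct xs" "set xs = A" "i \<le> length xs"
      using 1 p by (auto simp: permutations_of_set_def distinct_card)
    have M: "M \<notin> set (take i xs)" using xs assms by (meson in_set_takeD)
    then have "takeWhile (\<lambda>y. y \<noteq> M) (take i xs @ M # drop i xs) = take i xs"
      by (subst takeWhile_append2) auto
    then show ?case using M xs by (simp add: p insert_at_def remove1_append)
  next
    case (2 p)
    obtain xs i where p: "p = (xs, i)" by force
    have xs: "distinct xs" "set xs = A"
      using 2 p by (auto simp: permutations_of_set_def)
    have "set (take i xs @ drop i xs) = A" "distinct (take i xs @ drop i xs)"
      using xs by simp_all
    then show ?case using assms unfolding p
      by (auto simp: insert_at_def permutations_of_set_def simp del: append_take_drop_id)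
  next
    case (3 ys)
    have ys: "distinct ys" "set ys = insert M A" using 3 by (auto simp: permutations_of_set_def)
    obtain us vs where u: "ys = us @ M # vs" "M \<notin> set us"
      using split_list_first[of M ys] ys by auto
    have "takeWhile (\<lambda>y. y \<noteq> M) ys = us" using u by (subst u, subst takeWhile_append2) auto
    then show ?case using u by (simp add: insert_at_def remove1_append)
  next
    case (4 ys)
    have ys: "distinct ys" "set ys = insert M A" using 4 by (auto simp: permutations_of_set_def)
    obtain us vs where u: "ys = us @ M # vs" "M \<notin> set us"
      using split_list_first[of M ys] ys by auto
    have t: "takeWhile (\<lambda>y. y \<noteq> M) ys = us" using u by (subst u, subst takeWhile_append2) auto
    have r: "remove1 M ys = us @ vs" using u by (simp add: remove1_append)
    have s: "set (us @ vs) = A" "distinct (us @ vs)" using u ys assms(1) by auto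
    have "length (us @ vs) = card A" using s distinct_card by metis
    then show ?case using s unfolding t r by (auto simp: permutations_of_set_def)
  qed auto
  finally show ?thesis by simp
qed

lemma worpitzky_list:
  assumes "m \<ge> 1"
  shows "(\<Sum>xs\<in>permutations_of_set {1..n}. (n + m - (descents xs + 1)) choose n) = m ^ n"
proof (induction n)
  case (Suc n)
  define f where "f d = ((Suc n + m - (d + 1)) choose Suc n)" for d
  have "(\<Sum>xs\<in>permutations_of_set {1..Suc n}. f (descents xs)) =
      (\<Sum>xs\<in>permutations_of_set {1..n}. \<Sum>i\<le>n. f (descents (insert_at (Suc n) i xs)))"
    by (subst atLeastAtMostSuc_conv, simp, subst sum_permutations_insert) auto
  also have "\<dots> = (\<Sum>xs\<in>permutations_of_set {1..n}. m * ((n + m - (descents xs + 1)) choose n))"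
  proof (rule sum.cong[OF refl])
    fix xs assume "xs \<in> permutations_of_set {1..n}"
    then have xs: "set xs = {1..n}" "distinct xs" by (auto simp: permutations_of_set_def)
    then have l: "length xs = n" using distinct_card[of xs] by simp
    have d: "descents xs \<le> n" using descents_le[of xs] l by simp
    have "(\<Sum>i\<le>n. f (descents (insert_at (Suc n) i xs))) =
        (descents xs + 1) * f (descents xs) + (n - descents xs) * f (descents xs + 1)"
      using sum_insert_descents[of xs "Suc n" f] xs l by simp
    also have "\<dots> = m * ((n + m - (descents xs + 1)) choose n)"
      using binomial_insert_identity[OF d assms] by (simp add: f_def)
    finally show "(\<Sum>i\<le>n. f (descents (insert_at (Suc n) i xs))) = \<dots>" .
  qed
  also have "\<dots> = m ^ Suc n" by (simp add: sum_distrib_left[symmetric] Suc.IH[simplified])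
  finally show ?case by (simp add: f_def)
qed simp

lemma descents_map_upt:
  "descents (map \<sigma> [a..<a + k]) = card {i \<in> {a..<a + k - 1}. \<sigma> (i + 1) < \<sigma> i}"
proof (induction k arbitrary: a)
  case (Suc k)
  show ?case
  proof (cases k)
    case (Suc j)
    have *: "{i \<in> {a..<a + Suc k - 1}. \<sigma> (i + 1) < \<sigma> i} =
        (if \<sigma> (a + 1) < \<sigma> a then {a} else {}) \<union> {i \<in> {Suc a..<Suc a + k - 1}. \<sigma> (i + 1) < \<sigma> i}"
      using Suc by (auto simp: Suc_le_eq le_less)
    have "[a..<a + Suc k] = a # Suc a # [Suc (Suc a)..<a + Suc k]"
      using Suc by (simp add: upt_rec)
    moreover have "[Suc a..<Suc a + k] = Suc a # [Suc (Suc a)..<a + Suc k]"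
      using Suc by (simp add: upt_rec)
    ultimately have "descents (map \<sigma> [a..<a + Suc k]) =
        (if \<sigma> (a + 1) < \<sigma> a then 1 else 0) + descents (map \<sigma> [Suc a..<Suc a + k])"
      by (simp del: upt_Suc)
    also have "\<dots> = card {i \<in> {a..<a + Suc k - 1}. \<sigma> (i + 1) < \<sigma> i}"
      unfolding * Suc.IH by (subst card_Un_disjoint) auto
    finally show ?thesis .
  qed simp
qed simp

lemma bij_permutes_lists:
  "bij_betw (\<lambda>\<sigma>. map \<sigma> [1..<1 + n]) {\<sigma>. \<sigma> permutes {1..n}} (permutations_of_set {1..n})"
proof -
  let ?F = "\<lambda>\<sigma>::nat \<Rightarrow> nat. map \<sigma> [1..<1 + n]"
  let ?S = "{\<sigma>. \<sigma> permutes {1..n}}"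
  have inj: "inj_on ?F ?S"
  proof (rule inj_onI, rule ext)
    fix \<sigma> \<tau> x assume *: "\<sigma> \<in> ?S" "\<tau> \<in> ?S" "?F \<sigma> = ?F \<tau>"
    show "\<sigma> x = \<tau> x"
    proof (cases "x \<in> {1..n}")
      case True
      then show ?thesis using *(3) by auto
    next
      case False
      then show ?thesis using *(1,2) by (simp add: permutes_not_in)
    qed
  qed
  have sub: "?F ` ?S \<subseteq> permutations_of_set {1..n}"
  proof
    fix ys assume "ys \<in> ?F ` ?S"
    then obtain \<sigma> where s: "\<sigma> permutes {1..n}" "ys = ?F \<sigma>" by auto
    have e: "set [1..<1 + n] = {1..n}" by auto
    have "set ys = {1..n}" using permutes_image[OF s(1)] unfolding s(2) set_map e .
    moreover have "distinct ys" unfolding s(2) distinct_map e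
      using permutes_inj_on[OF s(1)] by simp
    ultimately show "ys \<in> permutations_of_set {1..n}" by (simp add: permutations_of_set_def)
  qed
  have "card ?S = card (permutations_of_set {1..n})"
    using card_permutations[of "{1..n}" n] by simp
  then have "?F ` ?S = permutations_of_set {1..n}"
    using sub inj by (intro card_subset_eq) (auto simp: card_image)
  with inj show ?thesis by (simp add: bij_betw_def)
qed

lemma sum_shuffle_mass:
  assumes "m \<ge> 1"
  shows "(\<Sum>\<sigma> | \<sigma> permutes {1..n}. shuffle_mass n m \<sigma>) = 1"
proof -
  define g where "g d = (n + m - (d + 1)) choose n" for d
  define D where "D \<sigma> = card {i \<in> {1..<n}. \<sigma> (i + 1) < \<sigma> i}" for \<sigma> :: "nat \<Rightarrow> nat"
  have "(\<Sum>\<sigma> | \<sigma> permutes {1..n}. (n + m - rising_sequences n \<sigma>) choose n) =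
      (\<Sum>\<sigma> | \<sigma> permutes {1..n}. g (D (inv \<sigma>)))"
    by (simp add: rising_sequences_def g_def D_def)
  also have "\<dots> = (\<Sum>\<sigma> | \<sigma> permutes {1..n}. g (D \<sigma>))"
    by (rule sum_permutations_inverse[symmetric])
  also have "\<dots> = (\<Sum>\<sigma> | \<sigma> permutes {1..n}. g (descents (map \<sigma> [1..<1 + n])))"
    by (simp only: descents_map_upt D_def add_diff_cancel_left')
  also have "\<dots> = (\<Sum>xs\<in>permutations_of_set {1..n}. g (descents xs))"
    by (rule sum.reindex_bij_betw[OF bij_permutes_lists])
  also have "\<dots> = m ^ n" unfolding g_def by (rule worpitzky_list[OF assms])
  finally have "(\<Sum>\<sigma> | \<sigma> permutes {1..n}. (n + m - rising_sequences n \<sigma>) choose n) = m ^ n" .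
  then have "(\<Sum>\<sigma> | \<sigma> permutes {1..n}. real ((n + m - rising_sequences n \<sigma>) choose n)) = real m ^ n"
    by (metis of_nat_power of_nat_sum)
  then show ?thesis using assms
    by (simp add: shuffle_mass_def sum_divide_distrib[symmetric])
qed

lemma pmf_shuffle:
  assumes "m \<ge> 1"
  shows "pmf (shuffle n m) \<sigma> = shuffle_mass n m \<sigma>"
  unfolding shuffle_def
proof (rule pmf_embed_pmf)
  show nonneg: "0 \<le> shuffle_mass n m \<sigma>" for \<sigma> by (simp add: shuffle_mass_def)
  have fin: "finite {\<sigma>. \<sigma> permutes {1..n}}" by (simp add: finite_permutations)
  have "(\<integral>\<^sup>+ \<sigma>. ennreal (shuffle_mass n m \<sigma>) \<partial>count_space UNIV) =
      (\<Sum>\<sigma> | \<sigma> permutes {1..n}. ennreal (shuffle_mass n m \<sigma>))"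
    by (rule nn_integral_count_space'[OF fin]) (auto simp: shuffle_mass_def)
  also have "\<dots> = ennreal (\<Sum>\<sigma> | \<sigma> permutes {1..n}. shuffle_mass n m \<sigma>)"
    by (rule sum_ennreal) (rule nonneg)
  finally show "(\<integral>\<^sup>+ \<sigma>. ennreal (shuffle_mass n m \<sigma>) \<partial>count_space UNIV) = 1"
    using sum_shuffle_mass[OF assms, of n] by simp
qed

end

theory Submission
  imports Defs "HOL-Real_Asymp.Real_Asymp"
begin

text \<open>
  Since an \<open>m\<close>-shuffle followed by an \<open>m'\<close>-shuffle is an
  \<open>m m'\<close>-shuffle, \<open>k\<close> successive \<open>m\<close>-shuffles amount to a
  single \<open>M\<close>-shuffle with \<open>M = m ^ k\<close>. Everything therefore rests on
  the asymptotics of the distance between one \<open>M\<close>-shuffle of \<open>n\<close> cards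
  and the uniform distribution, and the scale that matters turns out to be
  \<open>M \<sim> n powr (3/2)\<close>.

  The shuffle has density \<open>(\<Prod>i=1..n. 1 + (i - r) / M)\<close> with respect to
  the uniform distribution, where \<open>r\<close> is the number of rising sequences, that is, one
  more than the number of descents of the inverse. The distance is the uniform expectation of the
  positive part of one minus this density. Under the uniform distribution \<open>r\<close> is
  \<open>1 + n / 2 + z * sqrt (n / 12)\<close> with \<open>z\<close> asymptotically
  standard normal. If \<open>n powr (3/2) / M\<close> tends to a finite \<open>a\<close>,
  expanding the logarithm of the density to second order shows that it converges to
  \<open>exp (- a z / sqrt 12 - a\<^sup>2 / 24)\<close>
  (\<open>likelihood_tendsto\<close>). The integrands are bounded by \<open>1\<close>, so the
  distance converges to the corresponding Gaussian integral, which is \<open>Psi a\<close>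
  (\<open>shuffle_distance_tendsto\<close>). If the ratio tends to infinity, the distance tends to
  \<open>1\<close>: further shuffling can only decrease it, and enough of it leads to a ratio with
  limit \<open>a\<close> for any prescribed \<open>a\<close>, where the limit
  \<open>Psi a\<close> is as close to \<open>1\<close> as desired
  (\<open>shuffle_distance_tendsto_1\<close>).

  The central limit theorem for descents (\<open>weak_conv_descent_law\<close>) comes from an
  exact identity: taking prefix sums modulo \<open>m\<close> turns a uniform word over
  \<open>{0, ..., m - 1}\<close> into a uniform word whose number of descents is the number of
  carries, i.e. the integer part of \<open>(x 1 + ... + x n) / m\<close>. As
  \<open>m\<close> grows, the descents of a uniform permutation thus behave, up to an error of at
  most \<open>1\<close>, like a sum of \<open>n\<close> independent uniform variables on
  \<open>[0, 1]\<close>.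

  For a family of \<open>m n\<close>-shuffles,
  \<open>n powr (3/2) / m n ^ k = exp (\<mu> n * (t n - k))\<close>. So the limit
  of the distance after \<open>k\<close> shuffles is governed by the limit of
  \<open>\<mu> n * (t n - k)\<close> (\<open>TV_tendsto\<close>), and all parts of the
  theorem follow by looking at how close an integer \<open>k\<close> can be to \<open>t n\<close>
  and passing to subsequences.
\<close>

section \<open>Words, sorting permutations and shuffles\<close>

definition words :: "nat \<Rightarrow> nat \<Rightarrow> (nat \<Rightarrow> nat) set" where
  "words n m = {1..n} \<rightarrow>\<^sub>E {..<m}"

lemma finite_words [simp]: "finite (words n m)"
  by (simp add: words_def finite_PiE)

lemma card_words: "card (words n m) = m ^ n"
  by (simp add: words_def card_PiE)

lemma words_nonempty: "m \<ge> 1 \<Longrightarrow> words n m \<noteq> {}"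
  by (auto simp: words_def PiE_eq_empty_iff lessThan_empty_iff)

lemma words_less: "w \<in> words n m \<Longrightarrow> i \<in> {1..n} \<Longrightarrow> w i < m"
  by (auto simp: words_def)

text \<open>
  For letters \<open>w i\<close> attached to the indices \<open>i\<close>, the permutation
  assigns to every index its place when the indices are stably sorted by their letters. Reading
  letters as pack numbers, this is the inverse description of a shuffle.
\<close>
definition sorts :: "nat \<Rightarrow> (nat \<Rightarrow> nat) \<Rightarrow> (nat \<Rightarrow> nat) \<Rightarrow> bool" where
  "sorts n w \<sigma> \<longleftrightarrow> \<sigma> permutes {1..n} \<and>
     (\<forall>i\<in>{1..n}. \<forall>j\<in>{1..n}. i < j \<longrightarrow> (\<sigma> i < \<sigma> j \<longleftrightarrow> w i \<le> w j))"

definition word_rank :: "nat \<Rightarrow> (nat \<Rightarrow> nat) \<Rightarrow> nat \<Rightarrow> nat" where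
  "word_rank n w i = (if i \<in> {1..n} then card {j\<in>{1..n}. w j < w i \<or> w j = w i \<and> j \<le> i} else i)"

lemma sorts_word_rank: "sorts n w (word_rank n w)"
proof -
  define B where "B i = {j\<in>{1..n}. w j < w i \<or> w j = w i \<and> j \<le> i}" for i
  have fin: "finite (B i)" for i by (simp add: B_def)
  have r: "word_rank n w i = card (B i)" if "i \<in> {1..n}" for i
    using that by (simp add: word_rank_def B_def)
  have less: "word_rank n w i < word_rank n w j" if "i \<in> {1..n}" "j \<in> {1..n}" "w i < w j \<or> w i = w j \<and> i < j" for i j
  proof -
    have "B i \<subset> B j" using that unfolding B_def by (auto simp: psubset_eq)
    then show ?thesis using r that fin by (simp add: psubset_card_mono)
  qed
  have ord: "word_rank n w i < word_rank n w j \<longleftrightarrow> w i < w j \<or> w i = w j \<and> i < j" if "i \<in> {1..n}" "j \<in> {1..n}" for i j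
    using less[OF that] less[OF that(2,1)] by (metis less_asym linorder_neqE_nat order_less_irrefl)
  have inj: "inj_on (word_rank n w) {1..n}"
    by (rule inj_onI) (metis less linorder_neqE_nat order_less_irrefl)
  have "word_rank n w ` {1..n} \<subseteq> {1..n}"
  proof safe
    fix i assume i: "i \<in> {1..n}"
    have "i \<in> B i" using i by (simp add: B_def)
    then have "1 \<le> card (B i)" using fin by (metis card_gt_0_iff empty_iff One_nat_def Suc_leI)
    moreover have "card (B i) \<le> card {1..n}" by (rule card_mono) (auto simp: B_def)
    ultimately show "word_rank n w i \<in> {1..n}" using r[OF i] by simp
  qed
  then have "bij_betw (word_rank n w) {1..n} {1..n}"
    using inj by (metis bij_betw_imageI endo_inj_surj finite_atLeastAtMost)
  then have "word_rank n w permutes {1..n}"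
    by (rule bij_imp_permutes) (auto simp: word_rank_def)
  then show ?thesis unfolding sorts_def using ord by (auto simp: le_less)
qed

lemma permutation_rank:
  assumes "\<sigma> permutes {1..n}" "i \<in> {1..n}"
  shows "\<sigma> i = card {j\<in>{1..n}. \<sigma> j \<le> \<sigma> i}"
proof -
  have "\<sigma> ` {j\<in>{1..n}. \<sigma> j \<le> \<sigma> i} = {1..\<sigma> i}"
  proof (intro equalityI subsetI)
    fix y assume y: "y \<in> {1..\<sigma> i}"
    have "\<sigma> i \<in> {1..n}" using assms permutes_in_image by metis
    then have "y \<in> \<sigma> ` {1..n}" using y permutes_image[OF assms(1)] by auto
    then show "y \<in> \<sigma> ` {j\<in>{1..n}. \<sigma> j \<le> \<sigma> i}" using y by auto
  next
    fix y assume "y \<in> \<sigma> ` {j\<in>{1..n}. \<sigma> j \<le> \<sigma> i}"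
    then show "y \<in> {1..\<sigma> i}" using permutes_image[OF assms(1)] by auto
  qed
  then have "card {j\<in>{1..n}. \<sigma> j \<le> \<sigma> i} = card {1..\<sigma> i}"
    by (metis card_image inj_on_subset permutes_inj[OF assms(1)] subset_UNIV)
  then show ?thesis by simp
qed

lemma sorts_unique:
  assumes "sorts n w \<sigma>" "sorts n w \<tau>"
  shows "\<sigma> = \<tau>"
proof
  fix i
  have p: "\<sigma> permutes {1..n}" "\<tau> permutes {1..n}" using assms by (auto simp: sorts_def)
  have le: "\<sigma> j \<le> \<sigma> i \<longleftrightarrow> \<tau> j \<le> \<tau> i" if "i \<in> {1..n}" "j \<in> {1..n}" for i j
  proof -
    have "i < j \<or> i = j \<or> j < i" by linarith
    moreover have "\<sigma> i = \<sigma> j \<longleftrightarrow> i = j" "\<tau> i = \<tau> j \<longleftrightarrow> i = j"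
      using p permutes_inj by (metis injD)+
    ultimately show ?thesis using assms that unfolding sorts_def
      by (smt (verit, best) linorder_not_less order_le_less)
  qed
  show "\<sigma> i = \<tau> i"
  proof (cases "i \<in> {1..n}")
    case True
    have "{j\<in>{1..n}. \<sigma> j \<le> \<sigma> i} = {j\<in>{1..n}. \<tau> j \<le> \<tau> i}" using le[OF True] by auto
    then show ?thesis using permutation_rank[OF p(1) True] permutation_rank[OF p(2) True] by simp
  qed (use p in \<open>simp add: permutes_not_in\<close>)
qed

lemma word_rank_eq_iff: "word_rank n w = \<sigma> \<longleftrightarrow> sorts n w \<sigma>"
  using sorts_word_rank sorts_unique by blast

lemma word_rank_permutes: "word_rank n w permutes {1..n}"
  using sorts_word_rank by (simp add: sorts_def)

lemma word_rank_less_iff: "i \<in> {1..n} \<Longrightarrow> j \<in> {1..n} \<Longrightarrow> i < j \<Longrightarrow> word_rank n w i < word_rank n w j \<longleftrightarrow> w i \<le> w j"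
  using sorts_word_rank by (simp add: sorts_def)

text \<open>
  With \<open>e p \<in> {0, 1}\<close>, the weakly increasing words that are required to
  increase strictly at the places \<open>p\<close> with \<open>e p = 1\<close>. For
  \<open>e p\<close> the indicator of a descent at \<open>p\<close> of
  \<open>inv \<sigma>\<close>, these are the words sorted by \<open>\<sigma>\<close>, read in
  sorted order.
\<close>
definition monotone_words :: "nat \<Rightarrow> nat \<Rightarrow> (nat \<Rightarrow> nat) \<Rightarrow> (nat \<Rightarrow> nat) set" where
  "monotone_words n m e = {a \<in> words n m. \<forall>p\<in>{1..<n}. a p + e p \<le> a (p + 1)}"

lemma monotone_words_le:
  assumes "a \<in> monotone_words n m e" "1 \<le> p" "p \<le> q" "q \<le> n"
  shows "a p \<le> a q"
  using assms(3,4)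
proof (induction q rule: dec_induct)
  case (step q)
  have "a q + e q \<le> a (q + 1)" using assms(1,2) step by (auto simp: monotone_words_def)
  then show ?case using step by simp
qed simp

text \<open>
  The last letter is the largest one. Either it is smaller than the top letter \<open>m\<close>,
  or it equals \<open>m\<close> and can be removed, which leaves a word with letters at most
  \<open>m - e n\<close>. This is the recurrence that Pascal's rule solves.
\<close>
lemma monotone_words_Suc:
  assumes "e n \<le> 1" "n \<ge> 1"
  shows "card (monotone_words (Suc n) (Suc m) e) =
         card (monotone_words (Suc n) m e) + card (monotone_words n (m + 1 - e n) e)"
proof -
  let ?S = "monotone_words (Suc n) (Suc m) e"
  let ?T = "monotone_words n (m + 1 - e n) e"
  have split: "?S = monotone_words (Suc n) m e \<union> {a\<in>?S. a (Suc n) = m}"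
  proof (intro equalityI subsetI)
    fix a assume a: "a \<in> ?S"
    show "a \<in> monotone_words (Suc n) m e \<union> {a\<in>?S. a (Suc n) = m}"
    proof (cases "a (Suc n) = m")
      case False
      have m: "a (Suc n) < m" using a False words_less[of a "Suc n" "Suc m" "Suc n"]
        by (auto simp: monotone_words_def)
      have "a i < m" if "i \<in> {1..Suc n}" for i
        using monotone_words_le[OF a, of i "Suc n"] that m by simp
      then have "a \<in> words (Suc n) m" using a
        by (auto simp: words_def monotone_words_def PiE_iff)
      then show ?thesis using a by (auto simp: monotone_words_def)
    qed (use a in simp)
  next
    fix a assume "a \<in> monotone_words (Suc n) m e \<union> {a\<in>?S. a (Suc n) = m}"
    then show "a \<in> ?S" by (fastforce simp: monotone_words_def words_def PiE_iff)
  qed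
  have bij: "bij_betw (\<lambda>b. b(Suc n := m)) ?T {a\<in>?S. a (Suc n) = m}"
  proof (rule bij_betw_byWitness[where f' = "\<lambda>a. a(Suc n := undefined)"])
    show "\<forall>b\<in>?T. (b(Suc n := m))(Suc n := undefined) = b"
      by (auto simp: monotone_words_def words_def PiE_def extensional_def)
    show "\<forall>a\<in>{a\<in>?S. a (Suc n) = m}. (a(Suc n := undefined))(Suc n := m) = a"
      by auto
    show "(\<lambda>b. b(Suc n := m)) ` ?T \<subseteq> {a\<in>?S. a (Suc n) = m}"
    proof (rule image_subsetI)
      fix b assume b: "b \<in> ?T"
      have lt: "b i < m + 1 - e n" if "i \<in> {1..n}" for i
        using b that words_less unfolding monotone_words_def by blast
      have "b i < Suc m" if "i \<in> {1..n}" for i using lt[OF that] by simp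
      then have "b(Suc n := m) \<in> words (Suc n) (Suc m)" using b
        by (auto simp: words_def monotone_words_def PiE_iff extensional_def)
      moreover have "b n + e n \<le> m" using lt[of n] assms by simp
      ultimately show "b(Suc n := m) \<in> {a\<in>?S. a (Suc n) = m}"
        using b by (auto simp: monotone_words_def less_Suc_eq)
    qed
    show "(\<lambda>a. a(Suc n := undefined)) ` {a\<in>?S. a (Suc n) = m} \<subseteq> ?T"
    proof (rule image_subsetI)
      fix a assume "a \<in> {a\<in>?S. a (Suc n) = m}"
      then have a: "a \<in> ?S" "a (Suc n) = m" by auto
      have "a n + e n \<le> a (n + 1)" using a(1) assms by (simp add: monotone_words_def)
      then have n: "a n + e n \<le> m" using a(2) by simp
      have "a i < m + 1 - e n" if "i \<in> {1..n}" for i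
        using monotone_words_le[OF a(1), of i n] that n by simp
      then have "a(Suc n := undefined) \<in> words n (m + 1 - e n)" using a(1)
        by (auto simp: words_def monotone_words_def PiE_iff extensional_def)
      then show "a(Suc n := undefined) \<in> ?T"
        using a by (auto simp: monotone_words_def)
    qed
  qed
  have "card ?S = card (monotone_words (Suc n) m e) + card {a\<in>?S. a (Suc n) = m}"
    unfolding split[THEN arg_cong[where f=card]]
  proof (rule card_Un_disjoint)
    show "finite (monotone_words (Suc n) m e)" "finite {a\<in>?S. a (Suc n) = m}"
      by (auto simp: monotone_words_def)
    show "monotone_words (Suc n) m e \<inter> {a\<in>?S. a (Suc n) = m} = {}"
      using words_less[of _ "Suc n" m "Suc n"] by (fastforce simp: monotone_words_def)
  qed
  then show ?thesis using bij_betw_same_card[OF bij] by simp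
qed

lemma card_monotone_words:
  assumes "\<And>p. e p \<le> 1"
  shows "card (monotone_words (Suc n) m e) = (n + m - (\<Sum>p=1..n. e p)) choose (Suc n)"
proof (induction n arbitrary: m)
  case 0
  have "monotone_words (Suc 0) m e = words 1 m" by (auto simp: monotone_words_def)
  then show ?case using card_words[of 1 m] by simp
next
  case (Suc n)
  note IH = Suc
  define s where "s = (\<Sum>p=1..n. e p)"
  have s: "s \<le> n" using sum_mono[of "{1..n}" e "\<lambda>_. 1"] assms by (simp add: s_def)
  show ?case
  proof (induction m)
    case 0
    have "words (Suc (Suc n)) 0 = {}" by (auto simp: words_def PiE_eq_empty_iff)
    then show ?case by (simp add: monotone_words_def binomial_eq_0)
  next
    case (Suc m)
    define K where "K = n + 1 + m - (s + e (Suc n))"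
    have e: "e (Suc n) \<le> 1" by (rule assms)
    have K: "Suc n + Suc m - (\<Sum>p=1..Suc n. e p) = Suc K" "n + (m + 1 - e (Suc n)) - s = K"
      using s e by (auto simp: K_def s_def)
    have "card (monotone_words (Suc (Suc n)) (Suc m) e) = (K choose Suc (Suc n)) + (K choose Suc n)"
      using monotone_words_Suc[of e "Suc n" m] e Suc IH[of "m + 1 - e (Suc n)"] K(2)
      by (simp add: s_def K_def)
    then show ?case unfolding K(1) by (simp add: add.commute)
  qed
qed

text \<open>
  It suffices to compare neighbours in the sorted order: being ordered lexicographically by letter
  and index is a transitive relation.
\<close>
lemma sorts_iff_monotone:
  assumes s: "\<sigma> permutes {1..n}"
  shows "sorts n w \<sigma> \<longleftrightarrow>
    (\<forall>p\<in>{1..<n}. w (inv \<sigma> p) + (if inv \<sigma> (p + 1) < inv \<sigma> p then 1 else 0) \<le> w (inv \<sigma> (p + 1)))"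
    (is "_ \<longleftrightarrow> ?mono")
proof -
  have inv: "inv \<sigma> permutes {1..n}" using s by (rule permutes_inv)
  have mem: "inv \<sigma> p \<in> {1..n}" if "p \<in> {1..n}" for p using that permutes_in_image[OF inv] by blast
  have \<sigma>inv: "\<sigma> (inv \<sigma> p) = p" "inv \<sigma> (\<sigma> p) = p" for p
    using permutes_inverses[OF s] by auto
  show ?thesis
  proof
    assume S: "sorts n w \<sigma>"
    show ?mono
    proof
      fix p assume p: "p \<in> {1..<n}"
      define i j where ij_def: "i = inv \<sigma> p" "j = inv \<sigma> (p + 1)"
      have ij: "i \<in> {1..n}" "j \<in> {1..n}" using p mem[of p] mem[of "p + 1"] by (auto simp: ij_def)
      have \<sigma>: "\<sigma> i = p" "\<sigma> j = p + 1" by (auto simp: ij_def \<sigma>inv)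
      then have "i < j \<or> j < i" by (metis linorder_neqE_nat n_not_Suc_n Suc_eq_plus1)
      then have "w i + (if j < i then 1 else 0) \<le> w j"
      proof
        assume "i < j"
        moreover from this have "w i \<le> w j" using S ij \<sigma> unfolding sorts_def by (metis less_add_one)
        ultimately show ?thesis by simp
      next
        assume "j < i"
        moreover from this have "\<not> w j \<le> w i" using S ij \<sigma> unfolding sorts_def
          by (metis less_add_one less_asym)
        ultimately show ?thesis by simp
      qed
      then show "w (inv \<sigma> p) + (if inv \<sigma> (p + 1) < inv \<sigma> p then 1 else 0) \<le> w (inv \<sigma> (p + 1))"
        by (simp add: ij_def)
    qed
  next
    assume M: ?mono
    have "w (inv \<sigma> p) < w (inv \<sigma> q) \<or> w (inv \<sigma> p) = w (inv \<sigma> q) \<and> inv \<sigma> p < inv \<sigma> q"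
      if "1 \<le> p" "Suc p \<le> q" "q \<le> n" for p q
      using that(2,3)
    proof (induction q rule: dec_induct)
      case base
      have "inv \<sigma> p \<noteq> inv \<sigma> (Suc p)" using \<sigma>inv(1) by (metis n_not_Suc_n)
      then show ?case using M[rule_format, of p] that base
        by (auto simp: le_less split: if_splits)
    next
      case (step q)
      have "inv \<sigma> q \<noteq> inv \<sigma> (Suc q)" using \<sigma>inv(1) by (metis n_not_Suc_n)
      then show ?case using M[rule_format, of q] that(1) step
        by (auto simp: le_less split: if_splits)
    qed
    then have le: "w i < w j \<or> w i = w j \<and> i < j" if "i \<in> {1..n}" "j \<in> {1..n}" "\<sigma> i < \<sigma> j" for i j
      using that \<sigma>inv(2) permutes_in_image[OF s]
      by (metis Suc_leI atLeastAtMost_iff)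
    show "sorts n w \<sigma>" unfolding sorts_def
    proof (intro conjI ballI impI)
      fix i j assume ij: "i \<in> {1..n}" "j \<in> {1..n}" "i < j"
      have "\<sigma> i \<noteq> \<sigma> j" using ij permutes_inj[OF s] by (metis injD less_irrefl)
      then show "\<sigma> i < \<sigma> j \<longleftrightarrow> w i \<le> w j" using le[OF ij(1,2)] le[OF ij(2,1)] ij(3) by force
    qed (rule s)
  qed
qed

lemma rising_sequences_le:
  assumes "n \<ge> 1"
  shows "rising_sequences n \<sigma> \<le> n"
proof -
  have "card {i \<in> {1..<n}. inv \<sigma> (i + 1) < inv \<sigma> i} \<le> card {1..<n}" by (rule card_mono) auto
  then show ?thesis using assms by (simp add: rising_sequences_def)
qed

lemma card_words_of_rank:
  assumes s: "\<sigma> permutes {1..n}"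
  shows "card {w \<in> words n m. word_rank n w = \<sigma>} = (n + m - rising_sequences n \<sigma>) choose n"
proof (cases n)
  case 0
  have "\<sigma> = word_rank n w" for w using s 0 by (auto simp: word_rank_def fun_eq_iff)
  then show ?thesis using 0 by (simp add: words_def)
next
  case (Suc k)
  define e where "e p = (if p \<in> {1..<n} \<and> inv \<sigma> (p + 1) < inv \<sigma> p then 1 else 0 :: nat)" for p
  have inv: "inv \<sigma> permutes {1..n}" using s by (rule permutes_inv)
  have bij: "bij_betw (\<lambda>w i. if i \<in> {1..n} then w (inv \<sigma> i) else undefined)
     {w \<in> words n m. word_rank n w = \<sigma>} (monotone_words n m e)"
  proof (rule bij_betw_byWitness[where f' = "\<lambda>a i. if i \<in> {1..n} then a (\<sigma> i) else undefined"])
    let ?W = "{w \<in> words n m. word_rank n w = \<sigma>}"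
    let ?f = "\<lambda>w i. if i \<in> {1..n} then w (inv \<sigma> i) else undefined"
    let ?g = "\<lambda>a i. if i \<in> {1..n} then a (\<sigma> i) else undefined"
    have mem: "inv \<sigma> p \<in> {1..n} \<longleftrightarrow> p \<in> {1..n}" "\<sigma> p \<in> {1..n} \<longleftrightarrow> p \<in> {1..n}" for p
      using permutes_in_image[OF inv] permutes_in_image[OF s] by blast+
    have [simp]: "\<sigma> (inv \<sigma> p) = p" "inv \<sigma> (\<sigma> p) = p" for p
      using permutes_inverses[OF s] by auto
    show 1: "\<forall>w\<in>?W. ?g (?f w) = w"
      using mem by (auto simp: words_def PiE_def extensional_def fun_eq_iff)
    show 2: "\<forall>a\<in>monotone_words n m e. ?f (?g a) = a"
      using mem by (auto simp: monotone_words_def words_def PiE_def extensional_def fun_eq_iff)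
    have fw: "?f w \<in> words n m" if "w \<in> words n m" for w :: "nat \<Rightarrow> nat"
      using that mem by (auto simp: words_def PiE_iff extensional_def)
    have gw: "?g w \<in> words n m" if "w \<in> words n m" for w :: "nat \<Rightarrow> nat"
      using that mem by (auto simp: words_def PiE_iff extensional_def)
    show "?f ` ?W \<subseteq> monotone_words n m e"
      using fw sorts_iff_monotone[OF s] by (auto simp: monotone_words_def word_rank_eq_iff e_def)
    show "?g ` monotone_words n m e \<subseteq> ?W"
    proof clarify
      fix a assume a: "a \<in> monotone_words n m e"
      have "sorts n (?g a) \<sigma>" unfolding sorts_iff_monotone[OF s]
      proof
        fix p assume p: "p \<in> {1..<n}"
        then have "inv \<sigma> p \<in> {1..n}" "inv \<sigma> (p + 1) \<in> {1..n}" using mem(1) by auto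
        then show "?g a (inv \<sigma> p) + (if inv \<sigma> (p + 1) < inv \<sigma> p then 1 else 0) \<le> ?g a (inv \<sigma> (p + 1))"
          using a p by (auto simp: monotone_words_def e_def)
      qed
      then show "?g a \<in> words n m \<and> word_rank n (?g a) = \<sigma>"
        using gw[of a] a by (simp add: monotone_words_def word_rank_eq_iff)
    qed
  qed
  have "(\<Sum>p=1..k. e p) = card {i \<in> {1..<n}. inv \<sigma> (i + 1) < inv \<sigma> i}"
  proof -
    have "{1..k} = {1..<n}" using Suc by auto
    then show ?thesis by (simp add: e_def sum.If_cases Int_def)
  qed
  then have "k + m - (\<Sum>p=1..k. e p) = n + m - rising_sequences n \<sigma>"
    using Suc by (simp add: rising_sequences_def)
  then show ?thesis
    using card_monotone_words[of e k m] bij_betw_same_card[OF bij] Suc by (simp add: e_def)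
qed

text \<open>
  This is the probabilistic form of the mass function: the binomial coefficient counts the words
  that are sorted by a given permutation.
\<close>
lemma shuffle_eq_map_rank:
  assumes "m \<ge> 1"
  shows "shuffle n m = map_pmf (word_rank n) (pmf_of_set (words n m))"
proof (rule pmf_eqI)
  fix \<sigma>
  have "pmf (map_pmf (word_rank n) (pmf_of_set (words n m))) \<sigma> =
      card (words n m \<inter> word_rank n -` {\<sigma>}) / card (words n m)"
    using assms by (simp add: pmf_map measure_pmf_of_set words_nonempty)
  also have "words n m \<inter> word_rank n -` {\<sigma>} = {w \<in> words n m. word_rank n w = \<sigma>}" by auto
  also have "card \<dots> / card (words n m) = shuffle_mass n m \<sigma>"
  proof (cases "\<sigma> permutes {1..n}")
    case True
    then show ?thesis by (simp add: card_words_of_rank shuffle_mass_def card_words)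
  next
    case False
    then have "{w \<in> words n m. word_rank n w = \<sigma>} = {}" using word_rank_permutes by auto
    then show ?thesis using False by (simp add: shuffle_mass_def)
  qed
  finally show "pmf (shuffle n m) \<sigma> = pmf (map_pmf (word_rank n) (pmf_of_set (words n m))) \<sigma>"
    using pmf_shuffle[OF assms] by simp
qed

section \<open>Composition of shuffles\<close>

text \<open>
  Sorting first by \<open>v\<close> and then, stably, by \<open>u\<close> is sorting once by
  pairs, with the letter of \<open>u\<close> being more significant. A pair of letters
  \<open>(a, b)\<close> is encoded as \<open>a * m' + b\<close>; the letter of
  \<open>u\<close> that index \<open>i\<close> meets in the second sorting is the one at its place
  after the first.
\<close>
definition product_word :: "nat \<Rightarrow> nat \<Rightarrow> (nat \<Rightarrow> nat) \<Rightarrow> (nat \<Rightarrow> nat) \<Rightarrow> nat \<Rightarrow> nat" where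
  "product_word n m' u v i = (if i \<in> {1..n} then u (word_rank n v i) * m' + v i else undefined)"

lemma rank_product_word:
  assumes v: "v \<in> words n m'"
  shows "word_rank n (product_word n m' u v) = word_rank n u \<circ> word_rank n v"
  unfolding word_rank_eq_iff sorts_def
proof (intro conjI ballI impI)
  show "word_rank n u \<circ> word_rank n v permutes {1..n}" by (intro permutes_compose word_rank_permutes)
  fix i j assume ij: "i \<in> {1..n}" "j \<in> {1..n}" "i < j"
  define \<tau> where "\<tau> = word_rank n v"
  have \<tau>: "\<tau> permutes {1..n}" unfolding \<tau>_def by (rule word_rank_permutes)
  then have t: "\<tau> i \<in> {1..n}" "\<tau> j \<in> {1..n}" using ij permutes_in_image by metis+
  have vv: "v i < m'" "v j < m'" using v ij words_less by blast+
  have less: "a * m' + b < a' * m' + b'" if "a < a'" "b < m'" for a a' b b' :: nat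
  proof -
    have "a * m' + b < (a + 1) * m'" using that by simp
    also have "\<dots> \<le> a' * m'" using that by (intro mult_right_mono) auto
    finally show ?thesis by simp
  qed
  have p: "product_word n m' u v i = u (\<tau> i) * m' + v i" "product_word n m' u v j = u (\<tau> j) * m' + v j"
    using ij by (simp_all add: product_word_def \<tau>_def)
  consider "\<tau> i < \<tau> j" | "\<tau> j < \<tau> i"
    using ij permutes_inj[OF \<tau>] by (metis injD less_irrefl linorder_neqE_nat)
  then have "(word_rank n u (\<tau> i) < word_rank n u (\<tau> j)) \<longleftrightarrow>
      u (\<tau> i) * m' + v i \<le> u (\<tau> j) * m' + v j"
  proof cases
    case 1
    then have vle: "v i \<le> v j" using word_rank_less_iff[OF ij, of v] by (simp add: \<tau>_def)
    have "u (\<tau> i) \<le> u (\<tau> j) \<longleftrightarrow> u (\<tau> i) * m' + v i \<le> u (\<tau> j) * m' + v j"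
    proof
      assume "u (\<tau> i) \<le> u (\<tau> j)"
      then show "u (\<tau> i) * m' + v i \<le> u (\<tau> j) * m' + v j"
        using vle by (intro add_mono mult_right_mono) auto
    qed (use less[of "u (\<tau> j)" "u (\<tau> i)" "v j" "v i"] vv in force)
    then show ?thesis using word_rank_less_iff[OF t 1, of u] by simp
  next
    case 2
    then have vle: "v j < v i" using word_rank_less_iff[OF ij, of v] by (simp add: \<tau>_def)
    have ne: "word_rank n u (\<tau> i) \<noteq> word_rank n u (\<tau> j)"
      using 2 permutes_inj[OF word_rank_permutes] by (metis injD less_irrefl)
    have "\<not> u (\<tau> j) \<le> u (\<tau> i) \<longleftrightarrow> u (\<tau> i) * m' + v i \<le> u (\<tau> j) * m' + v j"
    proof
      assume *: "u (\<tau> i) * m' + v i \<le> u (\<tau> j) * m' + v j"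
      show "\<not> u (\<tau> j) \<le> u (\<tau> i)"
      proof
        assume "u (\<tau> j) \<le> u (\<tau> i)"
        then have "u (\<tau> j) * m' \<le> u (\<tau> i) * m'" by simp
        then show False using * vle by linarith
      qed
    qed (use less[of "u (\<tau> i)" "u (\<tau> j)" "v i" "v j"] vv in force)
    then show ?thesis using word_rank_less_iff[OF t(2,1) 2, of u] ne by auto
  qed
  then show "((word_rank n u \<circ> word_rank n v) i < (word_rank n u \<circ> word_rank n v) j) =
      (product_word n m' u v i \<le> product_word n m' u v j)"
    by (simp add: p \<tau>_def)
qed

text \<open>
  The remainder modulo \<open>m'\<close> recovers \<open>v\<close>; this determines the first
  sorting, and then the quotient recovers \<open>u\<close>.
\<close>
lemma bij_product_word:
  assumes "m \<ge> 1" "m' \<ge> 1"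
  shows "bij_betw (\<lambda>(u, v). product_word n m' u v) (words n m \<times> words n m') (words n (m * m'))"
proof -
  let ?F = "\<lambda>(u, v). product_word n m' u v"
  let ?P = "words n m \<times> words n m'"
  have inj: "inj_on ?F ?P"
  proof (rule inj_onI, clarify)
    fix u v u' v' assume w: "u \<in> words n m" "v \<in> words n m'" "u' \<in> words n m" "v' \<in> words n m'"
      and eq: "product_word n m' u v = product_word n m' u' v'"
    have eqi: "u (word_rank n v i) * m' + v i = u' (word_rank n v' i) * m' + v' i" if "i \<in> {1..n}" for i
      using fun_cong[OF eq, of i] that by (simp add: product_word_def)
    have "v i = v' i" if i: "i \<in> {1..n}" for i
    proof -
      have "(u (word_rank n v i) * m' + v i) mod m' = (u' (word_rank n v' i) * m' + v' i) mod m'"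
        using eqi[OF i] by simp
      then show ?thesis using words_less[OF w(2) i] words_less[OF w(4) i] by simp
    qed
    then have v: "v = v'" using w unfolding words_def by (intro PiE_ext) auto
    have "u k = u' k" if k: "k \<in> {1..n}" for k
    proof -
      have "k \<in> word_rank n v ` {1..n}" using permutes_image[OF word_rank_permutes] k by simp
      then obtain i where "i \<in> {1..n}" "k = word_rank n v i" by auto
      then show ?thesis using eqi[of i] assms v by simp
    qed
    then have "u = u'" using w unfolding words_def by (intro PiE_ext) auto
    then show "u = u' \<and> v = v'" using v by simp
  qed
  have sub: "?F ` ?P \<subseteq> words n (m * m')"
  proof clarify
    fix u v assume w: "u \<in> words n m" "v \<in> words n m'"
    have "u (word_rank n v i) * m' + v i < m * m'" if i: "i \<in> {1..n}" for i
    proof -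
      have "word_rank n v i \<in> {1..n}" using i permutes_in_image[OF word_rank_permutes] by blast
      then have "u (word_rank n v i) + 1 \<le> m" using words_less[OF w(1)] by (simp add: Suc_leI)
      then have "(u (word_rank n v i) + 1) * m' \<le> m * m'" by (rule mult_right_mono) simp
      then show ?thesis using words_less[OF w(2) i] by simp
    qed
    then show "product_word n m' u v \<in> words n (m * m')"
      by (auto simp: words_def product_word_def PiE_iff extensional_def)
  qed
  have "card (?F ` ?P) = card (words n (m * m'))"
    using inj by (simp add: card_image card_cartesian_product card_words power_mult_distrib)
  then have "?F ` ?P = words n (m * m')" using sub by (intro card_subset_eq) auto
  with inj show ?thesis by (simp add: bij_betw_def)
qed

lemma convolution_shuffle:
  assumes "m \<ge> 1" "m' \<ge> 1"
  shows "convolution (shuffle n m) (shuffle n m') = shuffle n (m * m')"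
proof -
  let ?P = "words n m \<times> words n m'"
  have ne: "words n m \<noteq> {}" "words n m' \<noteq> {}" using assms by (simp_all add: words_nonempty)
  have pair: "pair_pmf (pmf_of_set (words n m)) (pmf_of_set (words n m')) = pmf_of_set ?P"
    using ne by (intro pmf_eqI) 
      (auto simp: pmf_pair pmf_of_set[OF ne(1) finite_words] pmf_of_set[OF ne(2) finite_words]
        card_cartesian_product indicator_def)
  have "convolution (shuffle n m) (shuffle n m') =
      map_pmf (\<lambda>(u, v). word_rank n u \<circ> word_rank n v) (pmf_of_set ?P)"
    using assms
    by (simp add: convolution_def shuffle_eq_map_rank map_pmf_def bind_assoc_pmf bind_return_pmf
        pair[symmetric] pair_pmf_def)
  also have "\<dots> = map_pmf (\<lambda>(u, v). word_rank n (product_word n m' u v)) (pmf_of_set ?P)"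
    using ne by (intro map_pmf_cong refl) (auto simp: rank_product_word)
  also have "\<dots> = map_pmf (word_rank n) (map_pmf (\<lambda>(u, v). product_word n m' u v) (pmf_of_set ?P))"
    by (simp add: map_pmf_comp split_def)
  also have "map_pmf (\<lambda>(u, v). product_word n m' u v) (pmf_of_set ?P) = pmf_of_set (words n (m * m'))"
    using assms ne by (intro map_pmf_of_set_bij_betw bij_product_word) auto
  also have "map_pmf (word_rank n) \<dots> = shuffle n (m * m')"
    using assms by (intro shuffle_eq_map_rank[symmetric]) (simp add: Suc_leI)
  finally show ?thesis .
qed

lemma shuffle_1: "shuffle n 1 = return_pmf id"
proof -
  have "sorts n w id" if "w \<in> words n 1" for w
    using that words_less[OF that] by (auto simp: sorts_def permutes_id)
  then have "map_pmf (word_rank n) (pmf_of_set (words n 1)) = map_pmf (\<lambda>_. id) (pmf_of_set (words n 1))"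
    by (intro map_pmf_cong refl) (auto simp: words_nonempty word_rank_eq_iff)
  then show ?thesis by (simp add: shuffle_eq_map_rank)
qed

lemma convolution_power_shuffle:
  assumes "m \<ge> 1"
  shows "convolution_power (shuffle n m) k = shuffle n (m ^ k)"
proof (induction k)
  case (Suc k)
  have "1 \<le> m ^ k" using assms by simp
  then show ?case using Suc assms by (simp add: convolution_shuffle mult.commute)
qed (simp add: shuffle_1[simplified])

section \<open>Asymptotic normality of the number of descents\<close>

definition des :: "nat \<Rightarrow> (nat \<Rightarrow> nat) \<Rightarrow> nat" where
  "des n w = card {i \<in> {1..<n}. w (i + 1) < w i}"

lemma rising_sequences_des: "rising_sequences n \<sigma> = 1 + des n (inv \<sigma>)"
  by (simp add: rising_sequences_def des_def)

text \<open>
  A tie between neighbouring letters is no descent of the word, and stable sorting keeps the order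
  of tied indices.
\<close>
lemma des_word_rank: "des n (word_rank n w) = des n w"
proof -
  have "word_rank n w (i + 1) < word_rank n w i \<longleftrightarrow> w (i + 1) < w i" if "i \<in> {1..<n}" for i
  proof -
    have "word_rank n w i \<noteq> word_rank n w (i + 1)"
      using permutes_inj[OF word_rank_permutes] by (metis injD n_not_Suc_n Suc_eq_plus1)
    then show ?thesis using word_rank_less_iff[of i n "i + 1" w] that by auto
  qed
  then show ?thesis unfolding des_def by (metis (mono_tags, lifting))
qed

lemma des_Suc:
  assumes "n \<ge> 1"
  shows "des (Suc n) (w(Suc n := y)) = des n w + (if y < w n then 1 else 0)"
proof -
  have "{i \<in> {1..<Suc n}. (w(Suc n := y)) (i + 1) < (w(Suc n := y)) i} =
      {i \<in> {1..<n}. w (i + 1) < w i} \<union> (if y < w n then {n} else {})"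
    using assms by (auto simp: less_Suc_eq)
  then show ?thesis unfolding des_def by (auto simp: card_insert_if)
qed

lemma sum_words_Suc:
  fixes F :: "(nat \<Rightarrow> nat) \<Rightarrow> 'a :: comm_monoid_add"
  shows "(\<Sum>w\<in>words (Suc n) m. F w) = (\<Sum>w\<in>words n m. \<Sum>y<m. F (w(Suc n := y)))"
proof -
  have "(\<Sum>w\<in>words (Suc n) m. F w) = (\<Sum>(w, y)\<in>words n m \<times> {..<m}. F (w(Suc n := y)))"
    by (intro sum.reindex_bij_witness[of _ "\<lambda>(w, y). w(Suc n := y)" "\<lambda>w. (w(Suc n := undefined), w (Suc n))"])
       (auto simp: words_def PiE_def extensional_def le_Suc_eq)
  then show ?thesis by (simp add: sum.cartesian_product)
qed

text \<open>
  The substitution \<open>y = (l + z) mod m\<close>: the new prefix sum drops below the old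
  one exactly when the addition carries.
\<close>
lemma carry_step:
  fixes g :: "nat \<Rightarrow> nat \<Rightarrow> 'a :: comm_monoid_add"
  assumes "l < m"
  shows "(\<Sum>y<m. g (d + (if y < l then 1 else 0)) y) = (\<Sum>z<m. g (d + (l + z) div m) ((l + z) mod m))"
proof (rule sum.reindex_bij_witness[of _ "\<lambda>z. (l + z) mod m" "\<lambda>y. if y < l then y + m - l else y - l"])
  fix z assume z: "z \<in> {..<m}"
  have *: "(l + z) mod m = (if l + z < m then l + z else l + z - m)"
    using assms z by (auto simp: mod_if)
  have **: "(l + z) div m = (if l + z < m then 0 else 1)"
    using assms z by (auto simp: div_if)
  show "(if (l + z) mod m < l then (l + z) mod m + m - l else (l + z) mod m - l) = z"
    using assms z by (auto simp: *)
  show "(l + z) mod m \<in> {..<m}" using assms by auto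
next
  fix y assume y: "y \<in> {..<m}"
  let ?z = "if y < l then y + m - l else y - l"
  have *: "l + ?z = (if y < l then y + m else y)" using assms y by auto
  show "(l + ?z) mod m = y" using y unfolding * by simp
  show "?z \<in> {..<m}" using assms y by auto
  show "g (d + (l + ?z) div m) ((l + ?z) mod m) = g (d + (if y < l then 1 else 0)) y"
    using y unfolding * by simp
qed

text \<open>
  Prefix sums modulo \<open>m\<close> are a bijection of words, under which descents become
  carries. The induction has to keep track of the last letter as well, since it decides about the
  next descent.
\<close>
lemma sum_words_descents_last:
  fixes g :: "nat \<Rightarrow> nat \<Rightarrow> 'a :: comm_monoid_add"
  assumes "n \<ge> 1"
  shows "(\<Sum>w\<in>words n m. g (des n w) (w n)) =
         (\<Sum>x\<in>words n m. g ((\<Sum>i=1..n. x i) div m) ((\<Sum>i=1..n. x i) mod m))"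
  using assms
proof (induction n arbitrary: g rule: nat_induct_at_least)
  case base
  show ?case
  proof (rule sum.cong[OF refl])
    fix w assume "w \<in> words 1 m"
    then have "w 1 < m" by (rule words_less) simp
    then show "g (des 1 w) (w 1) = g ((\<Sum>i=1..1. w i) div m) ((\<Sum>i=1..1. w i) mod m)"
      by (simp add: des_def)
  qed
next
  case (Suc n)
  let ?S = "\<lambda>x. \<Sum>i=1..n. x i"
  have "(\<Sum>w\<in>words (Suc n) m. g (des (Suc n) w) (w (Suc n))) =
      (\<Sum>w\<in>words n m. \<Sum>y<m. g (des n w + (if y < w n then 1 else 0)) y)"
    using Suc.hyps by (simp add: sum_words_Suc des_Suc cong: if_cong)
  also have "\<dots> = (\<Sum>x\<in>words n m. \<Sum>y<m. g (?S x div m + (if y < ?S x mod m then 1 else 0)) y)"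
    by (rule Suc.IH[of "\<lambda>d l. \<Sum>y<m. g (d + (if y < l then 1 else 0)) y"])
  also have "\<dots> = (\<Sum>x\<in>words n m. \<Sum>z<m. g ((?S x + z) div m) ((?S x + z) mod m))"
  proof (rule sum.cong[OF refl])
    fix x assume x: "x \<in> words n m"
    then have m: "m > 0" using words_less[OF x, of 1] Suc.hyps by auto
    have "(?S x + z) div m = ?S x div m + (?S x mod m + z) div m" for z
    proof -
      have "?S x + z = (?S x mod m + z) + (?S x div m) * m"
        using mod_div_mult_eq[of "?S x" m] by linarith
      then have "(?S x + z) div m = ((?S x mod m + z) + (?S x div m) * m) div m" by (rule arg_cong)
      also have "\<dots> = ?S x div m + (?S x mod m + z) div m"
        using m by (subst div_mult_self1) auto
      finally show ?thesis .
    qed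
    moreover have "(?S x mod m + z) mod m = (?S x + z) mod m" for z by (simp add: mod_simps)
    ultimately show "(\<Sum>y<m. g (?S x div m + (if y < ?S x mod m then 1 else 0)) y) =
        (\<Sum>z<m. g ((?S x + z) div m) ((?S x + z) mod m))"
      using m by (subst carry_step) simp_all
  qed
  also have "\<dots> = (\<Sum>x\<in>words (Suc n) m. g ((\<Sum>i=1..Suc n. x i) div m) ((\<Sum>i=1..Suc n. x i) mod m))"
  proof -
    have "(\<Sum>i=1..n. (x(Suc n := z)) i) = ?S x" for x and z :: nat
      by (rule sum.cong) auto
    then show ?thesis by (simp add: sum_words_Suc)
  qed
  finally show ?case .
qed

lemma sum_words_descents:
  fixes g :: "nat \<Rightarrow> 'a :: comm_monoid_add"
  assumes "n \<ge> 1"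
  shows "(\<Sum>w\<in>words n m. g (des n w)) = (\<Sum>x\<in>words n m. g ((\<Sum>i=1..n. x i) div m))"
  using sum_words_descents_last[OF assms, of "\<lambda>d _. g d"] .

lemma shuffle_likelihood:
  assumes "n \<ge> 1" "1 \<le> r" "r \<le> n" "M \<ge> 1"
  shows "fact n * real ((n + M - r) choose n) / real M ^ n =
         (\<Prod>i=1..n. 1 + (real i - real r) / real M)"
proof -
  have "fact n * real ((n + M - r) choose n) = (\<Prod>i=0..<n. real (n + M - r) - real i)"
    unfolding binomial_gbinomial gbinomial_prod_rev by simp
  also have "\<dots> = (\<Prod>i=1..n. real M + real i - real r)"
    using assms by (intro prod.reindex_bij_witness[of _ "\<lambda>i. n - i" "\<lambda>i. n - i"]) (auto simp: of_nat_diff)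
  finally have "fact n * real ((n + M - r) choose n) / real M ^ n =
      (\<Prod>i=1..n. (real M + real i - real r) / real M)"
    by (simp add: prod_dividef)
  also have "\<dots> = (\<Prod>i=1..n. 1 + (real i - real r) / real M)"
    using assms by (intro prod.cong refl) (simp add: field_simps)
  finally show ?thesis .
qed

lemma pmf_uniform_perm:
  "pmf (uniform_perm n) \<sigma> = (if \<sigma> permutes {1..n} then 1 / fact n else 0)"
proof -
  have "{\<sigma>. \<sigma> permutes {1..n}} \<noteq> {}" using permutes_id by blast
  then show ?thesis unfolding uniform_perm_def
    by (simp add: pmf_of_set finite_permutations card_permutations[of _ n] indicator_def)
qed

lemma set_uniform_perm: "set_pmf (uniform_perm n) = {\<sigma>. \<sigma> permutes {1..n}}"
proof -
  have "{\<sigma>. \<sigma> permutes {1..n}} \<noteq> {}" using permutes_id by blast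
  then show ?thesis unfolding uniform_perm_def
    by (simp add: set_pmf_of_set finite_permutations)
qed

lemma set_shuffle_subset: "m \<ge> 1 \<Longrightarrow> set_pmf (shuffle n m) \<subseteq> {\<sigma>. \<sigma> permutes {1..n}}"
  by (auto simp: set_pmf_iff pmf_shuffle shuffle_mass_def split: if_splits)

lemma pmf_shuffle_eq_likelihood:
  assumes "n \<ge> 1" "M \<ge> 1" "\<sigma> permutes {1..n}"
  shows "pmf (shuffle n M) \<sigma> = (\<Prod>i=1..n. 1 + (real i - real (rising_sequences n \<sigma>)) / real M) / fact n"
  using shuffle_likelihood[OF assms(1) _ rising_sequences_le[OF assms(1)] assms(2), of \<sigma>] assms
  by (simp add: pmf_shuffle shuffle_mass_def rising_sequences_def field_simps)

text \<open>
  For a fixed number of cards, one shuffle with more and more packs becomes uniform. This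
  transfers statements about words to uniform permutations.
\<close>
lemma shuffle_tendsto_uniform:
  assumes "n \<ge> 1"
  shows "(\<lambda>M. pmf (shuffle n M) \<sigma>) \<longlonglongrightarrow> pmf (uniform_perm n) \<sigma>"
proof (cases "\<sigma> permutes {1..n}")
  case True
  have "(\<lambda>M. (\<Prod>i=1..n. 1 + (real i - real (rising_sequences n \<sigma>)) / real M) / fact n)
      \<longlonglongrightarrow> (\<Prod>i=1..n. 1 + 0) / fact n"
    by (intro tendsto_intros lim_const_over_n) auto
  moreover have "\<forall>\<^sub>F M in sequentially. (\<Prod>i=1..n. 1 + (real i - real (rising_sequences n \<sigma>)) / real M) / fact n
      = pmf (shuffle n M) \<sigma>"
    using eventually_ge_at_top[of 1] by eventually_elim (rule pmf_shuffle_eq_likelihood[OF assms _ True, symmetric])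
  ultimately show ?thesis using True by (simp add: pmf_uniform_perm tendsto_cong)
next
  case False
  have "\<forall>\<^sub>F M in sequentially. pmf (shuffle n M) \<sigma> = 0"
    using eventually_ge_at_top[of 1] by eventually_elim (use False in \<open>simp add: pmf_shuffle shuffle_mass_def\<close>)
  then show ?thesis using False by (simp add: pmf_uniform_perm tendsto_eventually)
qed

lemma iexp_diff_le: "cmod (iexp a - iexp b) \<le> \<bar>a - b\<bar>"
proof -
  have "iexp a - iexp b = iexp b * (iexp (a - b) - 1)"
    by (simp add: algebra_simps flip: exp_add)
  then have "cmod (iexp a - iexp b) = cmod (iexp (a - b) - 1)"
    by (simp add: norm_mult)
  also have "\<dots> \<le> \<bar>a - b\<bar>" using iexp_approx1[of "a - b" 0] by simp
  finally show ?thesis .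
qed

text \<open>
  The limit is the characteristic function of the uniform distribution on \<open>[0, 1]\<close>;
  the averages are geometric sums.
\<close>
lemma mean_iexp_tendsto:
  assumes "\<theta> \<noteq> 0"
  shows "(\<lambda>M. (\<Sum>j<M. iexp (\<theta> * real j / real M)) / of_nat M) \<longlonglongrightarrow> (iexp \<theta> - 1) / (\<i> * \<theta>)"
proof -
  define z where "z = \<i> * complex_of_real \<theta>"
  have z0: "z \<noteq> 0" using assms by (simp add: z_def)
  have "((\<lambda>h. (exp h - 1) / h) \<longlongrightarrow> 1) (at (0::complex))"
    using DERIV_exp[of "0::complex"] by (simp add: has_field_derivative_iff)
  moreover have "filterlim (\<lambda>M. z / of_nat M) (at 0) sequentially"
    unfolding filterlim_at
  proof
    show "(\<lambda>M. z / of_nat M) \<longlonglongrightarrow> 0" by (rule lim_const_over_n)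
    show "\<forall>\<^sub>F M in sequentially. z / of_nat M \<in> UNIV \<and> z / of_nat M \<noteq> 0"
      using eventually_gt_at_top[of 0] by eventually_elim (use z0 in auto)
  qed
  ultimately have lim: "(\<lambda>M. (exp (z / of_nat M) - 1) / (z / of_nat M)) \<longlonglongrightarrow> 1"
    by (rule filterlim_compose)
  then have "(\<lambda>M. (exp z - 1) / z / ((exp (z / of_nat M) - 1) / (z / of_nat M))) \<longlonglongrightarrow> (exp z - 1) / z / 1"
    by (intro tendsto_divide tendsto_const) auto
  moreover have "\<forall>\<^sub>F M in sequentially. (exp z - 1) / z / ((exp (z / of_nat M) - 1) / (z / of_nat M)) =
      (\<Sum>j<M. iexp (\<theta> * real j / real M)) / of_nat M"
    using tendsto_imp_eventually_ne[OF lim zero_neq_one[symmetric]] eventually_gt_at_top[of 0]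
  proof eventually_elim
    case (elim M)
    define q where "q = exp (z / of_nat M)"
    have q: "q \<noteq> 1" using elim by (auto simp: q_def)
    have "(\<Sum>j<M. iexp (\<theta> * real j / real M)) = (\<Sum>j<M. q ^ j)"
      by (intro sum.cong refl) (simp add: q_def z_def field_simps flip: exp_of_nat_mult)
    also have "\<dots> = (q ^ M - 1) / (q - 1)" using q by (simp add: geometric_sum)
    also have "q ^ M = exp z" using elim by (simp add: q_def flip: exp_of_nat_mult)
    finally have S: "(\<Sum>j<M. iexp (\<theta> * real j / real M)) = (exp z - 1) / (q - 1)" .
    have "q - 1 \<noteq> 0" using q by simp
    then show ?case unfolding S q_def[symmetric] using elim z0 by (simp add: divide_simps)
  qed
  ultimately show ?thesis by (simp add: z_def tendsto_cong)
qed

text \<open>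
  For words over \<open>M\<close> letters, the number of descents can be replaced by the integer
  part of \<open>(x 1 + ... + x n) / M\<close>. Dropping the integer part moves the
  exponent by at most \<open>\<bar>\<theta>\<bar>\<close>, uniformly in \<open>M\<close>, and
  leaves a product of \<open>n\<close> equal means. The bound survives the limit
  \<open>M \<rightarrow> \<infinity>\<close>.
\<close>
lemma char_descents_approx:
  assumes "n \<ge> 1" "\<theta> \<noteq> 0"
  shows "cmod ((\<Sum>\<sigma> | \<sigma> permutes {1..n}. iexp (\<theta> * real (des n \<sigma>))) / fact n
           - ((iexp \<theta> - 1) / (\<i> * \<theta>)) ^ n) \<le> \<bar>\<theta>\<bar>"
proof -
  let ?P = "{\<sigma>. \<sigma> permutes {1..n}}"
  define A where "A M = (\<Sum>\<sigma>\<in>?P. pmf (shuffle n M) \<sigma> *\<^sub>R iexp (\<theta> * real (des n \<sigma>)))" for M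
  define B where "B M = ((\<Sum>j<M. iexp (\<theta> * real j / real M)) / of_nat M) ^ n" for M
  have fin: "finite ?P" by (simp add: finite_permutations)
  have A: "A \<longlonglongrightarrow> (\<Sum>\<sigma>\<in>?P. pmf (uniform_perm n) \<sigma> *\<^sub>R iexp (\<theta> * real (des n \<sigma>)))"
    unfolding A_def by (intro tendsto_intros shuffle_tendsto_uniform assms)
  have A': "(\<Sum>\<sigma>\<in>?P. pmf (uniform_perm n) \<sigma> *\<^sub>R iexp (\<theta> * real (des n \<sigma>))) =
      (\<Sum>\<sigma>\<in>?P. iexp (\<theta> * real (des n \<sigma>))) / fact n"
    by (simp add: pmf_uniform_perm scaleR_conv_of_real sum_divide_distrib)
  have B: "B \<longlonglongrightarrow> ((iexp \<theta> - 1) / (\<i> * \<theta>)) ^ n"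
    unfolding B_def by (intro tendsto_power mean_iexp_tendsto assms)
  have "cmod (A M - B M) \<le> \<bar>\<theta>\<bar>" if M: "M \<ge> 1" for M
  proof -
    let ?S = "\<lambda>x. \<Sum>i=1..n. x i"
    have "A M = measure_pmf.expectation (shuffle n M) (\<lambda>\<sigma>. iexp (\<theta> * real (des n \<sigma>)))"
      unfolding A_def by (rule integral_measure_pmf[symmetric, OF fin])
        (use set_shuffle_subset[OF M] in auto)
    also have "\<dots> = (\<Sum>w\<in>words n M. iexp (\<theta> * real (des n w))) / of_nat M ^ n"
      using M words_nonempty[OF M, of n]
      unfolding shuffle_eq_map_rank[OF M] integral_map_pmf des_word_rank
      by (subst integral_measure_pmf[of "words n M"])
         (auto simp: pmf_of_set card_words scaleR_conv_of_real sum_divide_distrib)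
    also have "(\<Sum>w\<in>words n M. iexp (\<theta> * real (des n w))) = (\<Sum>x\<in>words n M. iexp (\<theta> * real (?S x div M)))"
      using assms by (intro sum_words_descents) auto
    finally have AM: "A M = \<dots> / of_nat M ^ n" .
    have "B M = (\<Prod>i=1..n. \<Sum>j<M. iexp (\<theta> * real j / real M)) / of_nat M ^ n"
      by (simp add: B_def power_divide)
    also have "(\<Prod>i=1..n. \<Sum>j<M. iexp (\<theta> * real j / real M)) = (\<Sum>x\<in>words n M. \<Prod>i=1..n. iexp (\<theta> * real (x i) / real M))"
      unfolding words_def by (rule prod_sum_PiE) auto
    also have "\<dots> = (\<Sum>x\<in>words n M. iexp (\<theta> * real (?S x) / real M))"
      by (intro sum.cong refl) (simp add: sum_distrib_left sum_divide_distrib flip: exp_sum)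
    finally have BM: "B M = \<dots> / of_nat M ^ n" .
    have "cmod (A M - B M) = cmod (\<Sum>x\<in>words n M. iexp (\<theta> * real (?S x div M)) - iexp (\<theta> * real (?S x) / real M)) / real M ^ n"
      by (simp add: AM BM sum_subtractf norm_divide norm_power flip: diff_divide_distrib)
    also have "\<dots> \<le> (\<Sum>x\<in>words n M. \<bar>\<theta>\<bar>) / real M ^ n"
    proof (intro divide_right_mono sum_norm_le)
      fix x
      have "?S x = M * (?S x div M) + ?S x mod M" "?S x mod M \<le> M"
        using M by (auto intro: less_imp_le)
      then have "real (?S x) = real M * real (?S x div M) + real (?S x mod M)" "real (?S x mod M) \<le> real M"
        by (metis of_nat_add of_nat_mult, metis of_nat_le_iff)
      then have s: "\<bar>real (?S x div M) - real (?S x) / real M\<bar> \<le> 1"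
        using M by (simp add: field_simps)
      have "cmod (iexp (\<theta> * real (?S x div M)) - iexp (\<theta> * real (?S x) / real M)) \<le>
          \<bar>\<theta> * real (?S x div M) - \<theta> * real (?S x) / real M\<bar>"
        by (rule iexp_diff_le)
      also have "\<dots> = \<bar>\<theta>\<bar> * \<bar>real (?S x div M) - real (?S x) / real M\<bar>"
        by (simp add: abs_mult[symmetric] algebra_simps)
      also have "\<dots> \<le> \<bar>\<theta>\<bar>" using s by (simp add: mult_left_le)
      finally show "cmod (iexp (\<theta> * real (?S x div M)) - iexp (\<theta> * real (?S x) / real M)) \<le> \<bar>\<theta>\<bar>" .
    qed simp
    also have "\<dots> = \<bar>\<theta>\<bar>" using M by (simp add: card_words)
    finally show ?thesis .
  qed
  note bound = this
  have "\<forall>\<^sub>F M in sequentially. cmod (A M - B M) \<le> \<bar>\<theta>\<bar>"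
    by (rule eventually_mono[OF eventually_ge_at_top[of 1]]) (rule bound)
  then show ?thesis
    using tendsto_upperbound[OF tendsto_norm[OF tendsto_diff[OF A B]]] A' by simp
qed

text \<open>
  For \<open>n \<ge> 2\<close> the number of descents of a uniform permutation has variance
  \<open>(n + 1) / 12\<close> and mean \<open>(n - 1) / 2\<close>; the centring and
  scaling used here differ from these by negligible amounts.
\<close>
definition descent_law :: "nat \<Rightarrow> real measure" where
  "descent_law n = distr (measure_pmf (uniform_perm n)) borel
     (\<lambda>\<sigma>. (real (des n \<sigma>) - real n / 2) / sqrt (real n / 12))"

lemma real_distribution_descent_law: "real_distribution (descent_law n)"
  unfolding descent_law_def by (rule prob_space.real_distribution_distr[OF prob_space_measure_pmf]) simp

lemma sinc_power_tendsto:
  fixes t :: real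
  assumes "t \<noteq> 0"
  shows "(\<lambda>n. (sin (t / sqrt (real n / 12) / 2) / (t / sqrt (real n / 12) / 2)) ^ n) \<longlonglongrightarrow> exp (- t\<^sup>2 / 2)"
proof -
  \<comment> \<open>The function \<open>sin x / x\<close> is even, and its argument is \<open>c / sqrt n\<close> up to sign.\<close>
  define c where "c = sqrt 3 * \<bar>t\<bar>"
  have c: "c > 0" "c\<^sup>2 = 3 * t\<^sup>2" using assms by (simp_all add: c_def power_mult_distrib)
  have "(\<lambda>n. (sin (c / sqrt (real n)) / (c / sqrt (real n))) ^ n) \<longlonglongrightarrow> exp (- c\<^sup>2 / 6)"
    using c(1) by (real_asymp simp: power2_eq_square)
  moreover have "sin (c / sqrt (real n)) / (c / sqrt (real n)) =
      sin (t / sqrt (real n / 12) / 2) / (t / sqrt (real n / 12) / 2)" for n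
  proof -
    define x where "x = t / sqrt (real n / 12) / 2"
    have "sqrt 12 = 2 * sqrt 3" using real_sqrt_mult[of 4 3] by simp
    then have "c / sqrt (real n) = \<bar>t\<bar> / sqrt (real n / 12) / 2"
      by (simp add: c_def real_sqrt_divide)
    then have "c / sqrt (real n) = x \<or> c / sqrt (real n) = - x"
      by (auto simp: x_def abs_if)
    then have "sin (c / sqrt (real n)) / (c / sqrt (real n)) = sin x / x"
      by (elim disjE) (simp_all only: sin_minus minus_divide_divide)
    then show ?thesis by (simp add: x_def)
  qed
  ultimately show ?thesis using c(2) by simp
qed

lemma iexp_mean_sinc:
  assumes "\<theta> \<noteq> 0"
  shows "(iexp \<theta> - 1) / (\<i> * \<theta>) * iexp (- \<theta> / 2) = complex_of_real (sin (\<theta> / 2) / (\<theta> / 2))"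
proof -
  have "(iexp \<theta> - 1) * iexp (- \<theta> / 2) = iexp (\<theta> / 2) - iexp (- (\<theta> / 2))"
    by (simp add: algebra_simps flip: exp_add)
  also have "\<dots> = 2 * \<i> * sin (\<theta> / 2)"
    by (simp add: complex_eq_iff Re_exp Im_exp)
  finally show ?thesis using assms by (simp add: field_simps)
qed

text \<open>
  By Levy's continuity theorem it is enough to compare characteristic functions. At
  \<open>t\<close> the relevant frequency is \<open>\<theta> = t / sqrt (n / 12)\<close>,
  so the error \<open>\<bar>\<theta>\<bar>\<close> from replacing descents by a sum of uniform
  variables vanishes, and that sum contributes
  \<open>(sin (\<theta> / 2) / (\<theta> / 2)) ^ n\<close>.
\<close>
lemma weak_conv_descent_law: "weak_conv_m descent_law std_normal_distribution"
proof (rule levy_continuity[OF real_distribution_descent_law real_dist_normal_dist])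
  fix t :: real
  let ?P = "\<lambda>n. {\<sigma>. \<sigma> permutes {1..n}}"
  show "(\<lambda>n. char (descent_law n) t) \<longlonglongrightarrow> char std_normal_distribution t"
  proof (cases "t = 0")
    case True
    have "char (descent_law n) 0 = 1" for n
      using real_distribution.char_zero[OF real_distribution_descent_law] .
    then show ?thesis using True by (simp add: char_std_normal_distribution)
  next
    case False
    define \<theta> where "\<theta> n = t / sqrt (real n / 12)" for n :: nat
    define s where "s n = sin (\<theta> n / 2) / (\<theta> n / 2)" for n
    have s: "(\<lambda>n. complex_of_real (s n ^ n)) \<longlonglongrightarrow> complex_of_real (exp (- t\<^sup>2 / 2))"
      unfolding s_def \<theta>_def by (intro tendsto_of_real sinc_power_tendsto False)
    have \<theta>0: "\<theta> \<longlonglongrightarrow> 0" unfolding \<theta>_def by real_asymp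
    have "cmod (char (descent_law n) t - of_real (s n ^ n)) \<le> \<bar>\<theta> n\<bar>" if n: "n \<ge> 1" for n
    proof -
      have \<theta>n: "\<theta> n \<noteq> 0" using False n by (simp add: \<theta>_def)
      define X where "X = (\<Sum>\<sigma>\<in>?P n. iexp (\<theta> n * real (des n \<sigma>))) / fact n"
      have "char (descent_law n) t = measure_pmf.expectation (uniform_perm n)
          (\<lambda>\<sigma>. iexp (t * ((real (des n \<sigma>) - real n / 2) / sqrt (real n / 12))))"
        by (simp add: char_def descent_law_def integral_distr)
      also have "\<dots> = (\<Sum>\<sigma>\<in>?P n. iexp (t * ((real (des n \<sigma>) - real n / 2) / sqrt (real n / 12)))) / fact n"
        by (subst integral_measure_pmf[of "?P n"])
           (auto simp: finite_permutations set_uniform_perm pmf_uniform_perm scaleR_conv_of_real sum_divide_distrib)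
      also have "\<dots> = (\<Sum>\<sigma>\<in>?P n. iexp (\<theta> n * real (des n \<sigma>)) * iexp (- \<theta> n / 2) ^ n) / fact n"
      proof -
        have "iexp (t * ((real (des n \<sigma>) - real n / 2) / sqrt (real n / 12))) =
            iexp (\<theta> n * real (des n \<sigma>)) * iexp (- \<theta> n / 2) ^ n" for \<sigma>
        proof -
          have "t * ((real (des n \<sigma>) - real n / 2) / sqrt (real n / 12)) =
              \<theta> n * real (des n \<sigma>) + real n * (- \<theta> n / 2)"
            by (simp add: \<theta>_def algebra_simps diff_divide_distrib)
          then show ?thesis
            by (simp only: of_real_add of_real_mult distrib_left exp_add of_real_of_nat_eq
                mult.left_commute[of \<i>] exp_of_nat_mult)
        qed
        then show ?thesis by simp
      qed
      also have "\<dots> = X * iexp (- \<theta> n / 2) ^ n"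
        by (simp add: X_def sum_distrib_right)
      finally have 1: "char (descent_law n) t = X * iexp (- \<theta> n / 2) ^ n" .
      have 2: "complex_of_real (s n ^ n) = ((iexp (\<theta> n) - 1) / (\<i> * \<theta> n)) ^ n * iexp (- \<theta> n / 2) ^ n"
        unfolding s_def iexp_mean_sinc[OF \<theta>n, symmetric] of_real_power power_mult_distrib ..
      have "cmod (char (descent_law n) t - of_real (s n ^ n)) =
          cmod (X - ((iexp (\<theta> n) - 1) / (\<i> * \<theta> n)) ^ n) * cmod (iexp (- \<theta> n / 2) ^ n)"
        unfolding 1 2 left_diff_distrib[symmetric] norm_mult ..
      also have "cmod (iexp (- \<theta> n / 2) ^ n) = 1"
        unfolding norm_power norm_exp_i_times by simp
      finally show ?thesis using char_descents_approx[OF n \<theta>n] by (simp add: X_def)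
    qed
    note bound = this
    have "\<forall>\<^sub>F n in sequentially. cmod (char (descent_law n) t - of_real (s n ^ n)) \<le> \<bar>\<theta> n\<bar>"
      by (rule eventually_mono[OF eventually_ge_at_top[of 1]]) (rule bound)
    then have "(\<lambda>n. char (descent_law n) t - of_real (s n ^ n)) \<longlonglongrightarrow> 0"
      using \<theta>0 by (rule Lim_null_comparison[OF _ tendsto_rabs_zero])
    from tendsto_add[OF this s] show ?thesis by (simp add: char_std_normal_distribution)
  qed
qed

section \<open>The limit profile as a Gaussian integral\<close>

definition normal_mass :: "real \<Rightarrow> real" where
  "normal_mass b = measure std_normal_distribution {- b<..<b}"

interpretation std_normal: real_distribution std_normal_distribution
  by (rule real_dist_normal_dist)

lemma measure_std_normal:
  assumes "A \<in> sets borel"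
  shows "measure std_normal_distribution A = (\<integral>x. indicator A x * std_normal_density x \<partial>lborel)"
proof -
  have "measure std_normal_distribution A = (\<integral>x. indicator A x \<partial>std_normal_distribution)"
    using assms by simp
  also have "\<dots> = (\<integral>x. std_normal_density x * indicator A x \<partial>lborel)"
    using assms by (subst integral_real_density) auto
  finally show ?thesis by (simp add: mult.commute)
qed

lemma measure_std_normal_singleton: "measure std_normal_distribution {x} = 0"
proof -
  have "{x} \<in> null_sets lborel" by (rule finite_imp_null_set_lborel) simp
  then have "AE y in lborel. y \<notin> {x}" by (rule AE_not_in)
  then have ae: "AE y in lborel. y \<in> {x} \<longrightarrow> ennreal (std_normal_density y) = 0"
    by (rule eventually_mono) simp
  have "(\<lambda>y. ennreal (std_normal_density y)) \<in> borel_measurable lborel" by simp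
  from null_sets_density_iff[OF this, of "{x}"] have "{x} \<in> null_sets std_normal_distribution"
    using ae by simp
  then show ?thesis by (simp add: measure_eq_0_null_sets)
qed

lemma measure_std_normal_pos:
  assumes "a < b"
  shows "measure std_normal_distribution {a<..<b} > 0"
proof (rule ccontr)
  assume "\<not> ?thesis"
  then have "measure std_normal_distribution {a<..<b} = 0" by (simp add: not_less measure_le_0_iff)
  then have "{a<..<b} \<in> null_sets std_normal_distribution"
    by (simp add: null_sets_def std_normal.emeasure_eq_measure)
  then have "AE x in lborel. x \<in> {a<..<b} \<longrightarrow> ennreal (std_normal_density x) = 0"
    by (subst (asm) null_sets_density_iff) auto
  then have "AE x in lborel. x \<notin> {a<..<b}"
    by (rule eventually_mono) (metis ennreal_eq_0_iff normal_density_pos not_le zero_less_one)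
  then have "{a<..<b} \<in> null_sets lborel"
    by (subst (asm) AE_iff_null_sets[symmetric]) auto
  then show False using assms by (simp add: null_sets_def)
qed

lemma normal_mass_less_1: "normal_mass b < 1"
proof -
  have "normal_mass b + measure std_normal_distribution {b<..<b + 1} =
      measure std_normal_distribution ({- b<..<b} \<union> {b<..<b + 1})"
    unfolding normal_mass_def
    by (rule std_normal.finite_measure_Union[symmetric]) auto
  also have "\<dots> \<le> 1" by (rule std_normal.prob_le_1)
  finally show ?thesis using measure_std_normal_pos[of b "b + 1"] by simp
qed

lemma normal_mass_pos: "b > 0 \<Longrightarrow> normal_mass b > 0"
  unfolding normal_mass_def by (rule measure_std_normal_pos) simp

lemma normal_mass_mono: "b \<le> c \<Longrightarrow> normal_mass b \<le> normal_mass c"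
  unfolding normal_mass_def by (rule std_normal.finite_measure_mono) auto

lemma normal_mass_eq_cdf:
  assumes "b \<ge> 0"
  shows "normal_mass b = cdf std_normal_distribution b - cdf std_normal_distribution (- b)"
proof -
  have "measure std_normal_distribution {- b<..b} = measure std_normal_distribution ({- b<..<b} \<union> (if b = 0 then {} else {b}))"
    using assms by (intro arg_cong[where f = "measure _"]) auto
  also have "\<dots> = normal_mass b + measure std_normal_distribution (if b = 0 then {} else {b})"
    unfolding normal_mass_def by (intro std_normal.finite_measure_Union) auto
  finally have "measure std_normal_distribution {- b<..b} = normal_mass b"
    by (simp add: measure_std_normal_singleton)
  moreover have "cdf std_normal_distribution b - cdf std_normal_distribution (- b) =
      measure std_normal_distribution {- b<..b}"
    by (cases "b = 0") (use assms in \<open>auto intro!: std_normal.cdf_diff_eq\<close>)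
  ultimately show ?thesis by simp
qed

lemma normal_mass_at_top: "(normal_mass \<longlongrightarrow> 1) at_top"
proof -
  have "((\<lambda>b. cdf std_normal_distribution b - cdf std_normal_distribution (- b)) \<longlongrightarrow> 1 - 0) at_top"
    by (intro tendsto_diff std_normal.cdf_lim_at_top_prob
        filterlim_compose[OF std_normal.cdf_lim_at_bot filterlim_uminus_at_bot_at_top])
  moreover have "\<forall>\<^sub>F b in at_top. cdf std_normal_distribution b - cdf std_normal_distribution (- b) = normal_mass b"
    using eventually_ge_at_top[of 0] by eventually_elim (simp add: normal_mass_eq_cdf)
  ultimately show ?thesis by (simp add: tendsto_cong)
qed

lemma normal_mass_at_right_0: "(normal_mass \<longlongrightarrow> 0) (at_right 0)"
proof -
  have c: "isCont (cdf std_normal_distribution) 0"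
    by (simp add: std_normal.isCont_cdf measure_std_normal_singleton)
  have *: "((\<lambda>b. cdf std_normal_distribution b - cdf std_normal_distribution (- b))
      \<longlongrightarrow> cdf std_normal_distribution 0 - cdf std_normal_distribution 0) (at_right 0)"
    by (intro tendsto_diff isCont_tendsto_compose[OF c]) (auto intro!: tendsto_eq_intros)
  moreover have "\<forall>\<^sub>F b in at_right 0. cdf std_normal_distribution b - cdf std_normal_distribution (- b) = normal_mass b"
    unfolding eventually_at_right_field by (auto intro!: exI[of _ 1] normal_mass_eq_cdf[symmetric])
  ultimately show ?thesis by (simp add: tendsto_cong)
qed

lemma Psi_eq_integral:
  assumes "0 \<le> b" "b = x / ereal (4 * sqrt 3)"
  shows "Psi x = measure std_normal_distribution (einterval (- b) b)"
proof -
  have "- b \<le> b" using assms(1) by (cases b) auto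
  then have "Psi x = 1 / sqrt (2 * pi) * (\<integral>s. indicator (einterval (- b) b) s *\<^sub>R exp (- (s\<^sup>2) / 2) \<partial>lborel)"
    unfolding Psi_def assms(2)[symmetric]
    by (simp add: interval_lebesgue_integral_def set_lebesgue_integral_def)
  also have "\<dots> = (\<integral>s. 1 / sqrt (2 * pi) * (indicator (einterval (- b) b) s *\<^sub>R exp (- (s\<^sup>2) / 2)) \<partial>lborel)"
    by (rule Bochner_Integration.integral_mult_right_zero[symmetric])
  also have "\<dots> = (\<integral>s. indicator (einterval (- b) b) s * std_normal_density s \<partial>lborel)"
    by (rule Bochner_Integration.integral_cong[OF refl]) (simp add: std_normal_density_def)
  also have "\<dots> = measure std_normal_distribution (einterval (- b) b)"
    by (simp add: measure_std_normal)
  finally show ?thesis .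
qed

lemma Psi_ereal:
  assumes "x \<ge> 0"
  shows "Psi (ereal x) = normal_mass (x / (4 * sqrt 3))"
proof -
  define b where "b = x / (4 * sqrt 3)"
  have b: "b \<ge> 0" "ereal b = ereal x / ereal (4 * sqrt 3)" using assms by (simp_all add: b_def)
  have "einterval (- ereal b) (ereal b) = {- b<..<b}" by (auto simp: einterval_def)
  then have "Psi (ereal x) = normal_mass b"
    using Psi_eq_integral[of "ereal b" "ereal x"] b by (simp add: normal_mass_def)
  then show ?thesis by (simp add: b_def)
qed

lemma Psi_infinity: "Psi \<infinity> = 1"
proof -
  have "Psi \<infinity> = measure std_normal_distribution (einterval (- \<infinity>) \<infinity>)"
    by (rule Psi_eq_integral) auto
  also have "einterval (- \<infinity>) \<infinity> = UNIV" by (auto simp: einterval_def)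
  finally show ?thesis using std_normal.prob_space by simp
qed

text \<open>
  The exponential is the density at \<open>z\<close> of the normal distribution with mean
  \<open>- 2 * b\<close> relative to the standard one, so the integral is the total variation
  distance of two unit Gaussians whose means differ by \<open>2 * b\<close>. The positive part
  is supported on \<open>z > - b\<close>, and shifting the second Gaussian by
  \<open>2 * b\<close> turns the difference of the two tails into the mass of
  \<open>{- b..b}\<close>.
\<close>
lemma integral_likelihood_deficit:
  assumes "b \<ge> 0"
  shows "(\<integral>z. max 0 (1 - exp (- 2 * b * z - 2 * b\<^sup>2)) \<partial>std_normal_distribution) = normal_mass b"
proof -
  let ?d = std_normal_density
  have shift: "?d (2 * b + z) = ?d z * exp (- 2 * b * z - 2 * b\<^sup>2)" for z
    by (simp add: std_normal_density_def field_simps power2_eq_square flip: exp_add)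
  have "(\<integral>z. max 0 (1 - exp (- 2 * b * z - 2 * b\<^sup>2)) \<partial>std_normal_distribution) =
      (\<integral>z. ?d z * max 0 (1 - exp (- 2 * b * z - 2 * b\<^sup>2)) \<partial>lborel)"
    by (subst integral_real_density) auto
  also have "\<dots> = (\<integral>z. indicator {- b<..} z * ?d z - indicator {b<..} (2 * b + z) * ?d (2 * b + z) \<partial>lborel)"
  proof (rule Bochner_Integration.integral_cong[OF refl])
    fix z
    define E where "E = exp (- 2 * b * z - 2 * b\<^sup>2)"
    have E: "E = exp (- (2 * (b * (z + b))))"
      by (simp add: E_def algebra_simps power2_eq_square)
    show "?d z * max 0 (1 - exp (- 2 * b * z - 2 * b\<^sup>2)) =
        indicator {- b<..} z * ?d z - indicator {b<..} (2 * b + z) * ?d (2 * b + z)"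
    proof (cases "z > - b")
      case True
      then have "E \<le> 1" using assms by (simp add: E)
      moreover have "2 * b + z > b" using True by simp
      ultimately show ?thesis using True unfolding shift E_def[symmetric]
        by (simp add: right_diff_distrib)
    next
      case False
      then have "b * (z + b) \<le> 0" using assms by (simp add: mult_nonneg_nonpos)
      then have "E \<ge> 1" by (simp add: E)
      moreover have "\<not> 2 * b + z > b" using False by simp
      ultimately show ?thesis using False unfolding shift E_def[symmetric] by simp
    qed
  qed
  also have "\<dots> = (\<integral>z. indicator {- b<..} z * ?d z \<partial>lborel) -
      (\<integral>z. indicator {b<..} (2 * b + z) * ?d (2 * b + z) \<partial>lborel)"
  proof (rule Bochner_Integration.integral_diff)
    have i: "integrable lborel (\<lambda>z. indicator {c<..} z * ?d z)" for c
      by (rule Bochner_Integration.integrable_bound[OF integrable_normal_density[of 1 0]]) (auto simp: indicator_def)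
    show "integrable lborel (\<lambda>z. indicator {- b<..} z * ?d z)" by (rule i)
    show "integrable lborel (\<lambda>z. indicator {b<..} (2 * b + z) * ?d (2 * b + z))"
      using lborel_integrable_real_affine[OF i[of b], of 1 "2 * b"] by simp
  qed
  also have "(\<integral>z. indicator {b<..} (2 * b + z) * ?d (2 * b + z) \<partial>lborel) = (\<integral>z. indicator {b<..} z * ?d z \<partial>lborel)"
    using lborel_integral_real_affine[of 1 "\<lambda>z. indicator {b<..} z * ?d z" "2 * b"] by simp
  also have "(\<integral>z. indicator {- b<..} z * ?d z \<partial>lborel) - (\<integral>z. indicator {b<..} z * ?d z \<partial>lborel) =
      measure std_normal_distribution {- b<..} - measure std_normal_distribution {b<..}"
    by (simp add: measure_std_normal)
  also have "\<dots> = cdf std_normal_distribution b - cdf std_normal_distribution (- b)"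
  proof -
    have "measure std_normal_distribution {c<..} = 1 - cdf std_normal_distribution c" for c
      using std_normal.prob_compl[of "{..c}"] by (simp add: cdf_def Compl_eq_Diff_UNIV[symmetric])
    then show ?thesis by simp
  qed
  finally show ?thesis using assms by (simp add: normal_mass_eq_cdf)
qed

section \<open>Asymptotics of the likelihood ratio\<close>

text \<open>
  The derivative of \<open>ln (1 + y) - y + y\<^sup>2 / 2\<close> is
  \<open>y\<^sup>2 / (1 + y)\<close>, which is at most \<open>2 * x\<^sup>2\<close> for
  \<open>\<bar>y\<bar> \<le> \<bar>x\<bar> \<le> 1 / 2\<close>; the mean value theorem gives
  the bound.
\<close>
lemma ln_one_plus_second_order:
  fixes x :: real
  assumes "\<bar>x\<bar> \<le> 1/2"
  shows "\<bar>ln (1 + x) - x + x\<^sup>2 / 2\<bar> \<le> 2 * \<bar>x\<bar> ^ 3"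
proof -
  define h where "h y = ln (1 + y) - y + y\<^sup>2 / 2" for y :: real
  let ?I = "{- \<bar>x\<bar>..\<bar>x\<bar>}"
  have "norm (h x - h 0) \<le> (2 * x\<^sup>2) * norm (x - 0)"
  proof (rule field_differentiable_bound[of ?I h "\<lambda>y. y\<^sup>2 / (1 + y)"])
    fix y assume y: "y \<in> ?I"
    then have y1: "1 + y \<ge> 1/2" "\<bar>y\<bar> \<le> \<bar>x\<bar>" using assms by auto
    have "((\<lambda>y. ln (1 + y) - y + y\<^sup>2 / 2) has_field_derivative (1 / (1 + y) - 1 + y)) (at y within ?I)"
      using y1 by (auto intro!: derivative_eq_intros)
    also have "1 / (1 + y) - 1 + y = y\<^sup>2 / (1 + y)"
      using y1 by (simp add: field_simps power2_eq_square)
    finally show "(h has_field_derivative y\<^sup>2 / (1 + y)) (at y within ?I)"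
      by (simp add: h_def[abs_def])
    have "y\<^sup>2 / (1 + y) \<le> x\<^sup>2 / (1 / 2)"
      using y1 by (intro frac_le) (auto simp: abs_le_square_iff)
    then show "norm (y\<^sup>2 / (1 + y)) \<le> 2 * x\<^sup>2" using y1 by simp
  qed auto
  then show ?thesis by (simp add: h_def power3_eq_cube power2_eq_square abs_mult)
qed

lemma prod_one_plus_approx:
  fixes x :: "'a \<Rightarrow> real"
  assumes "finite J" "\<And>j. j \<in> J \<Longrightarrow> \<bar>x j\<bar> \<le> \<delta>" "\<delta> \<le> 1/2"
  shows "\<exists>e. (\<Prod>j\<in>J. 1 + x j) = exp ((\<Sum>j\<in>J. x j) - (\<Sum>j\<in>J. (x j)\<^sup>2) / 2 + e) \<and> \<bar>e\<bar> \<le> 2 * real (card J) * \<delta> ^ 3"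
proof (intro exI conjI)
  let ?e = "\<Sum>j\<in>J. ln (1 + x j) - x j + (x j)\<^sup>2 / 2"
  have pos: "1 + x j > 0" if "j \<in> J" for j using assms(2)[OF that] assms(3) by auto
  have "(\<Prod>j\<in>J. 1 + x j) = (\<Prod>j\<in>J. exp (ln (1 + x j)))"
    using pos by (intro prod.cong) auto
  also have "\<dots> = exp (\<Sum>j\<in>J. ln (1 + x j))" using assms(1) by (simp add: exp_sum)
  also have "(\<Sum>j\<in>J. ln (1 + x j)) = (\<Sum>j\<in>J. x j) - (\<Sum>j\<in>J. (x j)\<^sup>2) / 2 + ?e"
    by (simp add: sum.distrib sum_subtractf sum_divide_distrib)
  finally show "(\<Prod>j\<in>J. 1 + x j) = exp ((\<Sum>j\<in>J. x j) - (\<Sum>j\<in>J. (x j)\<^sup>2) / 2 + ?e)" .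
  have "\<bar>?e\<bar> \<le> (\<Sum>j\<in>J. 2 * \<delta> ^ 3)"
  proof (rule order_trans[OF sum_abs sum_mono])
    fix j assume j: "j \<in> J"
    have "\<bar>ln (1 + x j) - x j + (x j)\<^sup>2 / 2\<bar> \<le> 2 * \<bar>x j\<bar> ^ 3"
      using assms(2)[OF j] assms(3) by (intro ln_one_plus_second_order) auto
    also have "\<bar>x j\<bar> ^ 3 \<le> \<delta> ^ 3" using assms(2)[OF j] by (intro power_mono) auto
    finally show "\<bar>ln (1 + x j) - x j + (x j)\<^sup>2 / 2\<bar> \<le> 2 * \<delta> ^ 3" by simp
  qed
  then show "\<bar>?e\<bar> \<le> 2 * real (card J) * \<delta> ^ 3" by simp
qed

text \<open>
  The density of an \<open>M\<close>-shuffle at a permutation with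
  \<open>r = 1 + n / 2 + z * sqrt (n / 12)\<close> rising sequences, extended to all
  real \<open>z\<close>.
\<close>
definition likelihood :: "nat \<Rightarrow> nat \<Rightarrow> real \<Rightarrow> real" where
  "likelihood n M z = (\<Prod>j=1..n. 1 + (real j - (1 + real n / 2 + z * sqrt (real n / 12))) / real M)"

lemma sum_real_1_n: "(\<Sum>j=1..n. real j) = real n * (real n + 1) / 2"
  by (induction n) (auto simp: field_simps)

lemma sum_real_square_1_n: "(\<Sum>j=1..n. (real j)\<^sup>2) = real n * (real n + 1) * (2 * real n + 1) / 6"
  by (induction n) (auto simp: field_simps power2_eq_square)

text \<open>
  Write \<open>A = n powr (3/2) / M\<close> and \<open>u = 1 / sqrt n\<close> for
  \<open>n = \<nu> i\<close>. The factors are \<open>1 + x\<close> with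
  \<open>\<bar>x\<bar> \<le> \<delta> = O(A u)\<close>. The sum of the \<open>x\<close> is
  \<open>S1\<close>, the sum of their squares is \<open>S2\<close>, both polynomials in
  \<open>A\<close>, \<open>u\<close> and \<open>y\<close>, and the third-order error is at most
  \<open>2 * n * \<delta> ^ 3 = B\<close>, which is of order \<open>A ^ 3 * u\<close>.
  Letting \<open>u \<rightarrow> 0\<close> gives the limit. The arguments \<open>y i\<close>
  are allowed to vary, because almost sure convergence of random arguments is what the application
  provides.
\<close>
lemma likelihood_tendsto:
  fixes \<nu> M :: "nat \<Rightarrow> nat"
  assumes \<nu>: "filterlim \<nu> at_top sequentially" and M: "\<And>i. M i \<ge> 1"
    and a: "(\<lambda>i. real (\<nu> i) * sqrt (real (\<nu> i)) / real (M i)) \<longlonglongrightarrow> a"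
    and y: "y \<longlonglongrightarrow> y0"
  shows "(\<lambda>i. likelihood (\<nu> i) (M i) (y i)) \<longlonglongrightarrow> exp (- a * y0 / sqrt 12 - a\<^sup>2 / 24)"
proof -
  define A where "A i = real (\<nu> i) * sqrt (real (\<nu> i)) / real (M i)" for i
  define u where "u i = 1 / sqrt (real (\<nu> i))" for i
  define \<delta> where "\<delta> i = (1 + \<bar>y i\<bar>) * (A i * u i)" for i
  define x where "x i j = (real j - (1 + real (\<nu> i) / 2 + y i * sqrt (real (\<nu> i) / 12))) / real (M i)" for i j
  define S1 where "S1 i = - (A i * u i) / 2 - y i * A i / sqrt 12" for i
  define S2 where "S2 i = (A i)\<^sup>2 / 12 + (A i)\<^sup>2 * u i ^ 4 / 6 + y i / sqrt 12 * (A i)\<^sup>2 * u i ^ 3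
      + (y i)\<^sup>2 / 12 * (A i)\<^sup>2 * (u i)\<^sup>2" for i
  define B where "B i = 2 * (A i ^ 3 * u i) * (1 + \<bar>y i\<bar>) ^ 3" for i
  have A: "A \<longlonglongrightarrow> a" using a by (simp add: A_def[abs_def])
  have "filterlim (\<lambda>i. real (\<nu> i)) at_top sequentially"
    by (rule filterlim_compose[OF filterlim_real_sequentially \<nu>])
  then have u: "u \<longlonglongrightarrow> 0"
    unfolding u_def[abs_def]
    by (intro tendsto_divide_0[OF tendsto_const] filterlim_at_top_imp_at_infinity
        filterlim_compose[OF sqrt_at_top])
  have \<delta>0: "\<delta> \<longlonglongrightarrow> 0" unfolding \<delta>_def[abs_def]
    using tendsto_mult[OF tendsto_add[OF tendsto_const[of 1] tendsto_rabs[OF y]] tendsto_mult[OF A u]] by simp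
  have S1: "S1 \<longlonglongrightarrow> - a * y0 / sqrt 12" unfolding S1_def[abs_def]
    by (rule tendsto_eq_intros A u y refl | simp)+
  have S2: "S2 \<longlonglongrightarrow> a\<^sup>2 / 12" unfolding S2_def[abs_def]
    by (rule tendsto_eq_intros A u y refl | simp)+
  have B: "B \<longlonglongrightarrow> 0" unfolding B_def[abs_def]
    by (rule tendsto_eq_intros A u y refl | simp)+
  \<comment> \<open>The error in the exponent; it is controlled once all factors are close to \<open>1\<close>.\<close>
  define E where "E i = ln (likelihood (\<nu> i) (M i) (y i)) - (S1 i - S2 i / 2)" for i
  have main: "likelihood (\<nu> i) (M i) (y i) = exp (S1 i - S2 i / 2 + E i) \<and> \<bar>E i\<bar> \<le> B i"
    if i: "\<nu> i \<ge> 1" "\<delta> i \<le> 1/2" for i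
  proof -
    define n q m where "n = real (\<nu> i)" "q = sqrt n" "m = real (M i)"
    have nq: "n = q\<^sup>2" "q \<ge> 1" "m > 0" using i(1) M[of i] by (auto simp: n_q_m_def)
    have sq12: "sqrt (real (\<nu> i) / 12) = q / sqrt 12" by (simp add: n_q_m_def real_sqrt_divide)
    have Aq: "A i = q ^ 3 / m" "u i = 1 / q"
      using nq by (simp_all add: A_def u_def n_q_m_def[symmetric] power3_eq_cube power2_eq_square)
    have xj: "x i j = (real j - (1 + q\<^sup>2 / 2 + y i * (q / sqrt 12))) / m" for j
    proof -
      have "real (\<nu> i) = q\<^sup>2" "real (M i) = m" using nq(1) by (simp_all add: n_q_m_def(1,3))
      then show ?thesis unfolding x_def sq12 by simp
    qed
    have bound: "\<bar>x i j\<bar> \<le> \<delta> i" if "j \<in> {1..\<nu> i}" for j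
    proof -
      have j: "1 \<le> real j" "real j \<le> q\<^sup>2" using that nq(1) by (auto simp: n_q_m_def)
      have "q \<le> q\<^sup>2" using nq(2) by (simp add: power2_eq_square)
      then have "q / sqrt 12 \<le> q\<^sup>2" using nq(2) by (intro order_trans[OF divide_left_mono[of 1 "sqrt 12" q]]) auto
      then have "\<bar>y i * (q / sqrt 12)\<bar> \<le> \<bar>y i\<bar> * q\<^sup>2"
        using nq(2) by (simp only: abs_mult) (intro mult_left_mono, auto)
      then have "\<bar>real j - (1 + q\<^sup>2 / 2 + y i * (q / sqrt 12))\<bar> \<le> q\<^sup>2 + \<bar>y i\<bar> * q\<^sup>2"
        using j by linarith
      then have "\<bar>x i j\<bar> \<le> (q\<^sup>2 + \<bar>y i\<bar> * q\<^sup>2) / m"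
        unfolding xj using nq(3) by (simp add: divide_right_mono)
      also have "\<dots> = \<delta> i" using nq(2,3) by (simp add: \<delta>_def Aq field_simps power3_eq_cube power2_eq_square)
      finally show ?thesis .
    qed
    obtain e where e: "(\<Prod>j=1..\<nu> i. 1 + x i j) = exp ((\<Sum>j=1..\<nu> i. x i j) - (\<Sum>j=1..\<nu> i. (x i j)\<^sup>2) / 2 + e)"
      "\<bar>e\<bar> \<le> 2 * real (card {1..\<nu> i}) * \<delta> i ^ 3"
      using prod_one_plus_approx[of "{1..\<nu> i}" "x i" "\<delta> i"] bound i(2) by auto
    define r where "r = 1 + q\<^sup>2 / 2 + y i * (q / sqrt 12)"
    have xr: "x i j = (real j - r) / m" for j by (simp add: xj r_def)
    have "(\<Sum>j=1..\<nu> i. x i j) = (\<Sum>j=1..\<nu> i. (real j - r) / m)" by (simp add: xr)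
    also have "\<dots> = ((\<Sum>j=1..\<nu> i. real j) - n * r) / m"
      by (simp add: sum_subtractf n_q_m_def(1) flip: sum_divide_distrib)
    also have "\<dots> = (q\<^sup>2 * (q\<^sup>2 + 1) / 2 - q\<^sup>2 * r) / m"
      unfolding sum_real_1_n by (simp add: nq(1)[symmetric] n_q_m_def(1))
    also have "\<dots> = S1 i"
      using nq(2,3) by (simp add: S1_def Aq r_def field_simps power3_eq_cube power2_eq_square)
    finally have s1: "(\<Sum>j=1..\<nu> i. x i j) = S1 i" .
    have "(\<Sum>j=1..\<nu> i. (x i j)\<^sup>2) = (\<Sum>j=1..\<nu> i. (real j)\<^sup>2 - 2 * r * real j + r\<^sup>2) / m\<^sup>2"
      unfolding sum_divide_distrib
      by (intro sum.cong refl) (simp add: xr power_divide power2_diff)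
    also have "\<dots> = ((\<Sum>j=1..\<nu> i. (real j)\<^sup>2) - 2 * r * (\<Sum>j=1..\<nu> i. real j) + n * r\<^sup>2) / m\<^sup>2"
      by (simp add: sum.distrib sum_subtractf sum_distrib_left n_q_m_def(1))
    also have "\<dots> = (q\<^sup>2 * (q\<^sup>2 + 1) * (2 * q\<^sup>2 + 1) / 6 - 2 * r * (q\<^sup>2 * (q\<^sup>2 + 1) / 2) + q\<^sup>2 * r\<^sup>2) / m\<^sup>2"
      unfolding sum_real_1_n sum_real_square_1_n by (simp add: nq(1)[symmetric] n_q_m_def(1))
    also have "\<dots> = S2 i"
    proof -
      define s where "s = y i / sqrt 12"
      have s: "s\<^sup>2 = (y i)\<^sup>2 / 12" by (simp add: s_def power_divide)
      have r: "r = 1 + q\<^sup>2 / 2 + s * q" by (simp add: r_def s_def)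
      have "S2 i = (q ^ 6 / 12 + q\<^sup>2 / 6 + s * q ^ 3 + s\<^sup>2 * q ^ 4) / m\<^sup>2"
        unfolding S2_def Aq s s_def[symmetric] using nq(2,3)
        by (simp add: field_simps eval_nat_numeral)
      moreover have "q\<^sup>2 * (q\<^sup>2 + 1) * (2 * q\<^sup>2 + 1) / 6 - 2 * r * (q\<^sup>2 * (q\<^sup>2 + 1) / 2) + q\<^sup>2 * r\<^sup>2 =
          q ^ 6 / 12 + q\<^sup>2 / 6 + s * q ^ 3 + s\<^sup>2 * q ^ 4"
        unfolding r by (simp add: field_simps eval_nat_numeral)
      ultimately show ?thesis by simp
    qed
    finally have s2: "(\<Sum>j=1..\<nu> i. (x i j)\<^sup>2) = S2 i" .
    have L: "likelihood (\<nu> i) (M i) (y i) = exp (S1 i - S2 i / 2 + e)"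
      using e(1) unfolding s1 s2 by (simp add: likelihood_def x_def)
    then have "E i = e" by (simp add: E_def)
    moreover have "2 * real (card {1..\<nu> i}) * \<delta> i ^ 3 = B i"
      using nq(2,3) by (simp add: B_def \<delta>_def Aq flip: n_q_m_def(1))
        (simp add: nq(1) field_simps eval_nat_numeral)
    ultimately show ?thesis using L e(2) by simp
  qed
  have ev: "\<forall>\<^sub>F i in sequentially. \<nu> i \<ge> 1 \<and> \<delta> i \<le> 1/2"
    using \<nu> order_tendstoD(2)[OF \<delta>0, of "1/2"]
    by (auto simp: filterlim_at_top elim: eventually_elim2)
  have "E \<longlonglongrightarrow> 0"
    by (rule Lim_null_comparison[OF _ B]) (use ev in eventually_elim, simp add: main)
  then have "(\<lambda>i. exp (S1 i - S2 i / 2 + E i)) \<longlonglongrightarrow> exp (- a * y0 / sqrt 12 - a\<^sup>2 / 12 / 2 + 0)"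
    by (intro tendsto_intros S1 S2) auto
  moreover have "\<forall>\<^sub>F i in sequentially. exp (S1 i - S2 i / 2 + E i) = likelihood (\<nu> i) (M i) (y i)"
    using ev by eventually_elim (simp add: main)
  ultimately show ?thesis by (simp add: tendsto_cong)
qed

section \<open>Total variation distance\<close>

lemma prob_diff_le_1: "measure_pmf.prob \<mu> A - measure_pmf.prob \<nu> A \<le> 1"
  using measure_pmf.prob_le_1[of \<mu> A] measure_nonneg[of \<nu> A] by linarith

lemma prob_diff_le_tv_dist: "measure_pmf.prob \<mu> A - measure_pmf.prob \<nu> A \<le> tv_dist \<mu> \<nu>"
  unfolding tv_dist_def
  by (rule cSUP_upper) (auto intro!: bdd_aboveI2[of _ _ 1] prob_diff_le_1)

lemma tv_dist_leI:
  assumes "\<And>A. measure_pmf.prob \<mu> A - measure_pmf.prob \<nu> A \<le> c"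
  shows "tv_dist \<mu> \<nu> \<le> c"
  unfolding tv_dist_def by (rule cSUP_least) (use assms in auto)

lemma tv_dist_nonneg: "0 \<le> tv_dist \<mu> \<nu>"
  using prob_diff_le_tv_dist[of \<mu> "{}" \<nu>] by simp

lemma tv_dist_le_1: "tv_dist \<mu> \<nu> \<le> 1"
  by (rule tv_dist_leI) (rule prob_diff_le_1)

text \<open>
  The supremum is attained at the set where \<open>\<mu>\<close> has more mass, which yields the
  sum of the positive parts of \<open>pmf \<mu> x - pmf \<nu> x\<close>. Both mass functions
  sum to \<open>1\<close>, so the sum of the negative parts has the same value; in that form the
  summands are bounded by the mass of \<open>\<nu>\<close>.
\<close>
lemma tv_dist_eq_sum:
  assumes S: "finite S" "set_pmf \<mu> \<subseteq> S" "set_pmf \<nu> \<subseteq> S"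
  shows "tv_dist \<mu> \<nu> = (\<Sum>x\<in>S. max 0 (pmf \<nu> x - pmf \<mu> x))"
proof -
  have one: "(\<Sum>x\<in>S. pmf \<mu> x) = 1" "(\<Sum>x\<in>S. pmf \<nu> x) = 1"
    using S by (simp_all add: sum_pmf_eq_1)
  have prob: "measure_pmf.prob \<mu> A - measure_pmf.prob \<nu> A = (\<Sum>x\<in>S \<inter> A. pmf \<mu> x - pmf \<nu> x)" for A
  proof -
    have "measure_pmf.prob p A = (\<Sum>x\<in>S \<inter> A. pmf p x)" if "set_pmf p \<subseteq> S" for p
    proof -
      have "measure_pmf.prob p A = measure_pmf.prob p (S \<inter> A)"
        using that by (intro measure_pmf.finite_measure_eq_AE) (auto simp: AE_measure_pmf_iff)
      then show ?thesis using S(1) by (simp add: measure_measure_pmf_finite)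
    qed
    then show ?thesis using S by (simp add: sum_subtractf)
  qed
  have "(\<Sum>x\<in>S. max 0 (pmf \<mu> x - pmf \<nu> x)) - (\<Sum>x\<in>S. max 0 (pmf \<nu> x - pmf \<mu> x)) =
      (\<Sum>x\<in>S. pmf \<mu> x - pmf \<nu> x)"
    unfolding sum_subtractf[symmetric] by (intro sum.cong refl) auto
  then have sym: "(\<Sum>x\<in>S. max 0 (pmf \<nu> x - pmf \<mu> x)) = (\<Sum>x\<in>S. max 0 (pmf \<mu> x - pmf \<nu> x))"
    using one by (simp add: sum_subtractf)
  have "tv_dist \<mu> \<nu> \<le> (\<Sum>x\<in>S. max 0 (pmf \<mu> x - pmf \<nu> x))"
  proof (rule tv_dist_leI)
    fix A
    have "(\<Sum>x\<in>S \<inter> A. pmf \<mu> x - pmf \<nu> x) \<le> (\<Sum>x\<in>S \<inter> A. max 0 (pmf \<mu> x - pmf \<nu> x))"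
      by (rule sum_mono) simp
    also have "\<dots> \<le> (\<Sum>x\<in>S. max 0 (pmf \<mu> x - pmf \<nu> x))"
      by (rule sum_mono2) (use S in auto)
    finally show "measure_pmf.prob \<mu> A - measure_pmf.prob \<nu> A \<le> \<dots>" using prob by simp
  qed
  moreover have "(\<Sum>x\<in>S. max 0 (pmf \<mu> x - pmf \<nu> x)) \<le> tv_dist \<mu> \<nu>"
  proof -
    let ?A = "{x. pmf \<nu> x < pmf \<mu> x}"
    have "(\<Sum>x\<in>S. max 0 (pmf \<mu> x - pmf \<nu> x)) = (\<Sum>x\<in>S \<inter> ?A. pmf \<mu> x - pmf \<nu> x)"
      by (rule sum.mono_neutral_cong_right) (use S in auto)
    then show ?thesis using prob_diff_le_tv_dist[of \<mu> ?A \<nu>] prob[of ?A] by simp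
  qed
  ultimately show ?thesis using sym by simp
qed

text \<open>
  Conditioning on the second factor.\<close> lemma prob_convolution: "measure_pmf.prob
  (convolution P Q) A = measure_pmf.expectation Q (\<lambda>\<tau>. measure_pmf.prob P
  ((\<lambda>\<sigma>. \<sigma> \<circ> \<tau>) -` A))" proof - have p: "measure_pmf.prob p B =
  pmf (map_pmf (\<lambda>x. x \<in> B) p) True" for p :: "'b pmf" and B by (auto simp: pmf_map
  vimage_def intro: arg_cong[where f = "measure _"]) have "map_pmf (\<lambda>x. x \<in> A)
  (convolution P Q) = bind_pmf Q (\<lambda>\<tau>. map_pmf (\<lambda>\<sigma>. \<sigma> \<in>
  (\<lambda>\<sigma>. \<sigma> \<circ> \<tau>) -` A) P)" unfolding convolution_def by (subst
  bind_commute_pmf) (simp add: map_bind_pmf map_pmf_def bind_assoc_pmf bind_return_pmf) then show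
  ?thesis unfolding p by (simp add: pmf_bind) qed

  text
  \<open> Given the second factor, the event for the product is an event for the first factor, where the two probabilities differ by at most the distance of \<open>P\<close>
  and \<open>Q\<close>.
\<close>
lemma tv_dist_convolution_le:
  fixes P Q R :: "('a \<Rightarrow> 'a) pmf"
  shows "tv_dist (convolution P R) (convolution Q R) \<le> tv_dist P Q"
proof (rule tv_dist_leI)
  fix A :: "('a \<Rightarrow> 'a) set"
  let ?B = "\<lambda>\<tau>. (\<lambda>\<sigma>. \<sigma> \<circ> \<tau>) -` A"
  have int: "integrable (measure_pmf R) (\<lambda>\<tau>. measure_pmf.prob p (?B \<tau>))" for p :: "('a \<Rightarrow> 'a) pmf"
    by (rule measure_pmf.integrable_const_bound[of _ 1]) auto
  have "measure_pmf.prob (convolution P R) A - measure_pmf.prob (convolution Q R) A =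
      measure_pmf.expectation R (\<lambda>\<tau>. measure_pmf.prob P (?B \<tau>) - measure_pmf.prob Q (?B \<tau>))"
    unfolding prob_convolution by (rule Bochner_Integration.integral_diff[symmetric]) (rule int)+
  also have "\<dots> \<le> measure_pmf.expectation R (\<lambda>\<tau>. tv_dist P Q)"
    by (intro integral_mono Bochner_Integration.integrable_diff int prob_diff_le_tv_dist) auto
  finally show "measure_pmf.prob (convolution P R) A - measure_pmf.prob (convolution Q R) A \<le> tv_dist P Q"
    by simp
qed

lemma convolution_uniform_perm:
  assumes "set_pmf Q \<subseteq> {\<sigma>. \<sigma> permutes {1..n}}"
  shows "convolution (uniform_perm n) Q = uniform_perm n"
proof -
  let ?P = "{\<sigma>. \<sigma> permutes {1..n}}"
  have ne: "?P \<noteq> {}" using permutes_id by blast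
  have "map_pmf (\<lambda>\<sigma>. \<sigma> \<circ> \<tau>) (uniform_perm n) = uniform_perm n" if \<tau>: "\<tau> permutes {1..n}" for \<tau>
  proof -
    have i: "inv \<tau> permutes {1..n}" using \<tau> by (rule permutes_inv)
    have "bij_betw (\<lambda>\<sigma>. \<sigma> \<circ> \<tau>) ?P ?P"
      by (rule bij_betw_byWitness[where f' = "\<lambda>\<sigma>. \<sigma> \<circ> inv \<tau>"])
         (use \<tau> i permutes_inv_o[OF \<tau>] in \<open>auto simp: comp_assoc intro: permutes_compose\<close>)
    then show ?thesis unfolding uniform_perm_def
      using ne by (intro map_pmf_of_set_bij_betw) (auto simp: finite_permutations)
  qed
  then have "convolution (uniform_perm n) Q = bind_pmf Q (\<lambda>\<tau>. uniform_perm n)"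
    unfolding convolution_def
    by (subst bind_commute_pmf, intro bind_pmf_cong refl) (use assms in \<open>auto simp: map_pmf_def\<close>)
  then show ?thesis by simp
qed

section \<open>The distance of a single shuffle from uniformity\<close>

abbreviation shuffle_distance :: "nat \<Rightarrow> nat \<Rightarrow> real" where
  "shuffle_distance n M \<equiv> tv_dist (shuffle n M) (uniform_perm n)"

text \<open>
  An \<open>M'\<close>-shuffle following the \<open>M\<close>-shuffle preserves the uniform
  distribution and does not increase distances.
\<close>
lemma shuffle_distance_mult_le:
  assumes "M \<ge> 1" "M' \<ge> 1"
  shows "shuffle_distance n (M * M') \<le> shuffle_distance n M"
  using tv_dist_convolution_le[of "shuffle n M" "shuffle n M'" "uniform_perm n"]
  by (simp add: convolution_shuffle[OF assms] convolution_uniform_perm[OF set_shuffle_subset[OF assms(2)]])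

text \<open>
  At values of \<open>z\<close> that no permutation attains, the likelihood may be negative.
  Truncation at \<open>1\<close> makes the function bounded everywhere and changes nothing at
  attained values.
\<close>
definition deficit :: "nat \<Rightarrow> nat \<Rightarrow> real \<Rightarrow> real" where
  "deficit n M z = max 0 (min 1 (1 - likelihood n M z))"

lemma deficit_measurable [measurable]: "deficit n M \<in> borel_measurable borel"
  unfolding deficit_def likelihood_def by measurable

text \<open>
  The mass of \<open>\<sigma>\<close> depends on the descents of \<open>inv \<sigma>\<close>.
  Inversion preserves the uniform distribution, so the law of the descents of
  \<open>\<sigma>\<close> itself can be used.
\<close>
lemma shuffle_distance_eq_integral:
  assumes "n \<ge> 1" "M \<ge> 1"
  shows "shuffle_distance n M = (\<integral>z. deficit n M z \<partial>descent_law n)"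
proof -
  let ?P = "{\<sigma>. \<sigma> permutes {1..n}}"
  define G where "G d = max 0 (1 - (\<Prod>i=1..n. 1 + (real i - real (1 + d)) / real M)) / fact n" for d
  define Z where "Z \<sigma> = (real (des n \<sigma>) - real n / 2) / sqrt (real n / 12)" for \<sigma>
  have fin: "finite ?P" by (simp add: finite_permutations)
  have pm: "pmf (shuffle n M) \<sigma> = (\<Prod>i=1..n. 1 + (real i - real (1 + des n (inv \<sigma>))) / real M) / fact n"
    if "\<sigma> permutes {1..n}" for \<sigma>
    using pmf_shuffle_eq_likelihood[OF assms that] by (simp add: rising_sequences_des)
  have "shuffle_distance n M = (\<Sum>\<sigma>\<in>?P. max 0 (pmf (uniform_perm n) \<sigma> - pmf (shuffle n M) \<sigma>))"
    using set_shuffle_subset[OF assms(2), of n] fin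
    by (intro tv_dist_eq_sum) (auto simp: set_uniform_perm)
  also have "\<dots> = (\<Sum>\<sigma>\<in>?P. G (des n (inv \<sigma>)))"
  proof (rule sum.cong[OF refl])
    fix \<sigma> assume "\<sigma> \<in> ?P"
    then have \<sigma>: "\<sigma> permutes {1..n}" by simp
    have "max 0 (1 / fact n - x / fact n) = max 0 (1 - x) / fact n" for x :: real
      by (auto simp: max_def field_simps)
    then show "max 0 (pmf (uniform_perm n) \<sigma> - pmf (shuffle n M) \<sigma>) = G (des n (inv \<sigma>))"
      unfolding pmf_uniform_perm if_P[OF \<sigma>] pm[OF \<sigma>] G_def .
  qed
  also have "\<dots> = (\<Sum>\<sigma>\<in>?P. G (des n \<sigma>))" by (rule sum_permutations_inverse[symmetric])
  also have "\<dots> = (\<Sum>\<sigma>\<in>?P. deficit n M (Z \<sigma>) / fact n)"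
  proof (rule sum.cong[OF refl])
    fix \<sigma> assume "\<sigma> \<in> ?P"
    then have \<sigma>: "inv \<sigma> permutes {1..n}" "\<sigma> permutes {1..n}" by (auto intro: permutes_inv)
    have L: "likelihood n M (Z \<sigma>) = (\<Prod>i=1..n. 1 + (real i - real (1 + des n \<sigma>)) / real M)"
      unfolding likelihood_def using assms(1) by (intro prod.cong refl) (simp add: Z_def)
    have "(\<Prod>i=1..n. 1 + (real i - real (1 + des n \<sigma>)) / real M) / fact n = pmf (shuffle n M) (inv \<sigma>)"
      using pm[OF \<sigma>(1)] by (simp add: inv_inv_eq[OF permutes_bij[OF \<sigma>(2)]])
    then have "(\<Prod>i=1..n. 1 + (real i - real (1 + des n \<sigma>)) / real M) / fact n \<ge> 0" by simp
    then have "(\<Prod>i=1..n. 1 + (real i - real (1 + des n \<sigma>)) / real M) \<ge> 0"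
      by (simp add: pos_le_divide_eq[OF fact_gt_zero])
    then show "G (des n \<sigma>) = deficit n M (Z \<sigma>) / fact n"
      unfolding G_def deficit_def L by simp
  qed
  also have "\<dots> = measure_pmf.expectation (uniform_perm n) (\<lambda>\<sigma>. deficit n M (Z \<sigma>))"
    by (subst integral_measure_pmf[OF fin]) (auto simp: set_uniform_perm pmf_uniform_perm)
  also have "\<dots> = (\<integral>z. deficit n M z \<partial>descent_law n)"
    unfolding descent_law_def by (subst integral_distr) (auto simp: Z_def)
  finally show ?thesis .
qed

text \<open>
  By Skorohod's theorem the normalised numbers of descents can be realised as almost surely
  convergent random variables, so the likelihoods converge almost surely by
  \<open>likelihood_tendsto\<close>, and dominated convergence applies.
\<close>
theorem shuffle_distance_tendsto:
  fixes \<nu> M :: "nat \<Rightarrow> nat"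
  assumes \<nu>: "filterlim \<nu> at_top sequentially" and M: "\<And>i. M i \<ge> 1"
    and a: "(\<lambda>i. real (\<nu> i) * sqrt (real (\<nu> i)) / real (M i)) \<longlonglongrightarrow> a"
  shows "(\<lambda>i. shuffle_distance (\<nu> i) (M i)) \<longlonglongrightarrow> Psi (ereal a)"
proof -
  have a0: "a \<ge> 0" using a by (rule LIMSEQ_le_const) auto
  have wc: "weak_conv_m (\<lambda>i. descent_law (\<nu> i)) std_normal_distribution"
    using weak_conv_descent_law \<nu> unfolding weak_conv_m_def weak_conv_def
    by (auto intro: filterlim_compose)
  obtain \<Omega> Y Y0 where
    \<Omega>: "prob_space (\<Omega> :: real measure)" and
    Ym [measurable]: "\<And>i. Y i \<in> borel_measurable \<Omega>" and
    Yd: "\<And>i. distr \<Omega> borel (Y i) = descent_law (\<nu> i)" and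
    Y0m [measurable]: "Y0 \<in> borel_measurable \<Omega>" and
    Y0d: "distr \<Omega> borel Y0 = std_normal_distribution" and
    YY: "\<And>x. x \<in> space \<Omega> \<Longrightarrow> (\<lambda>i. Y i x) \<longlonglongrightarrow> Y0 x"
    using Skorohod[OF real_distribution_descent_law real_dist_normal_dist wc] by force
  interpret \<Omega>: prob_space \<Omega> by fact
  define g where "g z = max 0 (min 1 (1 - exp (- a * z / sqrt 12 - a\<^sup>2 / 24)))" for z :: real
  have [measurable]: "g \<in> borel_measurable borel" unfolding g_def by measurable
  have "(\<lambda>i. \<integral>x. deficit (\<nu> i) (M i) (Y i x) \<partial>\<Omega>) \<longlonglongrightarrow> (\<integral>x. g (Y0 x) \<partial>\<Omega>)"
  proof (rule integral_dominated_convergence[where w = "\<lambda>_. 1"])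
    show "AE x in \<Omega>. (\<lambda>i. deficit (\<nu> i) (M i) (Y i x)) \<longlonglongrightarrow> g (Y0 x)"
      unfolding deficit_def g_def
      by (intro AE_I2 tendsto_max tendsto_min tendsto_diff tendsto_const likelihood_tendsto[OF \<nu> M a YY])
    show "AE x in \<Omega>. norm (deficit (\<nu> i) (M i) (Y i x)) \<le> 1" for i
      by (simp add: deficit_def)
  qed auto
  moreover have "(\<integral>x. g (Y0 x) \<partial>\<Omega>) = Psi (ereal a)"
  proof -
    define b where "b = a / (4 * sqrt 3)"
    have s12: "sqrt 12 = 2 * sqrt 3" using real_sqrt_mult[of 4 3] by simp
    have b: "b \<ge> 0" "a / sqrt 12 = 2 * b" "a\<^sup>2 / 24 = 2 * b\<^sup>2"
      using a0 by (simp_all add: b_def s12 power_divide power_mult_distrib)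
    have "g z = max 0 (1 - exp (- 2 * b * z - 2 * b\<^sup>2))" for z
    proof -
      have "- a * z / sqrt 12 - a\<^sup>2 / 24 = - 2 * b * z - 2 * b\<^sup>2"
        using b(2,3) by (metis (no_types, opaque_lifting) mult.commute mult_minus_right times_divide_eq_right mult_minus_left)
      then show ?thesis unfolding g_def by simp
    qed
    moreover have "(\<integral>x. g (Y0 x) \<partial>\<Omega>) = (\<integral>z. g z \<partial>std_normal_distribution)"
      unfolding Y0d[symmetric] by (subst integral_distr) auto
    ultimately show ?thesis
      using integral_likelihood_deficit[OF b(1)] a0 by (simp add: Psi_ereal b_def)
  qed
  moreover have "\<forall>\<^sub>F i in sequentially. (\<integral>x. deficit (\<nu> i) (M i) (Y i x) \<partial>\<Omega>) = shuffle_distance (\<nu> i) (M i)"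
    using filterlim_at_top[THEN iffD1, OF \<nu>, rule_format, of 1]
  proof eventually_elim
    case (elim i)
    have "(\<integral>x. deficit (\<nu> i) (M i) (Y i x) \<partial>\<Omega>) = (\<integral>z. deficit (\<nu> i) (M i) z \<partial>descent_law (\<nu> i))"
      unfolding Yd[symmetric] by (subst integral_distr) auto
    then show ?case using shuffle_distance_eq_integral[OF elim M] by simp
  qed
  ultimately show ?thesis by (simp add: tendsto_cong)
qed

text \<open>
  Given \<open>e < 1\<close>, choose \<open>c\<close> with \<open>e < Psi c\<close>. A
  further \<open>N i\<close>-shuffle, with \<open>N i\<close> chosen such that the ratio
  \<open>n powr (3/2) / (M * N)\<close> tends to \<open>c\<close>, only decreases the
  distance, and the distance after it tends to \<open>Psi c\<close>.
\<close>
lemma shuffle_distance_tendsto_1: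
  fixes \<nu> M :: "nat \<Rightarrow> nat"
  assumes \<nu>: "filterlim \<nu> at_top sequentially" and M: "\<And>i. M i \<ge> 1"
    and a: "filterlim (\<lambda>i. real (\<nu> i) * sqrt (real (\<nu> i)) / real (M i)) at_top sequentially"
  shows "(\<lambda>i. shuffle_distance (\<nu> i) (M i)) \<longlonglongrightarrow> 1"
proof (rule order_tendstoI)
  fix e :: real assume "e > 1"
  then show "\<forall>\<^sub>F i in sequentially. shuffle_distance (\<nu> i) (M i) < e"
    by (intro always_eventually allI le_less_trans[OF tv_dist_le_1])
next
  fix e :: real assume e: "e < 1"
  have "\<forall>\<^sub>F b in at_top. e < normal_mass b \<and> b > 0"
    using order_tendstoD(1)[OF normal_mass_at_top e] eventually_gt_at_top by (rule eventually_conj)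
  then obtain b where b: "e < normal_mass b" "b > 0" by (auto simp: eventually_at_top_linorder)
  \<comment> \<open>The factor undoes the scaling of the argument in \<open>Psi\<close>.\<close>
  define c where "c = 4 * sqrt 3 * b"
  have c: "c > 0" "e < Psi (ereal c)" using b by (simp_all add: c_def Psi_ereal)
  define y where "y i = real (\<nu> i) * sqrt (real (\<nu> i)) / real (M i) / c" for i
  have y: "filterlim y at_top sequentially"
    unfolding y_def[abs_def] using a c(1)
    by (auto simp: divide_inverse intro!: filterlim_at_top_mult_tendsto_pos[OF tendsto_const])
  define N where "N i = max 1 (nat \<lceil>y i\<rceil>)" for i
  have "((\<lambda>x. x / real (nat \<lceil>x\<rceil>)) \<longlongrightarrow> 1) at_top" by real_asymp
  from filterlim_compose[OF this y] have "(\<lambda>i. c * (y i / real (nat \<lceil>y i\<rceil>))) \<longlonglongrightarrow> c * 1"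
    by (intro tendsto_mult tendsto_const)
  moreover have "\<forall>\<^sub>F i in sequentially. c * (y i / real (nat \<lceil>y i\<rceil>)) =
      real (\<nu> i) * sqrt (real (\<nu> i)) / real (M i * N i)"
    using filterlim_at_top_dense[THEN iffD1, OF y, rule_format, of 0]
  proof eventually_elim
    case (elim i)
    then have "N i = nat \<lceil>y i\<rceil>" by (simp add: N_def Suc_le_eq max_def)
    then show ?case using c(1) by (simp add: y_def field_simps)
  qed
  ultimately have "(\<lambda>i. real (\<nu> i) * sqrt (real (\<nu> i)) / real (M i * N i)) \<longlonglongrightarrow> c"
    by (simp add: tendsto_cong)
  then have "(\<lambda>i. shuffle_distance (\<nu> i) (M i * N i)) \<longlonglongrightarrow> Psi (ereal c)"
    using M by (intro shuffle_distance_tendsto[OF \<nu>]) (auto simp: N_def Suc_le_eq)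
  from order_tendstoD(1)[OF this c(2)]
  show "\<forall>\<^sub>F i in sequentially. e < shuffle_distance (\<nu> i) (M i)"
  proof eventually_elim
    case (elim i)
    then show ?case using shuffle_distance_mult_le[OF M[of i], of "N i" "\<nu> i"] by (simp add: N_def)
  qed
qed

section \<open>The limit profile on a logarithmic scale\<close>

lemma exp_ereal_simps [simp]:
  "exp_ereal (ereal r) = ereal (exp r)" "exp_ereal \<infinity> = \<infinity>" "exp_ereal (- \<infinity>) = 0"
  by (simp_all add: exp_ereal_def)

lemma Psi_0: "Psi 0 = 0"
  using Psi_ereal[of 0]
  by (simp only: zero_ereal_def[symmetric]) (simp add: normal_mass_def)

lemma Psi_exp_mono:
  assumes "L \<le> L'"
  shows "Psi (exp_ereal L) \<le> Psi (exp_ereal L')"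
proof -
  have nn: "0 \<le> normal_mass b" "normal_mass b \<le> 1" for b
    using normal_mass_less_1[of b] by (simp_all add: normal_mass_def)
  show ?thesis using assms
    by (cases L; cases L') (auto simp: Psi_0 nn Psi_ereal Psi_infinity intro!: normal_mass_mono divide_right_mono)
qed

lemma Psi_exp_pos: "0 < Psi (ereal (exp x))"
  by (simp add: Psi_ereal normal_mass_pos)

lemma Psi_exp_less_1: "Psi (ereal (exp x)) < 1"
  by (simp add: Psi_ereal normal_mass_less_1)

lemma Psi_exp_at_bot: "((\<lambda>x. Psi (ereal (exp x))) \<longlongrightarrow> 0) at_bot"
proof -
  have "filterlim (\<lambda>x::real. exp x / (4 * sqrt 3)) (at_right 0) at_bot" by real_asymp
  from filterlim_compose[OF normal_mass_at_right_0 this] show ?thesis by (simp add: Psi_ereal)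
qed

lemma Psi_exp_at_top: "((\<lambda>x. Psi (ereal (exp x))) \<longlongrightarrow> 1) at_top"
proof -
  have "filterlim (\<lambda>x::real. exp x / (4 * sqrt 3)) at_top at_top" by real_asymp
  from filterlim_compose[OF normal_mass_at_top this] show ?thesis by (simp add: Psi_ereal)
qed

lemma filterlim_min_at_top:
  fixes f g :: "'a \<Rightarrow> real"
  assumes "filterlim f at_top F" "filterlim g at_top F"
  shows "filterlim (\<lambda>x. min (f x) (g x)) at_top F"
  unfolding filterlim_at_top
proof
  fix Z
  show "\<forall>\<^sub>F x in F. Z \<le> min (f x) (g x)"
    using filterlim_at_top[THEN iffD1, OF assms(1), rule_format, of Z]
      filterlim_at_top[THEN iffD1, OF assms(2), rule_format, of Z]
    by eventually_elim simp
qed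

section \<open>Distances between a real number and the integers\<close>

lemma nearest_ge_half: "nearest x \<ge> 1/2"
proof (cases "x < 1/2")
  case False
  then have "round x \<ge> 1" by (simp add: round_def le_floor_iff)
  then have "real_of_int (round x) \<ge> 1" by simp
  then show ?thesis using False by (simp add: nearest_def)
qed (simp add: nearest_def)

lemma nearest_eq_nat:
  assumes "x \<ge> 1/2"
  shows "real (nat \<lfloor>nearest x\<rfloor>) = nearest x"
proof -
  have "round x \<ge> 1" using assms by (simp add: round_def le_floor_iff)
  then show ?thesis using assms by (simp add: nearest_def)
qed

lemma abs_nearest_diff_le: "x \<ge> 1/2 \<Longrightarrow> \<bar>x - nearest x\<bar> \<le> 1/2"
  using of_int_round_abs_le[of x] by (simp add: nearest_def abs_minus_commute)

lemma gap_below_nearest: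
  assumes "real k < nearest x"
  shows "x < 1/2 \<and> k = 0 \<or> x - real k \<ge> 1/2"
proof (cases "x < 1/2")
  case True
  then have "real k < 1/2" using assms by (simp add: nearest_def)
  then have "k = 0" by (cases k) auto
  then show ?thesis using True by simp
next
  case False
  then have "real_of_int (int k) < real_of_int (round x)" using assms by (simp add: nearest_def)
  then have "int k + 1 \<le> round x" by linarith
  then have "real k + 1 \<le> real_of_int (round x)" by linarith
  then have "x - real k \<ge> 1/2" using of_int_round_abs_le[of x] by linarith
  then show ?thesis ..
qed

lemma gap_above_nearest:
  assumes "real k > nearest x"
  shows "real k - x \<ge> 1/2"
proof (cases "x < 1/2")
  case True
  then have "k > 0" using assms by (cases k) (auto simp: nearest_def)
  then have "real k \<ge> 1" by simp
  then show ?thesis using True by simp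
next
  case False
  then have "real_of_int (int k) > real_of_int (round x)" using assms by (simp add: nearest_def)
  then have "int k \<ge> round x + 1" by linarith
  then have "real k \<ge> real_of_int (round x) + 1" by linarith
  then show ?thesis using of_int_round_abs_le[of x] by linarith
qed

lemma abs_dev_le: "x \<ge> 1/2 \<Longrightarrow> \<bar>dev x\<bar> \<le> \<bar>x - real k\<bar>"
  using round_diff_minimal[of x "int k"] by (simp add: dev_def nearest_def)

section \<open>Families of shuffles\<close>

locale shuffle_family =
  fixes m :: "nat \<Rightarrow> nat" and \<mu> t :: "nat \<Rightarrow> real"
    and Q :: "nat \<Rightarrow> (nat \<Rightarrow> nat) pmf" and TV :: "nat \<Rightarrow> nat \<Rightarrow> real"
  assumes m_gt_1: "\<And>n. n \<ge> 1 \<Longrightarrow> m n > 1"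
    and \<mu>_eq: "\<And>n. \<mu> n = ln (real (m n))"
    and t_eq: "\<And>n. n \<ge> 2 \<Longrightarrow> t n = 3 * ln (real n) / (2 * \<mu> n)"
    and Q_eq: "\<And>n. Q n = shuffle n (m n)"
    and TV_eq: "\<And>n k. TV n k = tv_dist (convolution_power (Q n) k) (uniform_perm n)"
begin

lemma TV_eq_shuffle_distance: "n \<ge> 1 \<Longrightarrow> TV n k = shuffle_distance n (m n ^ k)"
  using m_gt_1[of n] by (simp add: TV_eq Q_eq convolution_power_shuffle)

lemma TV_nonneg: "0 \<le> TV n k" and TV_le_1: "TV n k \<le> 1"
  by (simp_all add: TV_eq tv_dist_nonneg tv_dist_le_1)

lemma \<mu>_ge: "n \<ge> 1 \<Longrightarrow> ln 2 \<le> \<mu> n"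
  using m_gt_1[of n] by (simp add: \<mu>_eq)

lemma \<mu>_pos: "n \<ge> 1 \<Longrightarrow> 0 < \<mu> n"
  using \<mu>_ge[of n] ln_gt_zero[of "2::real"] by linarith

lemma \<mu>_t: "n \<ge> 2 \<Longrightarrow> \<mu> n * t n = 3 / 2 * ln (real n)"
  using \<mu>_pos[of n] by (simp add: t_eq)

lemma t_pos: "n \<ge> 2 \<Longrightarrow> 0 < t n"
  using \<mu>_pos[of n] by (simp add: t_eq)

text \<open>
  The signed distance of \<open>k\<close> from the critical number of shuffles in the scale of
  \<open>\<mu> n\<close>. It is the logarithm of \<open>n powr (3/2) / m n ^ k\<close>.
\<close>
definition gap :: "nat \<Rightarrow> nat \<Rightarrow> real" where
  "gap n k = \<mu> n * (t n - real k)"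

lemma exp_gap:
  assumes "n \<ge> 2"
  shows "real n * sqrt (real n) / real (m n ^ k) = exp (gap n k)"
proof -
  have n: "real n > 0" using assms by simp
  have m: "real (m n) > 0" using m_gt_1[of n] assms by simp
  have "exp (\<mu> n * t n) = exp (ln (real n)) * exp (ln (real n) / 2)"
    using \<mu>_t[OF assms] by (simp flip: exp_add)
  also have "ln (real n) / 2 = ln (sqrt (real n))" using n by (simp add: ln_sqrt)
  also have "exp (ln (real n)) * exp (ln (sqrt (real n))) = real n * sqrt (real n)" using n by simp
  finally have "exp (\<mu> n * t n) = real n * sqrt (real n)" .
  moreover have "exp (\<mu> n * real k) = real (m n ^ k)"
    using m by (simp add: \<mu>_eq mult.commute[of "ln _"] exp_of_nat_mult)
  ultimately show ?thesis by (simp add: gap_def right_diff_distrib exp_diff)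
qed

text \<open>
  The three kinds of limits of the gap correspond to the ratio
  \<open>n powr (3/2) / m n ^ k\<close> having a positive limit, tending to infinity, and
  tending to \<open>0\<close>. The sequence \<open>\<nu>\<close> permits passing to subsequences.
\<close>
lemma TV_tendsto:
  fixes \<nu> k :: "nat \<Rightarrow> nat"
  assumes \<nu>: "filterlim \<nu> at_top sequentially"
    and L: "(\<lambda>i. ereal (gap (\<nu> i) (k i))) \<longlonglongrightarrow> L"
  shows "(\<lambda>i. TV (\<nu> i) (k i)) \<longlonglongrightarrow> Psi (exp_ereal L)"
proof -
  \<comment> \<open>The maximum only matters if \<open>\<nu> i = 0\<close>, where \<open>m\<close> is arbitrary.\<close>
  define M where "M i = max 1 (m (\<nu> i) ^ k i)" for i
  have M1: "M i \<ge> 1" for i by (simp add: M_def)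
  have ev2: "\<forall>\<^sub>F i in sequentially. \<nu> i \<ge> 2" using \<nu> by (simp add: filterlim_at_top)
  have ME: "M i = m (\<nu> i) ^ k i" if "\<nu> i \<ge> 2" for i
    using m_gt_1[of "\<nu> i"] that by (simp add: M_def max_def)
  have E: "\<forall>\<^sub>F i in sequentially. exp (gap (\<nu> i) (k i)) = real (\<nu> i) * sqrt (real (\<nu> i)) / real (M i)"
    using ev2 by eventually_elim (simp only: ME exp_gap)
  have "(\<lambda>i. shuffle_distance (\<nu> i) (M i)) \<longlonglongrightarrow> Psi (exp_ereal L)"
  proof (cases L)
    case (real l)
    then have "(\<lambda>i. exp (gap (\<nu> i) (k i))) \<longlonglongrightarrow> exp l" using L by (intro tendsto_exp) simp
    then have "(\<lambda>i. real (\<nu> i) * sqrt (real (\<nu> i)) / real (M i)) \<longlonglongrightarrow> exp l"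
      using E by (simp add: tendsto_cong)
    then show ?thesis using shuffle_distance_tendsto[OF \<nu> M1] real by simp
  next
    case PInf
    then have "filterlim (\<lambda>i. gap (\<nu> i) (k i)) at_top sequentially"
      using L by (simp add: tendsto_PInfty_eq_at_top)
    then have "filterlim (\<lambda>i. exp (gap (\<nu> i) (k i))) at_top sequentially"
      by (rule filterlim_compose[OF exp_at_top])
    then have "filterlim (\<lambda>i. real (\<nu> i) * sqrt (real (\<nu> i)) / real (M i)) at_top sequentially"
      using E by (simp add: filterlim_cong)
    then show ?thesis using shuffle_distance_tendsto_1[OF \<nu> M1] PInf by (simp add: Psi_infinity)
  next
    case MInf
    then have "filterlim (\<lambda>i. gap (\<nu> i) (k i)) at_bot sequentially"
      using L by (simp add: tendsto_MInfty filterlim_at_bot_dense)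
    then have "(\<lambda>i. exp (gap (\<nu> i) (k i))) \<longlonglongrightarrow> 0"
      by (rule filterlim_compose[OF exp_at_bot])
    then have "(\<lambda>i. real (\<nu> i) * sqrt (real (\<nu> i)) / real (M i)) \<longlonglongrightarrow> 0"
      using E by (simp add: tendsto_cong)
    then show ?thesis using shuffle_distance_tendsto[OF \<nu> M1, where a = 0] MInf by (simp add: zero_ereal_def)
  qed
  moreover have "\<forall>\<^sub>F i in sequentially. shuffle_distance (\<nu> i) (M i) = TV (\<nu> i) (k i)"
    using ev2 by eventually_elim (simp add: ME TV_eq_shuffle_distance)
  ultimately show ?thesis by (simp add: tendsto_cong)
qed

lemma TV_tendsto_1:
  assumes "filterlim \<nu> at_top sequentially" "filterlim (\<lambda>i. gap (\<nu> i) (k i)) at_top sequentially"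
  shows "(\<lambda>i. TV (\<nu> i) (k i)) \<longlonglongrightarrow> 1"
  using TV_tendsto[of \<nu> k \<infinity>] assms by (simp add: tendsto_PInfty_eq_at_top Psi_infinity)

lemma TV_tendsto_0:
  assumes "filterlim \<nu> at_top sequentially" "filterlim (\<lambda>i. - gap (\<nu> i) (k i)) at_top sequentially"
  shows "(\<lambda>i. TV (\<nu> i) (k i)) \<longlonglongrightarrow> 0"
proof -
  have "filterlim (\<lambda>i. gap (\<nu> i) (k i)) at_bot sequentially"
    using assms(2) by (simp add: filterlim_uminus_at_bot)
  then show ?thesis
    using TV_tendsto[of \<nu> k "- \<infinity>"] assms(1)
    by (simp add: tendsto_MInfty filterlim_at_bot_dense Psi_0)
qed

lemma bdd_TV: "bdd_above (TV n ` S)" "bdd_below (TV n ` S)"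
  using TV_nonneg TV_le_1 by (auto intro!: bdd_aboveI2 bdd_belowI2)

text \<open>
  It is enough to choose for every \<open>n\<close> one \<open>k \<in> S n\<close> whose
  distance exceeds the infimum by less than \<open>1 / (n + 1)\<close>; its gap tends to
  infinity as well.
\<close>
lemma INF_TV_tendsto_1:
  assumes h: "filterlim h at_top sequentially"
    and S: "\<forall>\<^sub>F n in sequentially. S n \<noteq> {} \<and> (\<forall>k\<in>S n. gap n k \<ge> h n)"
  shows "(\<lambda>n. INF k\<in>S n. TV n k) \<longlonglongrightarrow> 1"
proof -
  define k where "k n = (SOME k. k \<in> S n \<and> TV n k < (INF k\<in>S n. TV n k) + 1 / real (Suc n))" for n
  have k: "k n \<in> S n \<and> TV n (k n) < (INF k\<in>S n. TV n k) + 1 / real (Suc n)" if "S n \<noteq> {}" for n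
  proof -
    have "(INF k\<in>S n. TV n k) < (INF k\<in>S n. TV n k) + 1 / real (Suc n)" by simp
    then have "\<exists>k\<in>S n. TV n k < (INF k\<in>S n. TV n k) + 1 / real (Suc n)"
      using that by (subst (asm) cINF_less_iff) (auto simp: bdd_TV)
    then show ?thesis unfolding k_def by (metis (mono_tags, lifting) someI_ex)
  qed
  have "filterlim (\<lambda>n. gap n (k n)) at_top sequentially"
    by (rule filterlim_at_top_mono[OF h]) (use S in eventually_elim, use k in blast)
  then have "(\<lambda>n. TV n (k n)) \<longlonglongrightarrow> 1"
    by (intro TV_tendsto_1[of "\<lambda>n. n"]) (auto simp: filterlim_ident)
  then have "(\<lambda>n. TV n (k n) - 1 / real (Suc n)) \<longlonglongrightarrow> 1 - 0"
    by (intro tendsto_diff LIMSEQ_Suc lim_1_over_n)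
  then have lim: "(\<lambda>n. TV n (k n) - 1 / real (Suc n)) \<longlonglongrightarrow> 1" by simp
  have "\<forall>\<^sub>F n in sequentially. TV n (k n) - 1 / real (Suc n) \<le> (INF k\<in>S n. TV n k)"
    using S
  proof eventually_elim
    case (elim n)
    then show ?case using k[of n] by linarith
  qed
  moreover have "\<forall>\<^sub>F n in sequentially. (INF k\<in>S n. TV n k) \<le> 1"
    using S by eventually_elim (meson TV_le_1 bdd_TV(2) cINF_lower2 all_not_in_conv)
  ultimately show ?thesis by (rule tendsto_sandwich[OF _ _ lim tendsto_const])
qed

lemma SUP_TV_tendsto_0:
  assumes h: "filterlim h at_top sequentially"
    and S: "\<forall>\<^sub>F n in sequentially. S n \<noteq> {} \<and> (\<forall>k\<in>S n. - gap n k \<ge> h n)"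
  shows "(\<lambda>n. SUP k\<in>S n. TV n k) \<longlonglongrightarrow> 0"
proof -
  define k where "k n = (SOME k. k \<in> S n \<and> TV n k > (SUP k\<in>S n. TV n k) - 1 / real (Suc n))" for n
  have k: "k n \<in> S n \<and> TV n (k n) > (SUP k\<in>S n. TV n k) - 1 / real (Suc n)" if "S n \<noteq> {}" for n
  proof -
    have "(SUP k\<in>S n. TV n k) - 1 / real (Suc n) < (SUP k\<in>S n. TV n k)" by simp
    then have "\<exists>k\<in>S n. TV n k > (SUP k\<in>S n. TV n k) - 1 / real (Suc n)"
      using that by (subst (asm) less_cSUP_iff) (auto simp: bdd_TV)
    then show ?thesis unfolding k_def by (metis (mono_tags, lifting) someI_ex)
  qed
  have "filterlim (\<lambda>n. - gap n (k n)) at_top sequentially"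
    by (rule filterlim_at_top_mono[OF h]) (use S in eventually_elim, use k in blast)
  then have "(\<lambda>n. TV n (k n)) \<longlonglongrightarrow> 0"
    by (intro TV_tendsto_0[of "\<lambda>n. n"]) (auto simp: filterlim_ident)
  then have "(\<lambda>n. TV n (k n) + 1 / real (Suc n)) \<longlonglongrightarrow> 0 + 0"
    by (intro tendsto_add LIMSEQ_Suc lim_1_over_n)
  then have lim: "(\<lambda>n. TV n (k n) + 1 / real (Suc n)) \<longlonglongrightarrow> 0" by simp
  have "\<forall>\<^sub>F n in sequentially. (SUP k\<in>S n. TV n k) \<le> TV n (k n) + 1 / real (Suc n)"
    using S
  proof eventually_elim
    case (elim n)
    then show ?case using k[of n] by linarith
  qed
  moreover have "\<forall>\<^sub>F n in sequentially. 0 \<le> (SUP k\<in>S n. TV n k)"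
    using S by eventually_elim (meson TV_nonneg bdd_TV(1) cSUP_upper2 all_not_in_conv)
  ultimately show ?thesis by (intro tendsto_sandwich[OF _ _ tendsto_const lim])
qed

text \<open>
  The extended real line is sequentially compact, so every limit point of the distances is the
  value of the limit profile at a limit point of the gaps.
\<close>
lemma gap_limit_point:
  assumes \<nu>: "filterlim \<nu> at_top sequentially" and r: "strict_mono r"
    and l: "(\<lambda>i. ereal (TV (\<nu> (r i)) (k (r i)))) \<longlonglongrightarrow> l"
  shows "\<exists>L s. strict_mono s \<and> (\<lambda>i. ereal (gap (\<nu> (r (s i))) (k (r (s i))))) \<longlonglongrightarrow> L \<and>
    l = ereal (Psi (exp_ereal L))"
proof -
  obtain s where s: "strict_mono s"
    "((\<lambda>i. ereal (gap (\<nu> (r i)) (k (r i)))) \<circ> s) \<longlonglongrightarrow> limsup (\<lambda>i. ereal (gap (\<nu> (r i)) (k (r i))))"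
    using limsup_subseq_lim by blast
  define L where "L = limsup (\<lambda>i. ereal (gap (\<nu> (r i)) (k (r i))))"
  have L: "(\<lambda>i. ereal (gap (\<nu> (r (s i))) (k (r (s i))))) \<longlonglongrightarrow> L"
    using s(2) by (simp add: L_def comp_def)
  have "filterlim (\<lambda>i. \<nu> (r (s i))) at_top sequentially"
    by (rule filterlim_compose[OF \<nu> filterlim_compose[OF filterlim_subseq[OF r] filterlim_subseq[OF s(1)]]])
  from TV_tendsto[OF this L]
  have "(\<lambda>i. ereal (TV (\<nu> (r (s i))) (k (r (s i))))) \<longlonglongrightarrow> ereal (Psi (exp_ereal L))" by simp
  moreover have "(\<lambda>i. ereal (TV (\<nu> (r (s i))) (k (r (s i))))) \<longlonglongrightarrow> l"
    using LIMSEQ_subseq_LIMSEQ[OF l s(1)] by (simp add: comp_def)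
  ultimately have "l = ereal (Psi (exp_ereal L))" by (rule LIMSEQ_unique[rotated])
  then show ?thesis using s(1) L by blast
qed

lemma limsup_TV_le:
  assumes \<nu>: "filterlim \<nu> at_top sequentially" and g: "\<forall>\<^sub>F i in sequentially. gap (\<nu> i) (k i) \<le> C"
  shows "limsup (\<lambda>i. ereal (TV (\<nu> i) (k i))) \<le> ereal (Psi (ereal (exp C)))"
proof -
  obtain r where r: "strict_mono r"
    "((\<lambda>i. ereal (TV (\<nu> i) (k i))) \<circ> r) \<longlonglongrightarrow> limsup (\<lambda>i. ereal (TV (\<nu> i) (k i)))"
    using limsup_subseq_lim by blast
  obtain L s where s: "strict_mono s" and L: "(\<lambda>i. ereal (gap (\<nu> (r (s i))) (k (r (s i))))) \<longlonglongrightarrow> L"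
    and e: "limsup (\<lambda>i. ereal (TV (\<nu> i) (k i))) = ereal (Psi (exp_ereal L))"
    using gap_limit_point[OF \<nu> r(1)] r(2) unfolding comp_def by blast
  have "\<forall>\<^sub>F i in sequentially. gap (\<nu> (r (s i))) (k (r (s i))) \<le> C"
    using eventually_subseq[OF s eventually_subseq[OF r(1) g]] .
  then have "L \<le> ereal C" using L by (intro tendsto_upperbound[OF L]) (auto elim: eventually_mono)
  then show ?thesis using Psi_exp_mono[of L "ereal C"] unfolding e by simp
qed

lemma liminf_TV_ge:
  assumes \<nu>: "filterlim \<nu> at_top sequentially" and g: "\<forall>\<^sub>F i in sequentially. C \<le> gap (\<nu> i) (k i)"
  shows "ereal (Psi (ereal (exp C))) \<le> liminf (\<lambda>i. ereal (TV (\<nu> i) (k i)))"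
proof -
  obtain r where r: "strict_mono r"
    "((\<lambda>i. ereal (TV (\<nu> i) (k i))) \<circ> r) \<longlonglongrightarrow> liminf (\<lambda>i. ereal (TV (\<nu> i) (k i)))"
    using liminf_subseq_lim by blast
  obtain L s where s: "strict_mono s" and L: "(\<lambda>i. ereal (gap (\<nu> (r (s i))) (k (r (s i))))) \<longlonglongrightarrow> L"
    and e: "liminf (\<lambda>i. ereal (TV (\<nu> i) (k i))) = ereal (Psi (exp_ereal L))"
    using gap_limit_point[OF \<nu> r(1)] r(2) unfolding comp_def by blast
  have "\<forall>\<^sub>F i in sequentially. C \<le> gap (\<nu> (r (s i))) (k (r (s i)))"
    using eventually_subseq[OF s eventually_subseq[OF r(1) g]] .
  then have "ereal C \<le> L" using L by (intro tendsto_lowerbound[OF L]) (auto elim: eventually_mono)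
  then show ?thesis using Psi_exp_mono[of "ereal C" L] unfolding e by simp
qed

text \<open>
  Bounded gaps have finite limit points, where the profile lies strictly between \<open>0\<close>
  and \<open>1\<close>.\<close> lemma TV_nondegenerate: assumes \<nu>: "filterlim \<nu> at_top
  sequentially" and g: "\<forall>\<^sub>F i in sequentially. \<bar>gap (\<nu> i) (k i)\<bar> \<le>
  C" shows "0 < liminf (\<lambda>i. ereal (TV (\<nu> i) (k i)))" and "liminf (\<lambda>i. ereal
  (TV (\<nu> i) (k i))) \<le> limsup (\<lambda>i. ereal (TV (\<nu> i) (k i)))" and "limsup
  (\<lambda>i. ereal (TV (\<nu> i) (k i))) < 1" proof - have g1: "\<forall>\<^sub>F i in
  sequentially. gap (\<nu> i) (k i) \<le> C" and g2: "\<forall>\<^sub>F i in sequentially. - C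
  \<le> gap (\<nu> i) (k i)" using g by (auto elim!: eventually_mono) have "0 < ereal (Psi (ereal
  (exp (- C))))" using Psi_exp_pos by simp then show "0 < liminf (\<lambda>i. ereal (TV (\<nu> i)
  (k i)))" using liminf_TV_ge[OF \<nu> g2] by (rule less_le_trans) have "ereal (Psi (ereal (exp
  C))) < 1" using Psi_exp_less_1 by simp then show "limsup (\<lambda>i. ereal (TV (\<nu> i) (k
  i))) < 1" using limsup_TV_le[OF \<nu> g1] by (rule le_less_trans[rotated]) show "liminf
  (\<lambda>i. ereal (TV (\<nu> i) (k i))) \<le> limsup (\<lambda>i. ereal (TV (\<nu> i) (k i)))"
  by (rule Liminf_le_Limsup) simp qed

  lemma upper_profile_eq: "upper_profile Q \<tau> b c = limsup (\<lambda>n. ereal (TV n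
  (cutoff_step \<tau> b n c)))" by (simp add: upper_profile_def TV_eq)

  lemma lower_profile_eq: "lower_profile Q \<tau> b c = liminf (\<lambda>n. ereal (TV n
  (cutoff_step \<tau> b n c)))" by (simp add: lower_profile_def TV_eq)

  text
  \<open> A sufficient condition that holds when already every single window constant \<open>c \<noteq> 0\<close>
  leads to the extreme limits.
\<close>
lemma tv_cutoffI:
  assumes "\<forall>\<^sub>F n in sequentially. \<tau> n > 0" "(\<lambda>n. b n / \<tau> n) \<longlonglongrightarrow> 0"
    and above: "\<And>c. c > 0 \<Longrightarrow> (\<lambda>n. TV n (cutoff_step \<tau> b n c)) \<longlonglongrightarrow> 0"
    and below: "\<And>c. c < 0 \<Longrightarrow> (\<lambda>n. TV n (cutoff_step \<tau> b n c)) \<longlonglongrightarrow> 1"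
  shows "tv_cutoff Q \<tau> b"
  unfolding tv_cutoff_def
proof (intro conjI assms(1,2))
  have "upper_profile Q \<tau> b c = 0" if "c > 0" for c
    using above[OF that] unfolding upper_profile_eq zero_ereal_def
    by (intro lim_imp_Limsup) auto
  then show "(upper_profile Q \<tau> b \<longlongrightarrow> 0) at_top"
    by (intro tendsto_eventually eventually_mono[OF eventually_gt_at_top[of 0]])
  have "lower_profile Q \<tau> b c = 1" if "c < 0" for c
    using below[OF that] unfolding lower_profile_eq one_ereal_def
    by (intro lim_imp_Liminf) auto
  then show "(lower_profile Q \<tau> b \<longlongrightarrow> 1) at_bot"
    by (intro tendsto_eventually eventually_mono[OF eventually_gt_at_bot[of 0]]) auto
qed

end

section \<open>Unbounded numbers of packs\<close>

context shuffle_family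
begin

lemma ln_at_top_seq: "filterlim (\<lambda>n. 3 / 2 * ln (real n)) at_top sequentially"
  by real_asymp

lemma \<mu>_at_top:
  assumes "filterlim m at_top sequentially"
  shows "filterlim \<mu> at_top sequentially"
  unfolding \<mu>_eq[abs_def]
  by (rule filterlim_compose[OF ln_at_top filterlim_compose[OF filterlim_real_sequentially assms]])

text \<open>
  A lower bound for the absolute gap of all numbers of shuffles \<open>k\<close> on either side of
  \<open>nearest (t n)\<close>: such a \<open>k\<close> is at distance at least
  \<open>1 / 2\<close> from \<open>t n\<close>, except for \<open>k = 0\<close> when
  \<open>t n < 1 / 2\<close>, whose gap is
  \<open>\<mu> n * t n = 3 / 2 * ln n\<close>.
\<close>
definition far :: "nat \<Rightarrow> real" where
  "far n = min (\<mu> n / 2) (3 / 2 * ln (real n))"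

lemma far_at_top:
  assumes "filterlim m at_top sequentially"
  shows "filterlim far at_top sequentially"
proof -
  have "filterlim (\<lambda>n. 1/2 * \<mu> n) at_top sequentially"
    by (rule filterlim_tendsto_pos_mult_at_top[OF tendsto_const _ \<mu>_at_top[OF assms]]) simp
  then have "filterlim (\<lambda>n. \<mu> n / 2) at_top sequentially" by simp
  then show ?thesis unfolding far_def[abs_def] by (rule filterlim_min_at_top[OF _ ln_at_top_seq])
qed

lemma gap_ge:
  assumes "n \<ge> 2" "t n - real k \<ge> \<delta>"
  shows "gap n k \<ge> \<mu> n * \<delta>"
  unfolding gap_def using \<mu>_pos[of n] assms by (intro mult_left_mono) auto

lemma gap_le:
  assumes "n \<ge> 2" "real k - t n \<ge> \<delta>"
  shows "- gap n k \<ge> \<mu> n * \<delta>"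
proof -
  have "\<mu> n * \<delta> \<le> \<mu> n * (real k - t n)" using \<mu>_pos[of n] assms by (intro mult_left_mono) auto
  then show ?thesis by (simp add: gap_def algebra_simps)
qed

lemma gap_0: "n \<ge> 2 \<Longrightarrow> gap n 0 = 3 / 2 * ln (real n)"
  by (simp add: gap_def \<mu>_t)

lemma gap_below_far:
  assumes "n \<ge> 2" "real k < nearest (t n)"
  shows "gap n k \<ge> far n"
  using gap_below_nearest[OF assms(2)]
proof
  assume "t n < 1/2 \<and> k = 0"
  then show ?thesis using gap_0[OF assms(1)] by (simp add: far_def)
next
  assume "t n - real k \<ge> 1/2"
  from gap_ge[OF assms(1) this] show ?thesis by (simp add: far_def min.coboundedI1)
qed

lemma gap_above_far:
  assumes "n \<ge> 2" "real k > nearest (t n)"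
  shows "- gap n k \<ge> far n"
  using gap_le[OF assms(1) gap_above_nearest[OF assms(2)]] by (simp add: far_def min.coboundedI1)

lemma real_nat_ceiling_ge: "x \<le> real (nat \<lceil>x\<rceil>)"
  by linarith

lemma real_nat_floor_le: "0 \<le> x \<Longrightarrow> real (nat \<lfloor>x\<rfloor>) \<le> x"
  by linarith

lemma cutoff_nearest:
  assumes m: "filterlim m at_top sequentially"
    and b: "\<And>n. n \<ge> 1 \<Longrightarrow> b n > 0" "b \<longlonglongrightarrow> 0"
  shows "tv_cutoff Q (\<lambda>n. nearest (t n)) b"
proof (rule tv_cutoffI)
  have pos: "nearest x > 0" for x using nearest_ge_half[of x] by linarith
  show "\<forall>\<^sub>F n in sequentially. nearest (t n) > 0" by (simp add: pos)
  show "(\<lambda>n. b n / nearest (t n)) \<longlonglongrightarrow> 0"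
  proof (rule Lim_null_comparison)
    show "\<forall>\<^sub>F n in sequentially. norm (b n / nearest (t n)) \<le> 2 * \<bar>b n\<bar>"
    proof (rule always_eventually, rule allI)
      fix n
      have "\<bar>b n\<bar> * 1 \<le> \<bar>b n\<bar> * (2 * nearest (t n))"
        using nearest_ge_half[of "t n"] by (intro mult_left_mono) auto
      then show "norm (b n / nearest (t n)) \<le> 2 * \<bar>b n\<bar>"
        using pos[of "t n"] by (simp add: divide_le_eq mult_ac)
    qed
    show "(\<lambda>n. 2 * \<bar>b n\<bar>) \<longlonglongrightarrow> 0"
      using tendsto_mult[OF tendsto_const[of 2] tendsto_rabs_zero[OF b(2)]] by simp
  qed
  fix c :: real
  let ?k = "\<lambda>n. cutoff_step (\<lambda>n. nearest (t n)) b n c"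
  show "(\<lambda>n. TV n (?k n)) \<longlonglongrightarrow> 0" if c: "c > 0"
  proof (rule TV_tendsto_0[of "\<lambda>n. n"])
    show "filterlim (\<lambda>n. - gap n (?k n)) at_top sequentially"
    proof (rule filterlim_at_top_mono[OF far_at_top[OF m] eventually_mono[OF eventually_ge_at_top[of 2]]])
      fix n :: nat assume n: "2 \<le> n"
      have "0 < c * b n" using c b(1)[of n] n by simp
      then have "nearest (t n) < real (?k n)"
        using real_nat_ceiling_ge[of "nearest (t n) + c * b n"] c by (simp add: cutoff_step_def)
      then show "far n \<le> - gap n (?k n)" by (rule gap_above_far[OF n])
    qed
  qed (simp add: filterlim_ident)
  show "(\<lambda>n. TV n (?k n)) \<longlonglongrightarrow> 1" if c: "c < 0"
  proof (rule TV_tendsto_1[of "\<lambda>n. n"])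
    show "filterlim (\<lambda>n. gap n (?k n)) at_top sequentially"
    proof (rule filterlim_at_top_mono[OF far_at_top[OF m] eventually_mono[OF eventually_ge_at_top[of 2]]])
      fix n :: nat assume n: "2 \<le> n"
      have "c * b n < 0" using c b(1)[of n] n by (simp add: mult_neg_pos)
      then have "real (?k n) < nearest (t n)"
        using pos[of "t n"] c unfolding cutoff_step_def by simp linarith
      then show "far n \<le> gap n (?k n)" by (rule gap_below_far[OF n])
    qed
  qed (simp add: filterlim_ident)
qed

lemma INF_below_nearest:
  assumes "filterlim m at_top sequentially"
  shows "(\<lambda>n. INF k\<in>{k. real k < nearest (t n)}. TV n k) \<longlonglongrightarrow> 1"
proof (rule INF_TV_tendsto_1[OF far_at_top[OF assms] eventually_mono[OF eventually_ge_at_top[of 2]]], intro conjI)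
  fix n :: nat
  have "0 \<in> {k. real k < nearest (t n)}" using nearest_ge_half[of "t n"] by simp
  then show "{k. real k < nearest (t n)} \<noteq> {}" by blast
qed (simp add: gap_below_far)

lemma SUP_above_nearest:
  assumes "filterlim m at_top sequentially"
  shows "(\<lambda>n. SUP k\<in>{k. real k > nearest (t n)}. TV n k) \<longlonglongrightarrow> 0"
proof (rule SUP_TV_tendsto_0[OF far_at_top[OF assms] eventually_mono[OF eventually_ge_at_top[of 2]]], intro conjI)
  fix n :: nat
  show "{k. real k > nearest (t n)} \<noteq> {}" using reals_Archimedean2[of "nearest (t n)"] by blast
qed (simp add: gap_above_far)

text \<open>
  A lower bound for the absolute gap of all numbers of shuffles \<open>k\<close>: if
  \<open>t n \<ge> 1 / 2\<close>, no integer is closer to \<open>t n\<close> than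
  \<open>\<bar>dev (t n)\<bar>\<close>, and if \<open>t n < 1 / 2\<close>, the argument for
  \<open>far\<close> covers \<open>k = 0\<close> and all \<open>k \<ge> 1\<close> alike.
\<close>
definition near :: "nat \<Rightarrow> real" where
  "near n = min (\<bar>dev (t n)\<bar> * \<mu> n) (far n)"

lemma near_at_top:
  assumes "filterlim m at_top sequentially" "filterlim (\<lambda>n. \<bar>dev (t n)\<bar> * \<mu> n) at_top sequentially"
  shows "filterlim near at_top sequentially"
  unfolding near_def[abs_def] by (rule filterlim_min_at_top[OF assms(2) far_at_top[OF assms(1)]])

lemma gap_below_near:
  assumes n: "n \<ge> 2" and k: "real k \<le> t n"
  shows "gap n k \<ge> near n"
proof (cases "t n < 1/2")
  case True
  then have "k = 0" using k by (cases k) auto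
  then show ?thesis using gap_0[OF n] by (simp add: near_def far_def)
next
  case False
  then have "t n - real k \<ge> \<bar>dev (t n)\<bar>" using abs_dev_le[of "t n" k] k by simp
  from gap_ge[OF n this] show ?thesis by (simp add: near_def mult.commute min.coboundedI1)
qed

lemma gap_above_near:
  assumes n: "n \<ge> 2" and k: "real k \<ge> t n"
  shows "- gap n k \<ge> near n"
proof (cases "t n < 1/2")
  case True
  then have "k > 0" using k t_pos[OF n] by (cases k) auto
  then have "real k - t n \<ge> 1/2" using True by (cases k) auto
  from gap_le[OF n this] show ?thesis by (simp add: near_def far_def min.coboundedI1 min.coboundedI2)
next
  case False
  then have "real k - t n \<ge> \<bar>dev (t n)\<bar>" using abs_dev_le[of "t n" k] k by simp
  from gap_le[OF n this] show ?thesis by (simp add: near_def mult.commute min.coboundedI1)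
qed

lemma eventually_t_pos: "\<forall>\<^sub>F n in sequentially. t n > 0"
  by (rule eventually_mono[OF eventually_ge_at_top[of 2] t_pos])

lemma cutoff_window_0:
  assumes "filterlim m at_top sequentially" "filterlim (\<lambda>n. \<bar>dev (t n)\<bar> * \<mu> n) at_top sequentially"
  shows "tv_cutoff Q t (\<lambda>n. 0)"
proof (rule tv_cutoffI[OF eventually_t_pos])
  note near = near_at_top[OF assms]
  fix c :: real
  let ?k = "\<lambda>n. cutoff_step t (\<lambda>n. 0) n c"
  show "(\<lambda>n. TV n (?k n)) \<longlonglongrightarrow> 0" if c: "c > 0"
  proof (rule TV_tendsto_0[of "\<lambda>n. n"])
    show "filterlim (\<lambda>n. - gap n (?k n)) at_top sequentially"
      by (rule filterlim_at_top_mono[OF near eventually_mono[OF eventually_ge_at_top[of 2]]],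
          rule gap_above_near) (use c real_nat_ceiling_ge in \<open>auto simp: cutoff_step_def\<close>)
  qed (simp add: filterlim_ident)
  show "(\<lambda>n. TV n (?k n)) \<longlonglongrightarrow> 1" if c: "c < 0"
  proof (rule TV_tendsto_1[of "\<lambda>n. n"])
    show "filterlim (\<lambda>n. gap n (?k n)) at_top sequentially"
    proof (rule filterlim_at_top_mono[OF near eventually_mono[OF eventually_ge_at_top[of 2]]])
      fix n :: nat assume n: "2 \<le> n"
      have "real (?k n) \<le> t n"
        using c real_nat_floor_le[of "t n"] t_pos[OF n] by (simp add: cutoff_step_def)
      then show "near n \<le> gap n (?k n)" by (rule gap_below_near[OF n])
    qed
  qed (simp add: filterlim_ident)
qed simp

lemma INF_upto_t:
  assumes "filterlim m at_top sequentially" "filterlim (\<lambda>n. \<bar>dev (t n)\<bar> * \<mu> n) at_top sequentially"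
  shows "(\<lambda>n. INF k\<in>{k. real k \<le> t n}. TV n k) \<longlonglongrightarrow> 1"
proof (rule INF_TV_tendsto_1[OF near_at_top[OF assms] eventually_mono[OF eventually_ge_at_top[of 2]]], intro conjI)
  fix n :: nat assume "2 \<le> n"
  then have "0 \<in> {k. real k \<le> t n}" using t_pos[of n] by simp
  then show "{k. real k \<le> t n} \<noteq> {}" by blast
qed (simp add: gap_below_near)

lemma SUP_from_t:
  assumes "filterlim m at_top sequentially" "filterlim (\<lambda>n. \<bar>dev (t n)\<bar> * \<mu> n) at_top sequentially"
  shows "(\<lambda>n. SUP k\<in>{k. real k \<ge> t n}. TV n k) \<longlonglongrightarrow> 0"
proof (rule SUP_TV_tendsto_0[OF near_at_top[OF assms] eventually_mono[OF eventually_ge_at_top[of 2]]], intro conjI)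
  fix n :: nat
  show "{k. real k \<ge> t n} \<noteq> {}" using real_arch_simple[of "t n"] by blast
qed (simp add: gap_above_near)

lemma gap_nearest:
  assumes "t n \<ge> 1/2"
  shows "gap n (nat \<lfloor>nearest (t n)\<rfloor>) = dev (t n) * \<mu> n"
  using assms by (simp add: gap_def nearest_eq_nat dev_def)

text \<open>
  If \<open>t n < 1 / 2\<close>, then
  \<open>dev (t n) * \<mu> n = \<mu> n / 2\<close>, which is eventually larger than any
  constant.
\<close>
lemma large_t_of_bounded_dev:
  assumes m: "filterlim m at_top sequentially" and \<nu>: "filterlim \<nu> at_top sequentially"
    and C: "\<forall>\<^sub>F i in sequentially. dev (t (\<nu> i)) * \<mu> (\<nu> i) < C"
  shows "\<forall>\<^sub>F i in sequentially. t (\<nu> i) \<ge> 1/2"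
proof -
  have "\<forall>\<^sub>F i in sequentially. \<mu> (\<nu> i) \<ge> 2 * C"
    using filterlim_compose[OF \<mu>_at_top[OF m] \<nu>] by (simp add: filterlim_at_top)
  with C show ?thesis
  proof eventually_elim
    case (elim i)
    show ?case
    proof (rule ccontr)
      assume "\<not> t (\<nu> i) \<ge> 1/2"
      then show False using elim by (simp add: dev_def)
    qed
  qed
qed

text \<open>
  The gap at the nearest integer is \<open>dev (t n) * \<mu> n\<close> if
  \<open>t n \<ge> 1 / 2\<close>. The other case can only occur infinitely often if
  \<open>L = \<infinity>\<close>, and then the gap at \<open>k = 0\<close> tends to infinity,
  too.
\<close>
lemma TV_nearest_tendsto:
  assumes m: "filterlim m at_top sequentially"
    and L: "(\<lambda>n. ereal (dev (t n) * \<mu> n)) \<longlonglongrightarrow> L"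
  shows "(\<lambda>n. TV n (nat \<lfloor>nearest (t n)\<rfloor>)) \<longlonglongrightarrow> Psi (exp_ereal L)"
proof (rule TV_tendsto[of "\<lambda>n. n"])
  let ?k = "\<lambda>n. nat \<lfloor>nearest (t n)\<rfloor>"
  show "(\<lambda>n. ereal (gap n (?k n))) \<longlonglongrightarrow> L"
  proof (cases "L = \<infinity>")
    case True
    then have d: "filterlim (\<lambda>n. dev (t n) * \<mu> n) at_top sequentially"
      using L by (simp add: tendsto_PInfty_eq_at_top)
    have "filterlim (\<lambda>n. gap n (?k n)) at_top sequentially"
    proof (rule filterlim_at_top_mono[OF filterlim_min_at_top[OF d ln_at_top_seq]
          eventually_mono[OF eventually_ge_at_top[of 2]]])
      fix n :: nat assume n: "2 \<le> n"
      show "min (dev (t n) * \<mu> n) (3 / 2 * ln (real n)) \<le> gap n (?k n)"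
      proof (cases "t n < 1/2")
        case True
        then have "?k n = 0" by (simp add: nearest_def)
        then show ?thesis using gap_0[OF n] by simp
      qed (simp add: gap_nearest)
    qed
    then show ?thesis using True by (simp add: tendsto_PInfty_eq_at_top)
  next
    case False
    then obtain C where "L < ereal C" by (metis ereal_dense2 less_PInf_Ex_of_nat ereal_infty_less(1))
    from order_tendstoD(2)[OF L this]
    have "\<forall>\<^sub>F n in sequentially. dev (t n) * \<mu> n < C" by simp
    from large_t_of_bounded_dev[OF m filterlim_ident this]
    have "\<forall>\<^sub>F n in sequentially. ereal (gap n (?k n)) = ereal (dev (t n) * \<mu> n)"
      by eventually_elim (simp add: gap_nearest)
    then show ?thesis using L by (rule tendsto_cong[THEN iffD2])
  qed
qed (simp add: filterlim_ident)

lemma bounded_dev_subsequence: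
  assumes m: "filterlim m at_top sequentially"
    and dev: "liminf (\<lambda>n. ereal (\<bar>dev (t n)\<bar> * \<mu> n)) < \<infinity>"
  obtains N C where "filterlim N at_top sequentially" "\<And>i. t (N i) \<ge> 1/2"
    "\<And>i. \<bar>gap (N i) (nat \<lfloor>nearest (t (N i))\<rfloor>)\<bar> \<le> C"
proof -
  let ?u = "\<lambda>n. ereal (\<bar>dev (t n)\<bar> * \<mu> n)"
  obtain r where r: "strict_mono r" "(?u \<circ> r) \<longlonglongrightarrow> liminf ?u"
    using liminf_subseq_lim by blast
  obtain C where "liminf ?u < ereal C"
    using dev by (metis ereal_dense2)
  from order_tendstoD(2)[OF r(2) this]
  have C: "\<forall>\<^sub>F i in sequentially. \<bar>dev (t (r i))\<bar> * \<mu> (r i) < C" by simp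
  have r1: "\<forall>\<^sub>F i in sequentially. r i \<ge> 1"
    using filterlim_subseq[OF r(1)] by (simp add: filterlim_at_top)
  have C': "\<forall>\<^sub>F i in sequentially. dev (t (r i)) * \<mu> (r i) < C"
    using C r1
  proof eventually_elim
    case (elim i)
    have "dev (t (r i)) * \<mu> (r i) \<le> \<bar>dev (t (r i))\<bar> * \<mu> (r i)"
      using \<mu>_pos[OF elim(2)] by (intro mult_right_mono) auto
    then show ?case using elim(1) by simp
  qed
  from large_t_of_bounded_dev[OF m filterlim_subseq[OF r(1)] C'] C r1
  have "\<forall>\<^sub>F i in sequentially. t (r i) \<ge> 1/2 \<and> \<bar>dev (t (r i))\<bar> * \<mu> (r i) < C \<and> r i \<ge> 1"
    by eventually_elim simp
  then obtain i0 where i0: "\<And>i. i \<ge> i0 \<Longrightarrow> t (r i) \<ge> 1/2 \<and> \<bar>dev (t (r i))\<bar> * \<mu> (r i) < C \<and> r i \<ge> 1"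
    by (auto simp: eventually_sequentially)
  show ?thesis
  proof
    show "filterlim (\<lambda>i. r (i + i0)) at_top sequentially"
      by (rule filterlim_compose[OF filterlim_subseq[OF r(1)] filterlim_add_const_nat_at_top])
    fix i
    have i: "t (r (i + i0)) \<ge> 1/2" "\<bar>dev (t (r (i + i0)))\<bar> * \<mu> (r (i + i0)) < C" "r (i + i0) \<ge> 1"
      using i0[of "i + i0"] by auto
    show "t (r (i + i0)) \<ge> 1/2" by (rule i(1))
    show "\<bar>gap (r (i + i0)) (nat \<lfloor>nearest (t (r (i + i0)))\<rfloor>)\<bar> \<le> C"
      using i \<mu>_pos[OF i(3)] by (simp add: gap_nearest abs_mult)
  qed
qed

text \<open>
  With window size \<open>0\<close> the number of steps depends on the sign of \<open>c\<close>
  only, so the profiles are constant on either side and equal to their limits.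
\<close>
lemma constant_cutoff_step_limits:
  assumes "tv_cutoff Q t (\<lambda>n. 0)"
  shows "liminf (\<lambda>n. ereal (TV n (nat \<lfloor>t n\<rfloor>))) = 1" "limsup (\<lambda>n. ereal (TV n (nat \<lceil>t n\<rceil>))) = 0"
proof -
  have "\<forall>\<^sub>F c in at_bot. lower_profile Q t (\<lambda>n. 0) c = liminf (\<lambda>n. ereal (TV n (nat \<lfloor>t n\<rfloor>)))"
    by (rule eventually_mono[OF eventually_gt_at_bot[of 0]])
       (simp add: lower_profile_eq cutoff_step_def)
  then have "(lower_profile Q t (\<lambda>n. 0) \<longlongrightarrow> liminf (\<lambda>n. ereal (TV n (nat \<lfloor>t n\<rfloor>)))) at_bot"
    by (rule tendsto_eventually)
  then show "liminf (\<lambda>n. ereal (TV n (nat \<lfloor>t n\<rfloor>))) = 1"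
    using assms unfolding tv_cutoff_def by (metis tendsto_unique trivial_limit_at_bot_linorder)
  have "\<forall>\<^sub>F c in at_top. upper_profile Q t (\<lambda>n. 0) c = limsup (\<lambda>n. ereal (TV n (nat \<lceil>t n\<rceil>)))"
    by (rule eventually_mono[OF eventually_gt_at_top[of 0]])
       (simp add: upper_profile_eq cutoff_step_def)
  then have "(upper_profile Q t (\<lambda>n. 0) \<longlongrightarrow> limsup (\<lambda>n. ereal (TV n (nat \<lceil>t n\<rceil>)))) at_top"
    by (rule tendsto_eventually)
  then show "limsup (\<lambda>n. ereal (TV n (nat \<lceil>t n\<rceil>))) = 0"
    using assms unfolding tv_cutoff_def by (metis tendsto_unique trivial_limit_at_top_linorder)
qed

text \<open>
  The nearest integer is the floor or the ceiling of \<open>t n\<close>. A cutoff would force the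
  distance to tend to \<open>1\<close> at the floor and to \<open>0\<close> at the ceiling.
\<close>
lemma no_window_0_cutoff:
  assumes N: "filterlim N at_top sequentially" and t: "\<And>i. t (N i) \<ge> 1/2"
    and pos: "0 < liminf (\<lambda>i. ereal (TV (N i) (nat \<lfloor>nearest (t (N i))\<rfloor>)))"
    and less_1: "limsup (\<lambda>i. ereal (TV (N i) (nat \<lfloor>nearest (t (N i))\<rfloor>))) < 1"
  shows "\<not> tv_cutoff Q t (\<lambda>n. 0)"
proof
  assume "tv_cutoff Q t (\<lambda>n. 0)"
  note lim = constant_cutoff_step_limits[OF this]
  obtain p where p: "limsup (\<lambda>i. ereal (TV (N i) (nat \<lfloor>nearest (t (N i))\<rfloor>))) < p" "p < 1"
    using dense[OF less_1] by blast
  obtain q where q: "0 < q" "q < liminf (\<lambda>i. ereal (TV (N i) (nat \<lfloor>nearest (t (N i))\<rfloor>)))"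
    using dense[OF pos] by blast
  have 1: "\<forall>\<^sub>F i in sequentially. p < ereal (TV (N i) (nat \<lfloor>t (N i)\<rfloor>))"
    using less_LiminfD[of p sequentially "\<lambda>n. ereal (TV n (nat \<lfloor>t n\<rfloor>))"] p(2) lim(1)
    by (intro eventually_compose_filterlim[OF _ N]) simp
  have 2: "\<forall>\<^sub>F i in sequentially. ereal (TV (N i) (nat \<lceil>t (N i)\<rceil>)) < q"
    using Limsup_lessD[of sequentially "\<lambda>n. ereal (TV n (nat \<lceil>t n\<rceil>))" q] q(1) lim(2)
    by (intro eventually_compose_filterlim[OF _ N]) simp
  have "\<forall>\<^sub>F i in sequentially. False"
    using 1 2 Limsup_lessD[OF p(1)] less_LiminfD[OF q(2)]
  proof eventually_elim
    case (elim i)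
    have "nearest (t (N i)) = real_of_int (round (t (N i)))" using t[of i] by (simp add: nearest_def)
    then have "nat \<lfloor>nearest (t (N i))\<rfloor> = nat \<lfloor>t (N i)\<rfloor> \<or> nat \<lfloor>nearest (t (N i))\<rfloor> = nat \<lceil>t (N i)\<rceil>"
      by (auto simp: round_altdef)
    then show False using elim by (metis less_asym)
  qed
  then show False by simp
qed

section \<open>Bounded numbers of packs\<close>

context
  fixes B :: nat
  assumes B: "\<And>n. n \<ge> 1 \<Longrightarrow> m n \<le> B"
begin

lemma \<mu>_le: "n \<ge> 1 \<Longrightarrow> \<mu> n \<le> ln (real B)"
  using B[of n] m_gt_1[of n] by (simp add: \<mu>_eq)

lemma ln_B_pos: "ln (real B) > 0"
  using \<mu>_le[of 1] \<mu>_pos[of 1] by simp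

lemma t_at_top: "filterlim t at_top sequentially"
proof (rule filterlim_at_top_mono[OF _ eventually_mono[OF eventually_ge_at_top[of 2]]])
  show "filterlim (\<lambda>n. 3 * ln (real n) / (2 * ln (real B))) at_top sequentially"
    using ln_B_pos by real_asymp
  fix n :: nat assume n: "2 \<le> n"
  show "3 * ln (real n) / (2 * ln (real B)) \<le> t n"
    using n \<mu>_pos[of n] \<mu>_le[of n] by (simp add: t_eq) (intro divide_left_mono, auto)
qed

lemma bounded_gap:
  assumes "n \<ge> 2" "\<bar>t n - real k\<bar> \<le> C"
  shows "\<bar>gap n k\<bar> \<le> ln (real B) * C"
  unfolding gap_def abs_mult using assms \<mu>_pos[of n] \<mu>_le[of n] by (intro mult_mono) auto

lemma cutoff_step_above:
  assumes "n \<ge> 2" "c > 0"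
  shows "gap n (cutoff_step t (\<lambda>n. 1) n c) \<le> - (ln 2 * c)" "\<bar>t n - real (cutoff_step t (\<lambda>n. 1) n c)\<bar> \<le> c + 1"
proof -
  have k: "real (cutoff_step t (\<lambda>n. 1) n c) = real_of_int \<lceil>t n + c\<rceil>"
    using assms t_pos[OF assms(1)] by (simp add: cutoff_step_def)
  have "\<mu> n * c \<ge> ln 2 * c" using \<mu>_ge[of n] assms by (intro mult_right_mono) auto
  moreover have "- gap n (cutoff_step t (\<lambda>n. 1) n c) \<ge> \<mu> n * c"
    by (rule gap_le[OF assms(1)]) (unfold k, linarith)
  ultimately show "gap n (cutoff_step t (\<lambda>n. 1) n c) \<le> - (ln 2 * c)" by linarith
  show "\<bar>t n - real (cutoff_step t (\<lambda>n. 1) n c)\<bar> \<le> c + 1"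
    unfolding k using assms(2) by linarith
qed

lemma cutoff_step_below:
  assumes "n \<ge> 2" "c < 0" "t n + c \<ge> 0"
  shows "gap n (cutoff_step t (\<lambda>n. 1) n c) \<ge> - (ln 2 * c)" "\<bar>t n - real (cutoff_step t (\<lambda>n. 1) n c)\<bar> \<le> - c + 1"
proof -
  have k: "real (cutoff_step t (\<lambda>n. 1) n c) = real_of_int \<lfloor>t n + c\<rfloor>"
    using assms by (simp add: cutoff_step_def)
  have "\<mu> n * (- c) \<ge> ln 2 * (- c)" using \<mu>_ge[of n] assms by (intro mult_right_mono) auto
  moreover have "gap n (cutoff_step t (\<lambda>n. 1) n c) \<ge> \<mu> n * (- c)"
    by (rule gap_ge[OF assms(1)]) (unfold k, linarith)
  ultimately show "gap n (cutoff_step t (\<lambda>n. 1) n c) \<ge> - (ln 2 * c)" by simp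
  show "\<bar>t n - real (cutoff_step t (\<lambda>n. 1) n c)\<bar> \<le> - c + 1"
    unfolding k using assms(2) by linarith
qed

lemma eventually_below: "\<forall>\<^sub>F n in sequentially. n \<ge> 2 \<and> t n + c \<ge> 0"
  using filterlim_at_top[THEN iffD1, OF t_at_top, rule_format, of "- c"] eventually_ge_at_top[of 2]
  by eventually_elim auto

text \<open>
  At window constant \<open>c\<close> the gap is at most \<open>- c * ln 2\<close> for
  \<open>c > 0\<close> and at least \<open>- c * ln 2\<close> for \<open>c < 0\<close>,
  because \<open>\<mu> n \<ge> ln 2\<close>. So the profiles are squeezed by
  \<open>Psi (exp (- c * ln 2))\<close>.
\<close>
lemma cutoff_window_1: "tv_cutoff Q t (\<lambda>n. 1)"
  unfolding tv_cutoff_def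
proof (intro conjI eventually_t_pos)
  show "(\<lambda>n. 1 / t n) \<longlonglongrightarrow> 0"
    by (rule tendsto_divide_0[OF tendsto_const filterlim_at_top_imp_at_infinity[OF t_at_top]])
  have "filterlim (\<lambda>c::real. - (ln 2 * c)) at_bot at_top" by real_asymp
  from filterlim_compose[OF Psi_exp_at_bot this]
  have lim0: "((\<lambda>c. ereal (Psi (ereal (exp (- (ln 2 * c)))))) \<longlongrightarrow> 0) at_top" by (simp add: zero_ereal_def)
  show "(upper_profile Q t (\<lambda>n. 1) \<longlongrightarrow> 0) at_top"
  proof (rule tendsto_sandwich[OF _ _ tendsto_const lim0])
    show "\<forall>\<^sub>F c in at_top. 0 \<le> upper_profile Q t (\<lambda>n. 1) c"
      unfolding upper_profile_eq by (intro always_eventually allI le_Limsup) (auto simp: TV_nonneg)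
    show "\<forall>\<^sub>F c in at_top. upper_profile Q t (\<lambda>n. 1) c \<le> ereal (Psi (ereal (exp (- (ln 2 * c)))))"
      unfolding upper_profile_eq
      by (rule eventually_mono[OF eventually_gt_at_top[of 0]], rule limsup_TV_le[OF filterlim_ident],
          rule eventually_mono[OF eventually_ge_at_top[of 2]]) (rule cutoff_step_above(1))
  qed
  have "filterlim (\<lambda>c::real. - (ln 2 * c)) at_top at_bot" by real_asymp
  from filterlim_compose[OF Psi_exp_at_top this]
  have lim1: "((\<lambda>c. ereal (Psi (ereal (exp (- (ln 2 * c)))))) \<longlongrightarrow> 1) at_bot" by (simp add: one_ereal_def)
  show "(lower_profile Q t (\<lambda>n. 1) \<longlongrightarrow> 1) at_bot"
  proof (rule tendsto_sandwich[OF _ _ lim1 tendsto_const])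
    show "\<forall>\<^sub>F c in at_bot. lower_profile Q t (\<lambda>n. 1) c \<le> 1"
      unfolding lower_profile_eq by (intro always_eventually allI Liminf_le) (auto simp: TV_le_1)
    show "\<forall>\<^sub>F c in at_bot. ereal (Psi (ereal (exp (- (ln 2 * c))))) \<le> lower_profile Q t (\<lambda>n. 1) c"
      unfolding lower_profile_eq
      by (rule eventually_mono[OF eventually_gt_at_bot[of 0]], rule liminf_TV_ge[OF filterlim_ident],
          rule eventually_mono[OF eventually_below]) (auto intro: cutoff_step_below(1))
  qed
qed

text \<open>
  At a fixed window constant the gap is bounded, because \<open>\<mu>\<close> is.
\<close>
lemma optimal_cutoff_window_1: "optimal_tv_cutoff Q t (\<lambda>n. 1)"
  unfolding optimal_tv_cutoff_def
proof (intro conjI allI impI cutoff_window_1)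
  fix c :: real assume c: "c > 0"
  have "\<forall>\<^sub>F n in sequentially. \<bar>gap n (cutoff_step t (\<lambda>n. 1) n c)\<bar> \<le> ln (real B) * (c + 1)"
    using eventually_ge_at_top[of 2]
    by eventually_elim (rule bounded_gap, simp, rule cutoff_step_above(2)[OF _ c])
  from TV_nondegenerate(1)[OF filterlim_ident this]
  show "0 < lower_profile Q t (\<lambda>n. 1) c" unfolding lower_profile_eq .
  have "\<forall>\<^sub>F n in sequentially. \<bar>gap n (cutoff_step t (\<lambda>n. 1) n (- c))\<bar> \<le> ln (real B) * (- (- c) + 1)"
    using eventually_below[of "- c"]
    by eventually_elim (rule bounded_gap, simp, rule cutoff_step_below(2), use c in auto)
  from TV_nondegenerate(3)[OF filterlim_ident this]
  show "upper_profile Q t (\<lambda>n. 1) (- c) < 1" unfolding upper_profile_eq .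
qed

lemma eventually_bounded_gap_nearest:
  "\<forall>\<^sub>F n in sequentially. \<bar>gap n (nat (\<lfloor>nearest (t n)\<rfloor> + k))\<bar> \<le> ln (real B) * (1/2 + \<bar>real_of_int k\<bar>)"
  using filterlim_at_top[THEN iffD1, OF t_at_top, rule_format, of "1/2 + \<bar>real_of_int k\<bar>"]
    eventually_ge_at_top[of 2]
proof eventually_elim
  case (elim n)
  have t: "t n \<ge> 1/2" using elim by linarith
  then have near: "real_of_int \<lfloor>nearest (t n)\<rfloor> = nearest (t n)" by (simp add: nearest_def)
  have d: "\<bar>t n - nearest (t n)\<bar> \<le> 1/2" using t by (rule abs_nearest_diff_le)
  then have "nearest (t n) + real_of_int k \<ge> 0" using elim(1) by linarith
  then have "real_of_int (\<lfloor>nearest (t n)\<rfloor> + k) \<ge> 0" by (simp only: of_int_add near)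
  then have "\<lfloor>nearest (t n)\<rfloor> + k \<ge> 0" by linarith
  then have k: "real (nat (\<lfloor>nearest (t n)\<rfloor> + k)) = nearest (t n) + real_of_int k" using near by simp
  show ?case
  proof (rule bounded_gap[OF elim(2)])
    show "\<bar>t n - real (nat (\<lfloor>nearest (t n)\<rfloor> + k))\<bar> \<le> 1/2 + \<bar>real_of_int k\<bar>"
      unfolding k using d by linarith
  qed
qed

end

end

section \<open>The cutoff theorem\<close>

theorem theorem3p2:
  fixes m :: "nat \<Rightarrow> nat" and \<mu> t :: "nat \<Rightarrow> real"
    and Q :: "nat \<Rightarrow> (nat \<Rightarrow> nat) pmf" and TV :: "nat \<Rightarrow> nat \<Rightarrow> real"
  assumes m_gt_1: "\<And>n. n \<ge> 1 \<Longrightarrow> m n > 1"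
    and \<mu>_eq: "\<And>n. \<mu> n = ln (real (m n))"
    and t_eq: "\<And>n. n \<ge> 2 \<Longrightarrow> t n = 3 * ln (real n) / (2 * \<mu> n)"
    and Q_eq: "\<And>n. Q n = shuffle n (m n)"
    and TV_eq: "\<And>n k. TV n k = tv_dist (convolution_power (Q n) k) (uniform_perm n)"
  shows
    "(filterlim m at_top sequentially \<longrightarrow>
       \<comment> \<open>(A1)\<close>
       ((\<forall>b. (\<forall>n\<ge>1. b n > 0) \<and> b \<longlonglongrightarrow> 0 \<longrightarrow> tv_cutoff Q (\<lambda>n. nearest (t n)) b) \<and>
        (\<lambda>n. INF k\<in>{k. real k < nearest (t n)}. TV n k) \<longlonglongrightarrow> 1 \<and>
        (\<lambda>n. SUP k\<in>{k. real k > nearest (t n)}. TV n k) \<longlonglongrightarrow> 0) \<and>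
       \<comment> \<open>(A2)\<close>
       (filterlim (\<lambda>n. \<bar>dev (t n)\<bar> * \<mu> n) at_top sequentially \<longrightarrow>
         tv_cutoff Q t (\<lambda>n. 0) \<and>
         (\<lambda>n. INF k\<in>{k. real k \<le> t n}. TV n k) \<longlonglongrightarrow> 1 \<and>
         (\<lambda>n. SUP k\<in>{k. real k \<ge> t n}. TV n k) \<longlonglongrightarrow> 0) \<and>
       \<comment> \<open>(A3)\<close>
       (liminf (\<lambda>n. ereal (\<bar>dev (t n)\<bar> * \<mu> n)) < \<infinity> \<longrightarrow>
         (\<exists>N :: nat \<Rightarrow> nat. filterlim N at_top sequentially \<and> (\<forall>i. t (N i) \<ge> 1/2) \<and>
            0 < liminf (\<lambda>i. ereal (TV (N i) (nat \<lfloor>nearest (t (N i))\<rfloor>))) \<and>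
            liminf (\<lambda>i. ereal (TV (N i) (nat \<lfloor>nearest (t (N i))\<rfloor>))) \<le>
              limsup (\<lambda>i. ereal (TV (N i) (nat \<lfloor>nearest (t (N i))\<rfloor>))) \<and>
            limsup (\<lambda>i. ereal (TV (N i) (nat \<lfloor>nearest (t (N i))\<rfloor>))) < 1) \<and>
         \<not> tv_cutoff Q t (\<lambda>n. 0)) \<and>
       \<comment> \<open>(A4)\<close>
       (\<forall>L :: ereal. (\<lambda>n. ereal (dev (t n) * \<mu> n)) \<longlonglongrightarrow> L \<longrightarrow>
         (\<lambda>n. TV n (nat \<lfloor>nearest (t n)\<rfloor>)) \<longlonglongrightarrow> Psi (exp_ereal L))) \<and>
     \<comment> \<open>(B)\<close>
     ((\<exists>B. \<forall>n\<ge>1. m n \<le> B) \<longrightarrow>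
       filterlim t at_top sequentially \<and>
       tv_cutoff Q t (\<lambda>n. 1) \<and>
       (\<forall>k :: int.
          0 < liminf (\<lambda>n. ereal (TV n (nat (\<lfloor>nearest (t n)\<rfloor> + k)))) \<and>
          liminf (\<lambda>n. ereal (TV n (nat (\<lfloor>nearest (t n)\<rfloor> + k)))) \<le>
            limsup (\<lambda>n. ereal (TV n (nat (\<lfloor>nearest (t n)\<rfloor> + k)))) \<and>
          limsup (\<lambda>n. ereal (TV n (nat (\<lfloor>nearest (t n)\<rfloor> + k)))) < 1) \<and>
       optimal_tv_cutoff Q t (\<lambda>n. 1))"
proof -
  interpret shuffle_family m \<mu> t Q TV
    by unfold_locales (fact m_gt_1 \<mu>_eq t_eq Q_eq TV_eq)+
  show ?thesis
  proof (intro conjI impI allI)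
    assume m: "filterlim m at_top sequentially"
    show "tv_cutoff Q (\<lambda>n. nearest (t n)) b" if "(\<forall>n\<ge>1. b n > 0) \<and> b \<longlonglongrightarrow> 0" for b
      using that by (intro cutoff_nearest[OF m]) auto
    show "(\<lambda>n. INF k\<in>{k. real k < nearest (t n)}. TV n k) \<longlonglongrightarrow> 1"
      by (rule INF_below_nearest[OF m])
    show "(\<lambda>n. SUP k\<in>{k. real k > nearest (t n)}. TV n k) \<longlonglongrightarrow> 0"
      by (rule SUP_above_nearest[OF m])
    {
      assume d: "filterlim (\<lambda>n. \<bar>dev (t n)\<bar> * \<mu> n) at_top sequentially"
      show "tv_cutoff Q t (\<lambda>n. 0)" by (rule cutoff_window_0[OF m d])
      show "(\<lambda>n. INF k\<in>{k. real k \<le> t n}. TV n k) \<longlonglongrightarrow> 1" by (rule INF_upto_t[OF m d])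
      show "(\<lambda>n. SUP k\<in>{k. real k \<ge> t n}. TV n k) \<longlonglongrightarrow> 0" by (rule SUP_from_t[OF m d])
    }
    {
      assume d: "liminf (\<lambda>n. ereal (\<bar>dev (t n)\<bar> * \<mu> n)) < \<infinity>"
      obtain N C where N: "filterlim N at_top sequentially" "\<And>i. t (N i) \<ge> 1/2"
        and C: "\<And>i. \<bar>gap (N i) (nat \<lfloor>nearest (t (N i))\<rfloor>)\<bar> \<le> C"
        using bounded_dev_subsequence[OF m d] by blast
      note bounds = TV_nondegenerate[OF N(1) always_eventually[OF allI[OF C]]]
      show "\<exists>N :: nat \<Rightarrow> nat. filterlim N at_top sequentially \<and> (\<forall>i. t (N i) \<ge> 1/2) \<and>
            0 < liminf (\<lambda>i. ereal (TV (N i) (nat \<lfloor>nearest (t (N i))\<rfloor>))) \<and>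
            liminf (\<lambda>i. ereal (TV (N i) (nat \<lfloor>nearest (t (N i))\<rfloor>))) \<le>
              limsup (\<lambda>i. ereal (TV (N i) (nat \<lfloor>nearest (t (N i))\<rfloor>))) \<and>
            limsup (\<lambda>i. ereal (TV (N i) (nat \<lfloor>nearest (t (N i))\<rfloor>))) < 1"
        using N bounds by (intro exI[of _ N] conjI allI)
      show "\<not> tv_cutoff Q t (\<lambda>n. 0)"
        by (rule no_window_0_cutoff[OF N bounds(1,3)])
    }
    show "(\<lambda>n. TV n (nat \<lfloor>nearest (t n)\<rfloor>)) \<longlonglongrightarrow> Psi (exp_ereal L)"
      if "(\<lambda>n. ereal (dev (t n) * \<mu> n)) \<longlonglongrightarrow> L" for L :: ereal
      by (rule TV_nearest_tendsto[OF m that])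
  next
    assume "\<exists>B. \<forall>n\<ge>1. m n \<le> B"
    then obtain B where B: "\<And>n. n \<ge> 1 \<Longrightarrow> m n \<le> B" by blast
    show "filterlim t at_top sequentially" by (rule t_at_top[OF B])
    show "tv_cutoff Q t (\<lambda>n. 1)" by (rule cutoff_window_1[OF B])
    show "optimal_tv_cutoff Q t (\<lambda>n. 1)" by (rule optimal_cutoff_window_1[OF B])
    fix k :: int
    note bounds = TV_nondegenerate[OF filterlim_ident eventually_bounded_gap_nearest[OF B, of k]]
    show "0 < liminf (\<lambda>n. ereal (TV n (nat (\<lfloor>nearest (t n)\<rfloor> + k))))" by (rule bounds(1))
    show "liminf (\<lambda>n. ereal (TV n (nat (\<lfloor>nearest (t n)\<rfloor> + k)))) \<le>
        limsup (\<lambda>n. ereal (TV n (nat (\<lfloor>nearest (t n)\<rfloor> + k))))" by (rule bounds(2))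
    show "limsup (\<lambda>n. ereal (TV n (nat (\<lfloor>nearest (t n)\<rfloor> + k)))) < 1" by (rule bounds(3))
  qed
qed

end
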